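(* The pair $({}^{\mathrm{odd}}MU_*,F')$ is universal for pairs $(R,G)$ consisting of a $\mathbb{Z}[1/2]$-algebra $R$ together with an odd formal group law $G$ on $R$. That is, $F'$ is an odd formal group law over ${}^{\mathrm{odd}}MU_*$, and for every such pair $(R,G)$ there is a unique ring homomorphism ${}^{\mathrm{odd}}MU_*\to R$ carrying $F'$ to $G$.
   Context: Rings $R=R_*$ are graded, commutative and unital, homomorphisms preserve degree, and formal group laws are commutative, $1$-dimensional and graded: $G(X,Y)=\sum_{i,j}a_{i,j}X^iY^j$ with $a_{i,j}\in R_{2i+2j-2}$. The series $[-1]_G(X)$ is characterized by $G(X,[-1]_G(X))=0$; $G$ is called odd if $[-1]_G(X)=-X$. Let $F=F^{MU}$ be the universal formal group law over $MU_*$ (associated with the canonical orientation $x\in MU^2(\mathbb{CP}^\infty)$), with logarithm $\log^{MU}(X)=\sum_{n\geq 0}m_nX^{n+1}$ over $MU_*\otimes\mathbb{Q}=\mathbb{Q}[m_n:n\geq1]$ ($m_0=1$). Let $[1/2]_{MU}(X)\in MU[1/2]_*[[X]]$ be the series with $[2]_{MU}([1/2]_{MU}(X))=X$, where $MU[1/2]_*=MU_*\otimes\mathbb{Z}[1/2]$. Put $\varphi(X)=[1/2]_{MU}(F(X,[-1]_{MU}(-X)))$ and $F'(X,Y)=\varphi^{-1}(F(\varphi(X),\varphi(Y)))$; the logarithm of $F'$ is $\frac12(\log^{MU}(X)-\log^{MU}(-X))=\sum_{n\geq0}m_{2n}X^{2n+1}$. Let $\epsilon_2\colon MU[1/2]_*\to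 MU[1/2]_*$ be the ring homomorphism classifying $F'$ (it is idempotent; rationally it sends $m_n$ to $0$ for $n$ odd and to $m_n$ for $n$ even), and let ${}^{\mathrm{odd}}MU_*=\operatorname{im}\epsilon_2\subset MU[1/2]_*$. *)

theory Defs
  imports "HOL-Library.Multiset" "HOL-Algebra.Algebra"
begin

section \<open>Graded rings\<close>

record 'a graded_ring = "'a ring" +
  grade :: "int \<Rightarrow> 'a set"

definition graded_cring :: "'a graded_ring \<Rightarrow> bool" where
  "graded_cring R \<longleftrightarrow>
     cring R \<and>
     (\<forall>n. additive_subgroup (grade R n) R) \<and>
     \<one>\<^bsub>R\<^esub> \<in> grade R 0 \<and>
     (\<forall>m n. \<forall>x\<in>grade R m. \<forall>y\<in>grade R n. x \<otimes>\<^bsub>R\<^esub> y \<in> grade R (m + n)) \<and>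
     (\<forall>x\<in>carrier R. \<exists>!c. (\<forall>n. c n \<in> grade R n) \<and> finite {n. c n \<noteq> \<zero>\<^bsub>R\<^esub>} \<and>
        x = (\<Oplus>\<^bsub>R\<^esub>n\<in>{n. c n \<noteq> \<zero>\<^bsub>R\<^esub>}. c n))"

text \<open>Homomorphisms are extensional functions, so that \<open>\<exists>!\<close> expresses uniqueness on the carrier.\<close>

definition graded_ring_hom :: "'a graded_ring \<Rightarrow> 'b graded_ring \<Rightarrow> ('a \<Rightarrow> 'b) set" where
  "graded_ring_hom R S =
     {h \<in> ring_hom R S. h \<in> extensional (carrier R) \<and> (\<forall>n. h ` grade R n \<subseteq> grade S n)}"

definition image_graded_ring :: "('a \<Rightarrow> 'b) \<Rightarrow> 'a graded_ring \<Rightarrow> 'b graded_ring \<Rightarrow> 'b graded_ring" where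
  "image_graded_ring h R S =
     S\<lparr>carrier := h ` carrier R, grade := (\<lambda>n. h ` grade R n)\<rparr>"

text \<open>The ring \<open>\<int>[1/2]\<close>, concentrated in degree 0.\<close>

definition Z_half :: "rat graded_ring" where
  "Z_half =
     (let Z = {of_int a / 2 ^ k | (a :: int) (k :: nat). True} in
      \<lparr>carrier = Z, monoid.mult = (*), one = 1, ring.zero = 0, ring.add = (+),
       grade = (\<lambda>n. if n = 0 then Z else {0})\<rparr>)"

text \<open>For a unital ring the structure map is unique if it exists, so being a
  \<open>\<int>[1/2]\<close>-algebra is a property.\<close>

definition Z_half_algebra :: "'a graded_ring \<Rightarrow> bool" where
  "Z_half_algebra R \<longleftrightarrow> graded_cring R \<and> graded_ring_hom Z_half R \<noteq> {}"

text \<open>The ring \<open>R[1/2] = R \<otimes> \<int>[1/2]\<close>, as the localization of \<open>R\<close> away from 2: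
  \<open>half_frac R a k\<close> is the fraction \<open>a / 2 ^ k\<close>, that is, the set of all
  \<open>(b, l)\<close> for which \<open>2 ^ l a - 2 ^ k b\<close> is annihilated by a power of 2.\<close>

definition half_frac :: "'a graded_ring \<Rightarrow> 'a \<Rightarrow> nat \<Rightarrow> ('a \<times> nat) set" where
  "half_frac R a k =
     {(b, l). b \<in> carrier R \<and>
        (\<exists>m::nat. add_pow R ((2::nat) ^ (m + l)) a = add_pow R ((2::nat) ^ (m + k)) b)}"

definition invert_two :: "'a graded_ring \<Rightarrow> ('a \<times> nat) set graded_ring" where
  "invert_two R =
     \<lparr>carrier = {half_frac R a k | a k. a \<in> carrier R},
      monoid.mult = (\<lambda>x y. \<Union>(a, k)\<in>x. \<Union>(b, l)\<in>y. half_frac R (a \<otimes>\<^bsub>R\<^esub> b) (k + l)),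
      one = half_frac R \<one>\<^bsub>R\<^esub> 0,
      ring.zero = half_frac R \<zero>\<^bsub>R\<^esub> 0,
      ring.add = (\<lambda>x y. \<Union>(a, k)\<in>x. \<Union>(b, l)\<in>y.
        half_frac R (add_pow R ((2::nat) ^ l) a \<oplus>\<^bsub>R\<^esub> add_pow R ((2::nat) ^ k) b) (k + l)),
      grade = (\<lambda>n. {half_frac R a k | a k. a \<in> grade R n})\<rparr>"


section \<open>Formal power series\<close>

text \<open>A monomial is a multiset of variables, and a power series in the variables
  \<open>'v\<close> is the function assigning to each monomial its coefficient
  (compare \<open>HOL-Algebra.Indexed_Polynomials\<close>).\<close>

definition mps :: "'a graded_ring \<Rightarrow> ('v multiset \<Rightarrow> 'a) ring" where
  "mps R =
     \<lparr>carrier = {f. \<forall>m. f m \<in> carrier R},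
      monoid.mult = (\<lambda>f g m. \<Oplus>\<^bsub>R\<^esub>k\<in>{k. k \<subseteq># m}. f k \<otimes>\<^bsub>R\<^esub> g (m - k)),
      one = (\<lambda>m. if m = {#} then \<one>\<^bsub>R\<^esub> else \<zero>\<^bsub>R\<^esub>),
      ring.zero = (\<lambda>m. \<zero>\<^bsub>R\<^esub>),
      ring.add = (\<lambda>f g m. f m \<oplus>\<^bsub>R\<^esub> g m)\<rparr>"

text \<open>All identities are stated in \<open>R[[X, Y, Z]]\<close>.\<close>

datatype var = VX | VY | VZ

definition mps_var :: "'a graded_ring \<Rightarrow> var \<Rightarrow> var multiset \<Rightarrow> 'a" where
  "mps_var R v = (\<lambda>m. if m = {#v#} then \<one>\<^bsub>R\<^esub> else \<zero>\<^bsub>R\<^esub>)"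

text \<open>Series to be substituted into are given by coefficient families:
  \<open>f\<close> stands for \<open>\<Sum>i. f i X\<^sup>i\<close>, and \<open>F\<close> for \<open>\<Sum>i j. F i j X\<^sup>i Y\<^sup>j\<close>.
  Substitution is only used for series \<open>g\<close>, \<open>h\<close> with vanishing constant term.
  Then \<open>g\<^sup>i\<close> has no terms of degree less than \<open>i\<close>, so the sums below may be truncated
  at the degree \<open>size m\<close> of the monomial.\<close>

definition subst1 ::
  "'a graded_ring \<Rightarrow> (nat \<Rightarrow> 'a) \<Rightarrow> (var multiset \<Rightarrow> 'a) \<Rightarrow> var multiset \<Rightarrow> 'a" where
  "subst1 R f g = (\<lambda>m. \<Oplus>\<^bsub>R\<^esub>i\<in>{..size m}. f i \<otimes>\<^bsub>R\<^esub> (g [^]\<^bsub>mps R\<^esub> i) m)"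

definition subst2 ::
  "'a graded_ring \<Rightarrow> (nat \<Rightarrow> nat \<Rightarrow> 'a) \<Rightarrow> (var multiset \<Rightarrow> 'a) \<Rightarrow> (var multiset \<Rightarrow> 'a) \<Rightarrow>
     var multiset \<Rightarrow> 'a" where
  "subst2 R F g h = (\<lambda>m. \<Oplus>\<^bsub>R\<^esub>i\<in>{..size m}. \<Oplus>\<^bsub>R\<^esub>j\<in>{..size m}.
     F i j \<otimes>\<^bsub>R\<^esub> (g [^]\<^bsub>mps R\<^esub> i \<otimes>\<^bsub>mps R\<^esub> h [^]\<^bsub>mps R\<^esub> j) m)"

definition coeffs1 :: "(var multiset \<Rightarrow> 'a) \<Rightarrow> nat \<Rightarrow> 'a" where
  "coeffs1 s i = s (replicate_mset i VX)"

definition coeffs2 :: "(var multiset \<Rightarrow> 'a) \<Rightarrow> nat \<Rightarrow> nat \<Rightarrow> 'a" where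
  "coeffs2 s i j = s (replicate_mset i VX + replicate_mset j VY)"

definition substitutable :: "'a graded_ring \<Rightarrow> (nat \<Rightarrow> 'a) \<Rightarrow> bool" where
  "substitutable R f \<longleftrightarrow> f 0 = \<zero>\<^bsub>R\<^esub> \<and> (\<forall>i. f i \<in> carrier R)"

definition comp_inverse :: "'a graded_ring \<Rightarrow> (nat \<Rightarrow> 'a) \<Rightarrow> nat \<Rightarrow> 'a" where
  "comp_inverse R f = (THE g. substitutable R g \<and>
     subst1 R f (subst1 R g (mps_var R VX)) = mps_var R VX \<and>
     subst1 R g (subst1 R f (mps_var R VX)) = mps_var R VX)"


section \<open>Formal group laws\<close>

definition formal_group_law :: "'a graded_ring \<Rightarrow> (nat \<Rightarrow> nat \<Rightarrow> 'a) \<Rightarrow> bool" where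
  "formal_group_law R F \<longleftrightarrow>
     graded_cring R \<and>
     (\<forall>i j. F i j \<in> grade R (2 * int i + 2 * int j - 2)) \<and>
     (let x = mps_var R VX; y = mps_var R VY; z = mps_var R VZ; null = \<zero>\<^bsub>mps R\<^esub> in
        subst2 R F x null = x \<and>
        subst2 R F null y = y \<and>
        subst2 R F x y = subst2 R F y x \<and>
        subst2 R F (subst2 R F x y) z = subst2 R F x (subst2 R F y z))"

definition neg_series :: "'a graded_ring \<Rightarrow> (nat \<Rightarrow> nat \<Rightarrow> 'a) \<Rightarrow> nat \<Rightarrow> 'a" where
  "neg_series R F = (THE f. substitutable R f \<and>
     subst2 R F (mps_var R VX) (subst1 R f (mps_var R VX)) = \<zero>\<^bsub>mps R\<^esub>)"

definition odd_formal_group_law :: "'a graded_ring \<Rightarrow> (nat \<Rightarrow> nat \<Rightarrow> 'a) \<Rightarrow> bool" where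
  "odd_formal_group_law R F \<longleftrightarrow> formal_group_law R F \<and>
     subst1 R (neg_series R F) (mps_var R VX) = \<ominus>\<^bsub>mps R\<^esub> mps_var R VX"

definition two_series :: "'a graded_ring \<Rightarrow> (nat \<Rightarrow> nat \<Rightarrow> 'a) \<Rightarrow> nat \<Rightarrow> 'a" where
  "two_series R F = coeffs1 (subst2 R F (mps_var R VX) (mps_var R VX))"

definition half_series :: "'a graded_ring \<Rightarrow> (nat \<Rightarrow> nat \<Rightarrow> 'a) \<Rightarrow> nat \<Rightarrow> 'a" where
  "half_series R F = (THE f. substitutable R f \<and>
     subst1 R (two_series R F) (subst1 R f (mps_var R VX)) = mps_var R VX)"

definition phi_series :: "'a graded_ring \<Rightarrow> (nat \<Rightarrow> nat \<Rightarrow> 'a) \<Rightarrow> nat \<Rightarrow> 'a" where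
  "phi_series R F =
     (let x = mps_var R VX in
      coeffs1 (subst1 R (half_series R F)
        (subst2 R F x (subst1 R (neg_series R F) (\<ominus>\<^bsub>mps R\<^esub> x)))))"

definition odd_twist :: "'a graded_ring \<Rightarrow> (nat \<Rightarrow> nat \<Rightarrow> 'a) \<Rightarrow> nat \<Rightarrow> nat \<Rightarrow> 'a" where
  "odd_twist R F =
     (let \<phi> = phi_series R F in
      coeffs2 (subst1 R (comp_inverse R \<phi>)
        (subst2 R F (subst1 R \<phi> (mps_var R VX)) (subst1 R \<phi> (mps_var R VY)))))"

definition classifies ::
  "'a graded_ring \<Rightarrow> (nat \<Rightarrow> nat \<Rightarrow> 'a) \<Rightarrow> 'b graded_ring \<Rightarrow> (nat \<Rightarrow> nat \<Rightarrow> 'b) \<Rightarrow> ('a \<Rightarrow> 'b) \<Rightarrow> bool" where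
  "classifies L F R G h \<longleftrightarrow> h \<in> graded_ring_hom L R \<and> (\<forall>i j. h (F i j) = G i j)"

text \<open>Since HOL does not quantify over types inside a formula, the type \<open>'b\<close> of the carriers
  of the target rings is a parameter of the following two notions.\<close>

definition universal_fgl :: "'b itself \<Rightarrow> 'a graded_ring \<Rightarrow> (nat \<Rightarrow> nat \<Rightarrow> 'a) \<Rightarrow> bool" where
  "universal_fgl (T :: 'b itself) L F \<longleftrightarrow>
     formal_group_law L F \<and>
     (\<forall>(R :: 'b graded_ring) G. formal_group_law R G \<longrightarrow> (\<exists>!h. classifies L F R G h))"

definition universal_odd_fgl :: "'b itself \<Rightarrow> 'a graded_ring \<Rightarrow> (nat \<Rightarrow> nat \<Rightarrow> 'a) \<Rightarrow> bool" where
  "universal_odd_fgl (T :: 'b itself) L F \<longleftrightarrow>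
     Z_half_algebra L \<and> odd_formal_group_law L F \<and>
     (\<forall>(R :: 'b graded_ring) G. Z_half_algebra R \<and> odd_formal_group_law R G \<longrightarrow>
        (\<exists>!h. classifies L F R G h))"


section \<open>The odd part of \<open>MU[1/2]\<close>\<close>

text \<open>By Quillen's theorem the coefficient ring of \<open>MU\<close> with the formal group law of the canonical
  orientation is determined, up to unique isomorphism, by universality of that formal group law.
  The constructions below therefore take an arbitrary pair \<open>(MU, F)\<close> as argument, for which
  universality is to be assumed.\<close>

definition MU_half_fgl :: "'a graded_ring \<Rightarrow> (nat \<Rightarrow> nat \<Rightarrow> 'a) \<Rightarrow> nat \<Rightarrow> nat \<Rightarrow> ('a \<times> nat) set" where
  "MU_half_fgl MU F = (\<lambda>i j. half_frac MU (F i j) 0)"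

definition F_odd :: "'a graded_ring \<Rightarrow> (nat \<Rightarrow> nat \<Rightarrow> 'a) \<Rightarrow> nat \<Rightarrow> nat \<Rightarrow> ('a \<times> nat) set" where
  "F_odd MU F = odd_twist (invert_two MU) (MU_half_fgl MU F)"

definition eps2 :: "'a graded_ring \<Rightarrow> (nat \<Rightarrow> nat \<Rightarrow> 'a) \<Rightarrow> ('a \<times> nat) set \<Rightarrow> ('a \<times> nat) set" where
  "eps2 MU F =
     (THE h. classifies (invert_two MU) (MU_half_fgl MU F) (invert_two MU) (F_odd MU F) h)"

definition odd_MU :: "'a graded_ring \<Rightarrow> (nat \<Rightarrow> nat \<Rightarrow> 'a) \<Rightarrow> ('a \<times> nat) set graded_ring" where
  "odd_MU MU F = image_graded_ring (eps2 MU F) (invert_two MU) (invert_two MU)"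

end

theory Submission
  imports Defs
begin

text \<open>Let \<open>F\<close> be a formal group law over \<open>R\<close>. The power series without constant term form an abelian group
under \<open>(g, h) \<mapsto> F(g, h)\<close>; write \<open>+\<^sub>F\<close> and \<open>-\<^sub>F\<close> for its operations. If 2 is invertible in \<open>R\<close>, doubling
is bijective on this group, because the linear coefficient of \<open>F(X, X)\<close> is 2; call its inverse
\<open>half\<close>. In this language \<open>\<phi>(g) = half(g +\<^sub>F -\<^sub>F(-g))\<close>, where the inner sign is that of the ring of
power series. Two short computations in the group are the heart of the matter:

\<^item> \<open>\<phi>(-g) = half(-g +\<^sub>F -\<^sub>F g) = -\<^sub>F \<phi>(g)\<close>. As \<open>\<phi>\<close> is invertible under composition, it carries the
  law \<open>F'(X, Y) = \<phi>\<^sup>-\<^sup>1(F(\<phi>(X), \<phi>(Y)))\<close> to \<open>F\<close>, and \<open>F'\<close> is odd (\<open>odd_twist_odd\<close>).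

\<^item> If \<open>F\<close> is odd already, then \<open>-\<^sub>F(-g) = g\<close>, hence \<open>\<phi>(g) = half(g +\<^sub>F g) = g\<close> and \<open>F' = F\<close>
  (\<open>odd_twist_of_odd\<close>).

Moreover \<open>F'\<close> is natural: a graded homomorphism that carries \<open>F\<close> to \<open>G\<close> carries \<open>F'\<close> to \<open>G'\<close>
(\<open>odd_twist_natural\<close>).

Now let \<open>M = MU[1/2]\<close>, which with \<open>F\<close> is universal for formal group laws over \<open>\<int>[1/2]\<close>-algebras
(\<open>invert_two_universal\<close>), and let \<open>\<epsilon> : M \<rightarrow> M\<close> classify \<open>F'\<close>. If \<open>G\<close> is odd over \<open>S\<close> and
\<open>h : M \<rightarrow> S\<close> classifies \<open>G\<close>, then \<open>h\<close> carries \<open>F'\<close> to \<open>G' = G\<close>. So the restriction of \<open>h\<close> to the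
image of \<open>\<epsilon>\<close> carries \<open>F'\<close> to \<open>G\<close>. Conversely, if \<open>k\<close> is defined on the image of \<open>\<epsilon>\<close> and carries \<open>F'\<close>
to \<open>G\<close>, then \<open>k \<circ> \<epsilon>\<close> carries \<open>F\<close> to \<open>G\<close>, so \<open>k \<circ> \<epsilon> = h\<close>, and this determines \<open>k\<close>. Finally the case
\<open>S = M\<close>, \<open>G = F'\<close> shows that \<open>\<epsilon>\<close> fixes the coefficients of \<open>F'\<close>: they lie in the image of \<open>\<epsilon>\<close>, and
\<open>F'\<close> over this image is the base change along \<open>\<epsilon>\<close> of \<open>F'\<close> over \<open>M\<close>, hence an odd formal group law.

Three general facts make this precise. Substituting series without constant term for the variables
is a ring endomorphism of \<open>R[[X, Y, Z]]\<close> that commutes with composition of series, so that an identity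
in the variables may be evaluated at arbitrary elements of the group (\<open>at3_simps\<close>). An equation
\<open>C(g, y) = w\<close> for a series \<open>y\<close> is uniquely solvable when the coefficient of \<open>y\<close> in it is a unit
(\<open>subst2_solution_unique\<close>, \<open>subst2_solution_exists\<close>); this yields all the inverse series in question,
together with the degrees of their coefficients. And fractions with powers of 2 as denominators form a graded
ring with the expected universal property.\<close>

section \<open>Finite sums in an abelian monoid\<close>

context abelian_monoid
begin

lemma finsum_Sigma:
  assumes "finite A" "\<And>a. a \<in> A \<Longrightarrow> finite (B a)"
    and "\<And>a b. a \<in> A \<Longrightarrow> b \<in> B a \<Longrightarrow> f (a, b) \<in> carrier G"
  shows "finsum G f (Sigma A B) = (\<Oplus>a\<in>A. \<Oplus>b\<in>B a. f (a, b))"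
proof -
  have eq: "Sigma A B = (\<Union>a\<in>A. Pair a ` B a)" by auto
  have "finsum G f (Sigma A B) = (\<Oplus>a\<in>A. finsum G f (Pair a ` B a))"
    unfolding eq
    by (rule add.finprod_UN_disjoint) (use assms in \<open>auto simp: pairwise_def disjnt_def\<close>)
  also have "\<dots> = (\<Oplus>a\<in>A. \<Oplus>b\<in>B a. f (a, b))"
  proof (rule finsum_cong')
    show "(\<lambda>a. \<Oplus>b\<in>B a. f (a, b)) \<in> A \<rightarrow> carrier G"
      using assms by (auto intro!: finsum_closed)
    fix a assume a: "a \<in> A"
    show "finsum G f (Pair a ` B a) = (\<Oplus>b\<in>B a. f (a, b))"
      by (rule finsum_reindex) (use assms a in \<open>auto simp: inj_on_def\<close>)
  qed simp
  finally show ?thesis .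
qed

lemma finsum_bij_betw:
  assumes "bij_betw h A B" "\<And>b. b \<in> B \<Longrightarrow> f b \<in> carrier G" "\<And>a. a \<in> A \<Longrightarrow> f (h a) = g a"
  shows "finsum G g A = finsum G f B"
proof -
  have B: "B = h ` A" and inj: "inj_on h A" using assms(1) by (auto simp: bij_betw_def)
  have "finsum G f B = (\<Oplus>a\<in>A. f (h a))"
    unfolding B by (rule finsum_reindex[OF _ inj]) (use assms B in auto)
  also have "\<dots> = finsum G g A"
    by (rule finsum_cong') (use assms B in \<open>auto simp: Pi_def\<close>, metis image_eqI)
  finally show ?thesis by simp
qed

lemma finsum_swap:
  assumes "finite A" "finite B" "\<And>a b. a \<in> A \<Longrightarrow> b \<in> B \<Longrightarrow> f a b \<in> carrier G"
  shows "(\<Oplus>a\<in>A. \<Oplus>b\<in>B. f a b) = (\<Oplus>b\<in>B. \<Oplus>a\<in>A. f a b)"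
proof -
  have "(\<Oplus>a\<in>A. \<Oplus>b\<in>B. f a b) = (\<Oplus>p\<in>A \<times> B. f (fst p) (snd p))"
    using assms by (subst finsum_Sigma) auto
  also have "\<dots> = (\<Oplus>p\<in>B \<times> A. f (snd p) (fst p))"
    by (rule finsum_bij_betw[where h = prod.swap])
       (use assms in \<open>auto simp: bij_betw_def inj_on_def image_iff\<close>)
  also have "\<dots> = (\<Oplus>b\<in>B. \<Oplus>a\<in>A. f a b)"
    using assms by (subst finsum_Sigma) auto
  finally show ?thesis .
qed

lemma finsum_eq_single:
  assumes "finite A" "a \<in> A" "f a \<in> carrier G" "\<And>b. b \<in> A \<Longrightarrow> b \<noteq> a \<Longrightarrow> f b = \<zero>"
  shows "finsum G f A = f a"
proof -
  have "finsum G f {a} = finsum G f A"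
    by (rule add.finprod_mono_neutral_cong_left) (use assms in \<open>auto, metis zero_closed\<close>)
  thus ?thesis using assms by simp
qed

lemma finsum_restrict_support:
  assumes "finite B" "A \<subseteq> B" "\<And>x. x \<in> B \<Longrightarrow> x \<notin> A \<Longrightarrow> f x = \<zero>"
    "\<And>x. x \<in> B \<Longrightarrow> f x \<in> carrier G"
  shows "finsum G f A = finsum G f B"
  by (rule add.finprod_mono_neutral_cong_left) (use assms in auto)

end

section \<open>The ring of power series\<close>

text \<open>A product of two series has as coefficient at \<open>m\<close> a sum over these pairs; in contrast to the
submultisets of \<open>m\<close>, they treat both factors alike and can be reindexed without subtraction.\<close>

definition splittings :: "'v multiset \<Rightarrow> ('v multiset \<times> 'v multiset) set" where
  "splittings m = {(a, b). a + b = m}"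

lemma finite_submultisets: "finite {k. k \<subseteq># (m :: 'v multiset)}"
proof (rule finite_subset)
  show "{k. k \<subseteq># m} \<subseteq> (\<Union>i\<le>size m. multisets_of_size (set_mset m) i)"
    by (auto simp: multisets_of_size_def size_mset_mono dest: mset_subset_eqD)
qed auto

lemma splittings_eq_image: "splittings m = (\<lambda>k. (k, m - k)) ` {k. k \<subseteq># m}"
  by (auto simp: splittings_def image_iff)

lemma finite_splittings [simp]: "finite (splittings m)"
  by (simp add: splittings_eq_image finite_submultisets)

lemma carrier_mps [simp]: "f \<in> carrier (mps R) \<longleftrightarrow> (\<forall>m. f m \<in> carrier R)"
  by (simp add: mps_def)

lemma mps_add [simp]: "(f \<oplus>\<^bsub>mps R\<^esub> g) m = f m \<oplus>\<^bsub>R\<^esub> g m"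
  by (simp add: mps_def)

lemma mps_zero [simp]: "\<zero>\<^bsub>mps R\<^esub> m = \<zero>\<^bsub>R\<^esub>"
  by (simp add: mps_def)

lemma mps_one: "\<one>\<^bsub>mps R\<^esub> m = (if m = {#} then \<one>\<^bsub>R\<^esub> else \<zero>\<^bsub>R\<^esub>)"
  by (simp add: mps_def)

locale coefficient_ring = cring R for R :: "'a graded_ring" (structure)
begin

lemma mps_mult:
  assumes "f \<in> carrier (mps R)" "g \<in> carrier (mps R)"
  shows "(f \<otimes>\<^bsub>mps R\<^esub> g) m = (\<Oplus>p\<in>splittings m. f (fst p) \<otimes> g (snd p))"
proof -
  have "(f \<otimes>\<^bsub>mps R\<^esub> g) m = (\<Oplus>k\<in>{k. k \<subseteq># m}. f k \<otimes> g (m - k))"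
    by (simp add: mps_def)
  also have "\<dots> = (\<Oplus>p\<in>splittings m. f (fst p) \<otimes> g (snd p))"
    by (rule finsum_bij_betw[where h = "\<lambda>k. (k, m - k)"])
       (use assms in \<open>auto simp: bij_betw_def inj_on_def splittings_eq_image\<close>)
  finally show ?thesis .
qed

lemma mps_mult_closed:
  "f \<in> carrier (mps R) \<Longrightarrow> g \<in> carrier (mps R) \<Longrightarrow> (f \<otimes>\<^bsub>mps R\<^esub> g) m \<in> carrier R"
  by (auto simp: mps_mult intro!: finsum_closed)

lemma mps_assoc:
  assumes "f \<in> carrier (mps R)" "g \<in> carrier (mps R)" "h \<in> carrier (mps R)"
  shows "(f \<otimes>\<^bsub>mps R\<^esub> g) \<otimes>\<^bsub>mps R\<^esub> h = f \<otimes>\<^bsub>mps R\<^esub> (g \<otimes>\<^bsub>mps R\<^esub> h)"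
proof (rule ext)
  fix m
  have "((f \<otimes>\<^bsub>mps R\<^esub> g) \<otimes>\<^bsub>mps R\<^esub> h) m =
      (\<Oplus>p\<in>splittings m. (\<Oplus>q\<in>splittings (fst p). f (fst q) \<otimes> g (snd q)) \<otimes> h (snd p))"
    using assms by (subst mps_mult) (auto simp: mps_mult intro!: mps_mult_closed finsum_closed)
  also have "\<dots> = (\<Oplus>p\<in>splittings m. \<Oplus>q\<in>splittings (fst p). f (fst q) \<otimes> g (snd q) \<otimes> h (snd p))"
    using assms by (intro finsum_cong' finsum_ldistr) (auto intro!: finsum_closed)
  also have "\<dots> = (\<Oplus>x\<in>(SIGMA p:splittings m. splittings (fst p)).
      f (fst (snd x)) \<otimes> g (snd (snd x)) \<otimes> h (snd (fst x)))"
    using assms by (subst finsum_Sigma) auto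
  also have "\<dots> = (\<Oplus>x\<in>(SIGMA p:splittings m. splittings (snd p)).
      f (fst (fst x)) \<otimes> (g (fst (snd x)) \<otimes> h (snd (snd x))))"
    by (rule finsum_bij_betw[where h = "\<lambda>((k, c), (a, b)). ((a, b + c), (b, c))"])
       (use assms in \<open>auto simp: splittings_def bij_betw_def inj_on_def image_iff m_assoc add.assoc\<close>)
  also have "\<dots> = (\<Oplus>p\<in>splittings m. \<Oplus>q\<in>splittings (snd p). f (fst p) \<otimes> (g (fst q) \<otimes> h (snd q)))"
    using assms by (subst finsum_Sigma) auto
  also have "\<dots> = (\<Oplus>p\<in>splittings m. f (fst p) \<otimes> (\<Oplus>q\<in>splittings (snd p). g (fst q) \<otimes> h (snd q)))"
    using assms by (intro finsum_cong' finsum_rdistr[symmetric]) (auto intro!: finsum_closed)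
  also have "\<dots> = (f \<otimes>\<^bsub>mps R\<^esub> (g \<otimes>\<^bsub>mps R\<^esub> h)) m"
    using assms by (subst mps_mult) (auto simp: mps_mult intro!: mps_mult_closed finsum_closed)
  finally show "((f \<otimes>\<^bsub>mps R\<^esub> g) \<otimes>\<^bsub>mps R\<^esub> h) m = (f \<otimes>\<^bsub>mps R\<^esub> (g \<otimes>\<^bsub>mps R\<^esub> h)) m" .
qed

lemma mps_comm:
  assumes "f \<in> carrier (mps R)" "g \<in> carrier (mps R)"
  shows "f \<otimes>\<^bsub>mps R\<^esub> g = g \<otimes>\<^bsub>mps R\<^esub> f"
proof (rule ext)
  fix m
  show "(f \<otimes>\<^bsub>mps R\<^esub> g) m = (g \<otimes>\<^bsub>mps R\<^esub> f) m"
    using assms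
    by (simp only: mps_mult, intro finsum_bij_betw[where h = prod.swap])
       (auto simp: splittings_def bij_betw_def inj_on_def image_iff m_comm add.commute)
qed

lemma mps_cring: "cring (mps R :: ('v multiset \<Rightarrow> 'a) ring)"
proof (rule cringI)
  show "abelian_group (mps R :: ('v multiset \<Rightarrow> 'a) ring)"
  proof (rule abelian_groupI)
    fix f :: "'v multiset \<Rightarrow> 'a" assume f: "f \<in> carrier (mps R)"
    show "\<exists>g\<in>carrier (mps R). g \<oplus>\<^bsub>mps R\<^esub> f = \<zero>\<^bsub>mps R\<^esub>"
      by (rule bexI[where x = "\<lambda>m. \<ominus> f m"]) (use f in \<open>auto simp: l_neg\<close>)
  qed (auto simp: a_ac fun_eq_iff)
  show "comm_monoid (mps R :: ('v multiset \<Rightarrow> 'a) ring)"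
  proof (rule comm_monoidI)
    fix f :: "'v multiset \<Rightarrow> 'a" assume f: "f \<in> carrier (mps R)"
    show "\<one>\<^bsub>mps R\<^esub> \<otimes>\<^bsub>mps R\<^esub> f = f"
    proof (rule ext)
      fix m :: "'v multiset"
      define t where "t p = \<one>\<^bsub>mps R\<^esub> (fst p) \<otimes> f (snd p)" for p :: "'v multiset \<times> 'v multiset"
      have "(\<one>\<^bsub>mps R\<^esub> \<otimes>\<^bsub>mps R\<^esub> f) m = finsum R t (splittings m)"
        unfolding t_def using f by (intro mps_mult) (auto simp: mps_one)
      also have "\<dots> = t ({#}, m)"
        by (rule finsum_eq_single) (use f in \<open>auto simp: splittings_def mps_one t_def finite_splittings[unfolded splittings_def]\<close>)
      finally show "(\<one>\<^bsub>mps R\<^esub> \<otimes>\<^bsub>mps R\<^esub> f) m = f m" using f by (simp add: mps_one t_def)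
    qed
  qed (auto simp: mps_one mps_mult_closed mps_assoc intro: mps_comm)
  fix f g h :: "'v multiset \<Rightarrow> 'a"
  assume f: "f \<in> carrier (mps R)" "g \<in> carrier (mps R)" "h \<in> carrier (mps R)"
  show "(f \<oplus>\<^bsub>mps R\<^esub> g) \<otimes>\<^bsub>mps R\<^esub> h = f \<otimes>\<^bsub>mps R\<^esub> h \<oplus>\<^bsub>mps R\<^esub> g \<otimes>\<^bsub>mps R\<^esub> h"
  proof (rule ext)
    fix m
    show "((f \<oplus>\<^bsub>mps R\<^esub> g) \<otimes>\<^bsub>mps R\<^esub> h) m = (f \<otimes>\<^bsub>mps R\<^esub> h \<oplus>\<^bsub>mps R\<^esub> g \<otimes>\<^bsub>mps R\<^esub> h) m"
      using f by (simp add: mps_mult l_distr)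
  qed
qed

end

sublocale coefficient_ring \<subseteq> P: cring "mps R :: (var multiset \<Rightarrow> 'a) ring"
  by (rule mps_cring)

context coefficient_ring
begin

lemma mps_minus [simp]:
  assumes "f \<in> carrier (mps R)"
  shows "(\<ominus>\<^bsub>mps R\<^esub> f) m = \<ominus> f (m :: var multiset)"
proof -
  have "(\<ominus>\<^bsub>mps R\<^esub> f \<oplus>\<^bsub>mps R\<^esub> f) m = \<zero>"
    using assms by (subst P.l_neg) auto
  thus ?thesis using assms P.a_inv_closed[OF assms]
    by (metis carrier_mps minus_equality mps_add)
qed

lemma mps_memI: "(\<And>m. p m \<in> carrier R) \<Longrightarrow> p \<in> carrier (mps R)"
  by simp

lemma mps_coeff_closed [simp]: "p \<in> carrier (mps R) \<Longrightarrow> p m \<in> carrier R"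
  by simp

end

text \<open>As a rewrite rule, this would reduce membership of a series to membership of its coefficients,
which \<open>mps_coeff_closed\<close> reduces back.\<close>

declare carrier_mps [simp del]

section \<open>Order of a series\<close>

definition order_at_least :: "'a graded_ring \<Rightarrow> nat \<Rightarrow> ('v multiset \<Rightarrow> 'a) \<Rightarrow> bool" where
  "order_at_least R n f \<longleftrightarrow> (\<forall>m. size m < n \<longrightarrow> f m = \<zero>\<^bsub>R\<^esub>)"

definition augmentation_ideal :: "'a graded_ring \<Rightarrow> ('v multiset \<Rightarrow> 'a) set" where
  "augmentation_ideal R = {f \<in> carrier (mps R). f {#} = \<zero>\<^bsub>R\<^esub>}"

lemma augmentation_ideal_iff:
  "f \<in> augmentation_ideal R \<longleftrightarrow> (\<forall>m. f m \<in> carrier R) \<and> f {#} = \<zero>\<^bsub>R\<^esub>"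
  by (simp add: augmentation_ideal_def carrier_mps)

lemma augmentation_ideal_carrier [dest]: "f \<in> augmentation_ideal R \<Longrightarrow> f \<in> carrier (mps R)"
  by (simp add: augmentation_ideal_def)

lemma order_at_least_augmentation: "f \<in> augmentation_ideal R \<Longrightarrow> order_at_least R 1 f"
  by (simp add: augmentation_ideal_iff order_at_least_def)

context coefficient_ring
begin

lemma order_at_least_mult:
  fixes f g :: "var multiset \<Rightarrow> 'a"
  assumes "f \<in> carrier (mps R)" "g \<in> carrier (mps R)" "order_at_least R a f" "order_at_least R b g"
  shows "order_at_least R (a + b) (f \<otimes>\<^bsub>mps R\<^esub> g)"
  unfolding order_at_least_def
proof (intro allI impI)
  fix m :: "var multiset" assume m: "size m < a + b"
  have "f (fst p) \<otimes> g (snd p) = \<zero>" if "p \<in> splittings m" for p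
  proof -
    have "size (fst p) + size (snd p) = size m"
      using that by (auto simp: splittings_def)
    hence "size (fst p) < a \<or> size (snd p) < b" using m by linarith
    thus ?thesis using assms by (auto simp: order_at_least_def)
  qed
  thus "(f \<otimes>\<^bsub>mps R\<^esub> g) m = \<zero>"
    using assms by (simp add: mps_mult add.finprod_one_eqI)
qed

lemma order_at_least_pow:
  fixes g :: "var multiset \<Rightarrow> 'a"
  assumes "g \<in> augmentation_ideal R"
  shows "order_at_least R i (g [^]\<^bsub>mps R\<^esub> i)"
proof (induction i)
  case 0
  show ?case by (simp add: order_at_least_def)
next
  case (Suc i)
  show ?case
    using order_at_least_mult[OF _ _ Suc order_at_least_augmentation[OF assms]] assms
    by (simp add: augmentation_ideal_carrier)
qed

lemma order_at_least_pow_mult: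
  fixes g h :: "var multiset \<Rightarrow> 'a"
  assumes "g \<in> augmentation_ideal R" "h \<in> augmentation_ideal R"
  shows "order_at_least R (i + j) (g [^]\<^bsub>mps R\<^esub> i \<otimes>\<^bsub>mps R\<^esub> h [^]\<^bsub>mps R\<^esub> j)"
  using assms
  by (intro order_at_least_mult order_at_least_pow)
     (auto)

text \<open>Coefficients are additive, so identities of sums of series may be checked one monomial at a time.\<close>

lemma mps_finsum:
  assumes "\<And>i. i \<in> I \<Longrightarrow> f i \<in> carrier (mps R)"
  shows "(\<Oplus>\<^bsub>mps R\<^esub>i\<in>I. f i) (m :: var multiset) = (\<Oplus>i\<in>I. f i m)"
  using assms
proof (induction I rule: infinite_finite_induct)
  case (insert x F)
  thus ?case
    by (subst P.finsum_insert) (auto)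
qed auto

end

section \<open>Substitution\<close>

definition monomials :: "nat \<Rightarrow> var multiset set" where
  "monomials n = {k. size k \<le> n}"

lemma finite_monomials [simp]: "finite (monomials n)"
proof (rule finite_subset)
  show "monomials n \<subseteq> (\<Union>i\<le>n. multisets_of_size {VX, VY, VZ} i)"
    using var.exhaust by (auto simp: monomials_def multisets_of_size_def)
qed auto

lemma size_var_multiset: "size (k :: var multiset) = count k VX + count k VY + count k VZ"
  by (induction k) (auto, metis var.exhaust)

definition eval_monomial ::
  "'a graded_ring \<Rightarrow> (var \<Rightarrow> var multiset \<Rightarrow> 'a) \<Rightarrow> var multiset \<Rightarrow> var multiset \<Rightarrow> 'a" where
  "eval_monomial R \<sigma> k =
     \<sigma> VX [^]\<^bsub>mps R\<^esub> count k VX \<otimes>\<^bsub>mps R\<^esub> \<sigma> VY [^]\<^bsub>mps R\<^esub> count k VY \<otimes>\<^bsub>mps R\<^esub>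
     \<sigma> VZ [^]\<^bsub>mps R\<^esub> count k VZ"

text \<open>The substitution of \<open>\<sigma> v\<close> for each variable \<open>v\<close>. The truncation at the size of \<open>m\<close> loses nothing as
long as no \<open>\<sigma> v\<close> has a constant term, since then a monomial of size \<open>n\<close> is sent to a series of order
at least \<open>n\<close>.\<close>

definition eval_series ::
  "'a graded_ring \<Rightarrow> (var \<Rightarrow> var multiset \<Rightarrow> 'a) \<Rightarrow> (var multiset \<Rightarrow> 'a) \<Rightarrow> var multiset \<Rightarrow> 'a" where
  "eval_series R \<sigma> p = (\<lambda>m. \<Oplus>\<^bsub>R\<^esub>k\<in>monomials (size m). p k \<otimes>\<^bsub>R\<^esub> eval_monomial R \<sigma> k m)"

locale substitution = coefficient_ring +
  fixes \<sigma> :: "var \<Rightarrow> var multiset \<Rightarrow> 'a"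
  assumes augmentation: "\<sigma> v \<in> augmentation_ideal R"
begin

lemma subst_carrier [simp]: "\<sigma> v \<in> carrier (mps R)"
  using augmentation by blast

lemma eval_monomial_closed [simp]: "eval_monomial R \<sigma> k \<in> carrier (mps R)"
  unfolding eval_monomial_def by (simp)

lemma eval_monomial_closed' [simp]: "eval_monomial R \<sigma> k m \<in> carrier R"
  by simp

lemma eval_monomial_add:
  "eval_monomial R \<sigma> (a + b) = eval_monomial R \<sigma> a \<otimes>\<^bsub>mps R\<^esub> eval_monomial R \<sigma> b"
  unfolding eval_monomial_def
  by (simp add: P.nat_pow_mult[symmetric] P.m_ac)

lemma eval_monomial_eq_zero: "size m < size k \<Longrightarrow> eval_monomial R \<sigma> k m = \<zero>"
proof -
  have "order_at_least R (size k) (eval_monomial R \<sigma> k)"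
    unfolding eval_monomial_def size_var_multiset
    by (intro order_at_least_mult order_at_least_pow augmentation)
       (simp_all)
  thus "size m < size k \<Longrightarrow> ?thesis" by (simp add: order_at_least_def)
qed

text \<open>Raising the truncation bound changes nothing. This allows one bound to serve all coefficients that
occur in a product.\<close>

lemma eval_series_extend:
  assumes "p \<in> carrier (mps R)" "size m \<le> n"
  shows "eval_series R \<sigma> p m = (\<Oplus>k\<in>monomials n. p k \<otimes> eval_monomial R \<sigma> k m)"
  unfolding eval_series_def
  by (rule finsum_restrict_support)
     (use assms in \<open>auto simp: monomials_def eval_monomial_eq_zero finite_monomials[unfolded monomials_def]\<close>)

lemma eval_series_closed [simp]:
  "p \<in> carrier (mps R) \<Longrightarrow> eval_series R \<sigma> p \<in> carrier (mps R)"
  by (rule mps_memI) (auto simp: eval_series_def intro!: finsum_closed)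

lemma eval_series_augmentation:
  assumes "p \<in> augmentation_ideal R"
  shows "eval_series R \<sigma> p \<in> augmentation_ideal R"
proof -
  have "monomials 0 = {{#}}" by (auto simp: monomials_def)
  thus ?thesis
    using assms eval_series_closed[of p] augmentation_ideal_carrier[OF assms]
    by (simp add: augmentation_ideal_iff eval_series_def)
qed

lemma eval_series_one: "eval_series R \<sigma> \<one>\<^bsub>mps R\<^esub> = \<one>\<^bsub>mps R\<^esub>"
proof (rule ext)
  fix m :: "var multiset"
  have "eval_series R \<sigma> \<one>\<^bsub>mps R\<^esub> m = \<one>\<^bsub>mps R\<^esub> ({#} :: var multiset) \<otimes> eval_monomial R \<sigma> {#} m"
    unfolding eval_series_def
    by (rule finsum_eq_single[where f = "\<lambda>k :: var multiset. \<one>\<^bsub>mps R\<^esub> k \<otimes> eval_monomial R \<sigma> k m"])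
       (auto simp: mps_one monomials_def finite_monomials[unfolded monomials_def])
  also have "\<dots> = \<one>\<^bsub>mps R\<^esub> m" by (simp add: eval_monomial_def mps_one)
  finally show "eval_series R \<sigma> \<one>\<^bsub>mps R\<^esub> m = \<one>\<^bsub>mps R\<^esub> m" .
qed

lemma eval_series_add:
  assumes "p \<in> carrier (mps R)" "q \<in> carrier (mps R)"
  shows "eval_series R \<sigma> (p \<oplus>\<^bsub>mps R\<^esub> q) = eval_series R \<sigma> p \<oplus>\<^bsub>mps R\<^esub> eval_series R \<sigma> q"
  using assms by (simp add: eval_series_def fun_eq_iff l_distr)

text \<open>Both sides at \<open>m\<close> are sums of \<open>p a q b \<sigma>\<^sup>a\<^sup>+\<^sup>b(m)\<close>, on the left over all pairs with
\<open>size (a + b) \<le> size m\<close>, on the right over all pairs with \<open>size a\<close> and \<open>size b\<close> at most \<open>size m\<close>. The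
additional terms on the right vanish for reasons of order.\<close>

lemma eval_series_mult:
  assumes p: "p \<in> carrier (mps R)" and q: "q \<in> carrier (mps R)"
  shows "eval_series R \<sigma> (p \<otimes>\<^bsub>mps R\<^esub> q) = eval_series R \<sigma> p \<otimes>\<^bsub>mps R\<^esub> eval_series R \<sigma> q"
proof (rule ext)
  fix m :: "var multiset"
  define n where "n = size m"
  define e where "e = eval_monomial R \<sigma>"
  have e [simp]: "e k \<in> carrier (mps R)" "e k u \<in> carrier R" for k u
    unfolding e_def by (simp_all)
  have pq [simp]: "p k \<in> carrier R" "q k \<in> carrier R" for k using p q by auto
  have size: "size (fst s) \<le> n" "size (snd s) \<le> n" if "s \<in> splittings m" for s
    using that by (auto simp: splittings_def n_def)
  have "(eval_series R \<sigma> p \<otimes>\<^bsub>mps R\<^esub> eval_series R \<sigma> q) m =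
      (\<Oplus>s\<in>splittings m. eval_series R \<sigma> p (fst s) \<otimes> eval_series R \<sigma> q (snd s))"
    by (rule mps_mult) (use p q in \<open>simp_all\<close>)
  also have "\<dots> = (\<Oplus>s\<in>splittings m. \<Oplus>x\<in>monomials n \<times> monomials n.
      p (fst x) \<otimes> q (snd x) \<otimes> (e (fst x) (fst s) \<otimes> e (snd x) (snd s)))"
  proof (rule finsum_cong')
    fix s assume s: "s \<in> splittings m"
    have "eval_series R \<sigma> p (fst s) \<otimes> eval_series R \<sigma> q (snd s) =
        (\<Oplus>a\<in>monomials n. p a \<otimes> e a (fst s)) \<otimes> (\<Oplus>b\<in>monomials n. q b \<otimes> e b (snd s))"
      using p q size[OF s] by (simp add: eval_series_extend e_def)
    also have "\<dots> = (\<Oplus>a\<in>monomials n. p a \<otimes> e a (fst s) \<otimes> (\<Oplus>b\<in>monomials n. q b \<otimes> e b (snd s)))"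
      by (rule finsum_ldistr) (auto intro!: finsum_closed)
    also have "\<dots> = (\<Oplus>a\<in>monomials n. \<Oplus>b\<in>monomials n. p a \<otimes> q b \<otimes> (e a (fst s) \<otimes> e b (snd s)))"
    proof (rule finsum_cong')
      fix a assume "a \<in> monomials n"
      have "p a \<otimes> e a (fst s) \<otimes> (\<Oplus>b\<in>monomials n. q b \<otimes> e b (snd s)) =
          (\<Oplus>b\<in>monomials n. p a \<otimes> e a (fst s) \<otimes> (q b \<otimes> e b (snd s)))"
        by (rule finsum_rdistr) auto
      also have "\<dots> = (\<Oplus>b\<in>monomials n. p a \<otimes> q b \<otimes> (e a (fst s) \<otimes> e b (snd s)))"
        by (rule finsum_cong') (auto simp: m_ac)
      finally show "p a \<otimes> e a (fst s) \<otimes> (\<Oplus>b\<in>monomials n. q b \<otimes> e b (snd s)) =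
          (\<Oplus>b\<in>monomials n. p a \<otimes> q b \<otimes> (e a (fst s) \<otimes> e b (snd s)))" .
    qed (auto intro!: finsum_closed)
    also have "\<dots> = (\<Oplus>x\<in>monomials n \<times> monomials n.
        p (fst x) \<otimes> q (snd x) \<otimes> (e (fst x) (fst s) \<otimes> e (snd x) (snd s)))"
      by (subst finsum_Sigma) auto
    finally show "eval_series R \<sigma> p (fst s) \<otimes> eval_series R \<sigma> q (snd s) =
      (\<Oplus>x\<in>monomials n \<times> monomials n.
        p (fst x) \<otimes> q (snd x) \<otimes> (e (fst x) (fst s) \<otimes> e (snd x) (snd s)))" .
  qed (auto intro!: finsum_closed)
  also have "\<dots> = (\<Oplus>x\<in>monomials n \<times> monomials n. \<Oplus>s\<in>splittings m.
      p (fst x) \<otimes> q (snd x) \<otimes> (e (fst x) (fst s) \<otimes> e (snd x) (snd s)))"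
    by (rule finsum_swap) auto
  also have "\<dots> = (\<Oplus>x\<in>monomials n \<times> monomials n. p (fst x) \<otimes> q (snd x) \<otimes> e (fst x + snd x) m)"
  proof (rule finsum_cong')
    fix x assume "x \<in> monomials n \<times> monomials n"
    have "e (fst x + snd x) m = (\<Oplus>s\<in>splittings m. e (fst x) (fst s) \<otimes> e (snd x) (snd s))"
      unfolding e_def eval_monomial_add by (rule mps_mult) simp_all
    thus "(\<Oplus>s\<in>splittings m. p (fst x) \<otimes> q (snd x) \<otimes> (e (fst x) (fst s) \<otimes> e (snd x) (snd s))) =
      p (fst x) \<otimes> q (snd x) \<otimes> e (fst x + snd x) m"
      by (simp add: finsum_rdistr)
  qed auto
  also have "\<dots> = (\<Oplus>x\<in>{x. fst x + snd x \<in> monomials n}. p (fst x) \<otimes> q (snd x) \<otimes> e (fst x + snd x) m)"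
    by (rule finsum_restrict_support[symmetric])
       (auto simp: monomials_def finite_monomials[unfolded monomials_def] n_def e_def
          intro!: eval_monomial_eq_zero[THEN arg_cong[of _ _ "\<lambda>t. _ \<otimes> t"], THEN trans])
  also have "\<dots> = (\<Oplus>y\<in>Sigma (monomials n) splittings. p (fst (snd y)) \<otimes> q (snd (snd y)) \<otimes> e (fst y) m)"
    by (rule finsum_bij_betw[where h = "\<lambda>x. (fst x + snd x, x)"])
       (auto simp: splittings_def bij_betw_def inj_on_def image_iff)
  also have "\<dots> = (\<Oplus>k\<in>monomials n. \<Oplus>x\<in>splittings k. p (fst x) \<otimes> q (snd x) \<otimes> e k m)"
    by (subst finsum_Sigma) auto
  also have "\<dots> = (\<Oplus>k\<in>monomials n. (p \<otimes>\<^bsub>mps R\<^esub> q) k \<otimes> e k m)"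
    by (rule finsum_cong')
       (use p q in \<open>auto simp: mps_mult finsum_ldistr intro!: finsum_closed\<close>)
  also have "\<dots> = eval_series R \<sigma> (p \<otimes>\<^bsub>mps R\<^esub> q) m"
    by (simp add: eval_series_def n_def e_def)
  finally show "eval_series R \<sigma> (p \<otimes>\<^bsub>mps R\<^esub> q) m = (eval_series R \<sigma> p \<otimes>\<^bsub>mps R\<^esub> eval_series R \<sigma> q) m" ..
qed

lemma eval_series_ring_hom: "eval_series R \<sigma> \<in> ring_hom (mps R) (mps R)"
  by (rule ring_hom_memI)
     (simp_all add: eval_series_one eval_series_add eval_series_mult)

end

sublocale substitution \<subseteq> E: ring_hom_cring "mps R :: (var multiset \<Rightarrow> 'a) ring" "mps R" "eval_series R \<sigma>"
  by unfold_locales (rule eval_series_ring_hom)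

section \<open>Composition of series\<close>

definition triple_assignment :: "'b \<Rightarrow> 'b \<Rightarrow> 'b \<Rightarrow> var \<Rightarrow> 'b" where
  "triple_assignment f g h v = (case v of VX \<Rightarrow> f | VY \<Rightarrow> g | VZ \<Rightarrow> h)"

lemma triple_assignment_simps [simp]:
  "triple_assignment f g h VX = f" "triple_assignment f g h VY = g" "triple_assignment f g h VZ = h"
  by (simp_all add: triple_assignment_def)

definition mps_scale :: "'a graded_ring \<Rightarrow> 'a \<Rightarrow> ('v multiset \<Rightarrow> 'a) \<Rightarrow> 'v multiset \<Rightarrow> 'a" where
  "mps_scale R c p = (\<lambda>m. c \<otimes>\<^bsub>R\<^esub> p m)"

context coefficient_ring
begin

lemma augmentation_zero [simp]: "\<zero>\<^bsub>mps R\<^esub> \<in> augmentation_ideal R"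
  by (simp add: augmentation_ideal_iff)

lemma augmentation_uminus:
  fixes g :: "var multiset \<Rightarrow> 'a"
  assumes "g \<in> augmentation_ideal R"
  shows "\<ominus>\<^bsub>mps R\<^esub> g \<in> augmentation_ideal R"
  using assms by (simp add: augmentation_ideal_def)

lemma augmentation_var [simp]: "mps_var R v \<in> augmentation_ideal R"
  by (simp add: augmentation_ideal_iff mps_var_def)

lemma var_carrier [simp]: "mps_var R v \<in> carrier (mps R)"
  using augmentation_var by blast

lemma mps_scale_closed [simp]:
  "c \<in> carrier R \<Longrightarrow> p \<in> carrier (mps R) \<Longrightarrow> mps_scale R c p \<in> carrier (mps R)"
  unfolding mps_scale_def by (rule mps_memI) simp

lemma substitution_triple:
  "f \<in> augmentation_ideal R \<Longrightarrow> g \<in> augmentation_ideal R \<Longrightarrow> h \<in> augmentation_ideal R \<Longrightarrow>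
     substitution R (triple_assignment f g h)"
  by unfold_locales (auto simp: triple_assignment_def split: var.split)

text \<open>The double sum defining a composite as a single sum over a square, which may be enlarged at will.\<close>

lemma subst2_extend:
  assumes F: "\<And>i j. F i j \<in> carrier R"
    and g: "g \<in> augmentation_ideal R" and h: "h \<in> augmentation_ideal R"
    and n: "size m \<le> n"
  shows "subst2 R F g h m = (\<Oplus>x\<in>{..n} \<times> {..n}. F (fst x) (snd x) \<otimes>
           (g [^]\<^bsub>mps R\<^esub> fst x \<otimes>\<^bsub>mps R\<^esub> h [^]\<^bsub>mps R\<^esub> snd x) m)"
proof -
  have gh: "(g [^]\<^bsub>mps R\<^esub> i \<otimes>\<^bsub>mps R\<^esub> h [^]\<^bsub>mps R\<^esub> j) \<in> carrier (mps R)" for i j :: nat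
    using g h by (auto)
  have vanish: "(g [^]\<^bsub>mps R\<^esub> i \<otimes>\<^bsub>mps R\<^esub> h [^]\<^bsub>mps R\<^esub> j) m = \<zero>"
    if "size m < i + j" for i j :: nat
    using order_at_least_pow_mult[OF g h, of i j] that by (simp add: order_at_least_def)
  have "subst2 R F g h m = (\<Oplus>x\<in>{..size m} \<times> {..size m}. F (fst x) (snd x) \<otimes>
           (g [^]\<^bsub>mps R\<^esub> fst x \<otimes>\<^bsub>mps R\<^esub> h [^]\<^bsub>mps R\<^esub> snd x) m)"
    unfolding subst2_def using F gh by (subst finsum_Sigma) auto
  also have "\<dots> = (\<Oplus>x\<in>{..n} \<times> {..n}. F (fst x) (snd x) \<otimes>
           (g [^]\<^bsub>mps R\<^esub> fst x \<otimes>\<^bsub>mps R\<^esub> h [^]\<^bsub>mps R\<^esub> snd x) m)"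
  proof (rule finsum_restrict_support)
    fix x assume "x \<notin> {..size m} \<times> {..size m}"
    hence "size m < fst x + snd x" by (cases x) auto
    thus "F (fst x) (snd x) \<otimes> (g [^]\<^bsub>mps R\<^esub> fst x \<otimes>\<^bsub>mps R\<^esub> h [^]\<^bsub>mps R\<^esub> snd x) m = \<zero>"
      using F vanish by simp
  qed (use F gh n in auto)
  finally show ?thesis .
qed

lemma subst2_closed:
  assumes F: "\<And>i j. F i j \<in> carrier R"
    and g: "g \<in> augmentation_ideal R" and h: "h \<in> augmentation_ideal R"
  shows "subst2 R F g h \<in> carrier (mps R)"
proof -
  have gh: "(g [^]\<^bsub>mps R\<^esub> i \<otimes>\<^bsub>mps R\<^esub> h [^]\<^bsub>mps R\<^esub> j) \<in> carrier (mps R)" for i j :: nat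
    using g h by (auto)
  show ?thesis
    using F gh
    by (intro mps_memI) (auto simp: subst2_extend[OF F g h order_refl] intro!: finsum_closed)
qed

lemma subst2_augmentation:
  assumes F: "\<And>i j. F i j \<in> carrier R" and F0: "F 0 0 = \<zero>"
    and g: "g \<in> augmentation_ideal R" and h: "h \<in> augmentation_ideal R"
  shows "subst2 R F g h \<in> augmentation_ideal R"
  using subst2_closed[OF F g h] F0
  by (auto simp: augmentation_ideal_def subst2_def mps_one)

lemma subst2_zero_left:
  assumes F: "\<And>i j. F i j \<in> carrier R" and h: "h \<in> augmentation_ideal R"
  shows "subst2 R F \<zero>\<^bsub>mps R\<^esub> h = subst1 R (F 0) h"
proof (rule ext)
  fix m :: "var multiset"
  have hj [simp]: "h [^]\<^bsub>mps R\<^esub> j \<in> carrier (mps R)" for j :: nat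
    using h by (auto)
  have [simp]: "(h [^]\<^bsub>mps R\<^esub> (j::nat)) m \<in> carrier R" for j m using hj by simp
  let ?f = "\<lambda>i. \<Oplus>j\<in>{..size m}. F i j \<otimes> (\<zero>\<^bsub>mps R\<^esub> [^]\<^bsub>mps R\<^esub> i \<otimes>\<^bsub>mps R\<^esub> h [^]\<^bsub>mps R\<^esub> j) m"
  have "subst2 R F \<zero>\<^bsub>mps R\<^esub> h m = ?f 0"
    unfolding subst2_def
  proof (rule finsum_eq_single)
    fix i :: nat assume "i \<noteq> 0"
    thus "?f i = \<zero>"
      by (intro add.finprod_one_eqI) (use F in \<open>simp add: P.nat_pow_zero\<close>)
  qed (use F in \<open>auto intro!: finsum_closed\<close>)
  thus "subst2 R F \<zero>\<^bsub>mps R\<^esub> h m = subst1 R (F 0) h m"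
    by (simp add: subst1_def)
qed

lemma subst2_zero_right:
  assumes F: "\<And>i j. F i j \<in> carrier R" and g: "g \<in> augmentation_ideal R"
  shows "subst2 R F g \<zero>\<^bsub>mps R\<^esub> = subst1 R (\<lambda>i. F i 0) g"
proof (rule ext)
  fix m :: "var multiset"
  have gi [simp]: "g [^]\<^bsub>mps R\<^esub> i \<in> carrier (mps R)" for i :: nat
    using g by (auto)
  have [simp]: "(g [^]\<^bsub>mps R\<^esub> (i::nat)) m \<in> carrier R" for i m using gi by simp
  let ?f = "\<lambda>i j. F i j \<otimes> (g [^]\<^bsub>mps R\<^esub> i \<otimes>\<^bsub>mps R\<^esub> \<zero>\<^bsub>mps R\<^esub> [^]\<^bsub>mps R\<^esub> j) m"
  have "(\<Oplus>j\<in>{..size m}. ?f i j) = F i 0 \<otimes> (g [^]\<^bsub>mps R\<^esub> i) m" for i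
  proof -
    have "(\<Oplus>j\<in>{..size m}. ?f i j) = ?f i 0"
      by (rule finsum_eq_single) (use F in \<open>auto simp: P.nat_pow_zero\<close>)
    thus ?thesis by (simp)
  qed
  thus "subst2 R F g \<zero>\<^bsub>mps R\<^esub> m = subst1 R (\<lambda>i. F i 0) g m"
    by (simp add: subst1_def subst2_def)
qed

text \<open>Composition in one variable is the case \<open>X = 0\<close> of composition in two, so only the latter needs
to be studied.\<close>

lemma subst1_eq_subst2:
  assumes "\<And>i. f i \<in> carrier R" "g \<in> augmentation_ideal R"
  shows "subst1 R f g = subst2 R (\<lambda>_. f) \<zero>\<^bsub>mps R\<^esub> g"
  using assms by (simp add: subst2_zero_left)

lemma subst1_augmentation:
  assumes "substitutable R f" "g \<in> augmentation_ideal R"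
  shows "subst1 R f g \<in> augmentation_ideal R"
  using assms by (simp add: subst1_eq_subst2 subst2_augmentation substitutable_def)

end

context substitution
begin

lemma eval_var: "eval_series R \<sigma> (mps_var R v) = \<sigma> v"
proof (rule ext)
  fix m :: "var multiset"
  have "eval_series R \<sigma> (mps_var R v) m =
      (\<Oplus>k\<in>monomials (Suc (size m)). mps_var R v k \<otimes> eval_monomial R \<sigma> k m)"
    by (rule eval_series_extend) (simp_all)
  also have "\<dots> = mps_var R v {#v#} \<otimes> eval_monomial R \<sigma> {#v#} m"
    by (rule finsum_eq_single)
       (auto simp: mps_var_def monomials_def finite_monomials[unfolded monomials_def])
  also have "\<dots> = \<sigma> v m"
    by (cases v) (simp_all add: mps_var_def eval_monomial_def)
  finally show "eval_series R \<sigma> (mps_var R v) m = \<sigma> v m" .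
qed

lemma eval_series_cong:
  assumes "\<And>k. size k \<le> size m \<Longrightarrow> p k = q k" "q \<in> carrier (mps R)"
  shows "eval_series R \<sigma> p m = eval_series R \<sigma> q m"
  unfolding eval_series_def
  by (rule finsum_cong') (use assms in \<open>auto simp: monomials_def\<close>)

lemma eval_scale:
  assumes "c \<in> carrier R" "p \<in> carrier (mps R)"
  shows "eval_series R \<sigma> (mps_scale R c p) = mps_scale R c (eval_series R \<sigma> p)"
proof (rule ext)
  fix m
  show "eval_series R \<sigma> (mps_scale R c p) m = mps_scale R c (eval_series R \<sigma> p) m"
    unfolding eval_series_def mps_scale_def
    using assms by (subst finsum_rdistr) (auto simp: m_assoc intro!: finsum_cong')
qed

lemma eval_pow:
  fixes i :: nat
  assumes "g \<in> carrier (mps R)"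
  shows "eval_series R \<sigma> (g [^]\<^bsub>mps R\<^esub> i) = eval_series R \<sigma> g [^]\<^bsub>mps R\<^esub> i"
  using assms
  by (induction i) (simp_all add: eval_series_one)

text \<open>Up to the size of the monomial considered, \<open>F(g, h)\<close> is a finite linear combination of products
\<open>g\<^sup>i h\<^sup>j\<close>, and a ring endomorphism that respects scalars commutes with such combinations.\<close>

lemma eval_subst2:
  assumes F: "\<And>i j. F i j \<in> carrier R"
    and g: "g \<in> augmentation_ideal R" and h: "h \<in> augmentation_ideal R"
  shows "eval_series R \<sigma> (subst2 R F g h) =
    subst2 R F (eval_series R \<sigma> g) (eval_series R \<sigma> h)"
proof (rule ext)
  fix m :: "var multiset"
  define I where "I = {..size m} \<times> {..size m}"
  define t where "t g h x = mps_scale R (F (fst x) (snd x)) (g [^]\<^bsub>mps R\<^esub> fst x \<otimes>\<^bsub>mps R\<^esub> h [^]\<^bsub>mps R\<^esub> snd x)"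
    for g h :: "var multiset \<Rightarrow> 'a" and x :: "nat \<times> nat"
  have gh [simp]: "g \<in> carrier (mps R)" "h \<in> carrier (mps R)" using g h by blast+
  have t [simp]: "t g h x \<in> carrier (mps R)"
    if "g \<in> carrier (mps R)" "h \<in> carrier (mps R)" for g h x
    using that F by (auto simp: t_def)
  have Et: "eval_series R \<sigma> (t g h x) = t (eval_series R \<sigma> g) (eval_series R \<sigma> h) x" for x
    using F by (simp add: t_def eval_scale eval_pow)
  \<comment> \<open>the finite partial sum agrees with the composite as far as the coefficient at \<open>m\<close> can see\<close>
  have sum: "(\<Oplus>\<^bsub>mps R\<^esub>x\<in>I. t g h x) k = subst2 R F g h k"
    if "g \<in> augmentation_ideal R" "h \<in> augmentation_ideal R" "size k \<le> size m" for g h k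
  proof -
    have "(\<Oplus>\<^bsub>mps R\<^esub>x\<in>I. t g h x) k = (\<Oplus>x\<in>I. t g h x k)"
      by (intro mps_finsum t augmentation_ideal_carrier that)
    also have "\<dots> = subst2 R F g h k"
      using that F by (simp add: subst2_extend I_def t_def mps_scale_def)
    finally show ?thesis .
  qed
  have "eval_series R \<sigma> (subst2 R F g h) m = eval_series R \<sigma> (\<Oplus>\<^bsub>mps R\<^esub>x\<in>I. t g h x) m"
    by (rule eval_series_cong)
       (use g h in \<open>auto simp: sum intro!: P.finsum_closed\<close>)
  also have "eval_series R \<sigma> (\<Oplus>\<^bsub>mps R\<^esub>x\<in>I. t g h x) =
      (\<Oplus>\<^bsub>mps R\<^esub>x\<in>I. t (eval_series R \<sigma> g) (eval_series R \<sigma> h) x)"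
    by (subst E.hom_finsum) (simp_all add: Et comp_def Pi_def)
  also have "\<dots> m = subst2 R F (eval_series R \<sigma> g) (eval_series R \<sigma> h) m"
    by (rule sum) (use g h in \<open>simp_all add: eval_series_augmentation\<close>)
  finally show "eval_series R \<sigma> (subst2 R F g h) m = subst2 R F (eval_series R \<sigma> g) (eval_series R \<sigma> h) m" .
qed

lemma eval_subst1:
  assumes "\<And>i. f i \<in> carrier R" "g \<in> augmentation_ideal R"
  shows "eval_series R \<sigma> (subst1 R f g) = subst1 R f (eval_series R \<sigma> g)"
  using assms
  by (simp add: subst1_eq_subst2 eval_subst2 eval_series_augmentation)

end

context coefficient_ring
begin

text \<open>Reading off coefficients and composing again amounts to setting \<open>Z = 0\<close> and substituting for \<open>X\<close> and
\<open>Y\<close>: the monomials of \<open>s\<close> that involve \<open>Z\<close> are lost on the left and become zero on the right.\<close>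

lemma subst2_coeffs2:
  assumes s: "s \<in> carrier (mps R)"
    and g: "g \<in> augmentation_ideal R" and h: "h \<in> augmentation_ideal R"
  shows "subst2 R (coeffs2 s) g h = eval_series R (triple_assignment g h \<zero>\<^bsub>mps R\<^esub>) s"
proof (rule ext)
  fix m :: "var multiset"
  define n where "n = size m"
  interpret S: substitution R "triple_assignment g h \<zero>\<^bsub>mps R\<^esub>"
    using g h by (intro substitution_triple) auto
  have [simp]: "g [^]\<^bsub>mps R\<^esub> i \<in> carrier (mps R)" "h [^]\<^bsub>mps R\<^esub> i \<in> carrier (mps R)" for i :: nat
    using g h by (auto)
  have c: "coeffs2 s i j \<in> carrier R" for i j using s by (simp add: coeffs2_def)
  have closed: "s k \<otimes> eval_monomial R (triple_assignment g h \<zero>\<^bsub>mps R\<^esub>) k m \<in> carrier R" for k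
    using s by (simp add: S.eval_monomial_closed')
  have closed2: "coeffs2 s i j \<otimes> (g [^]\<^bsub>mps R\<^esub> i \<otimes>\<^bsub>mps R\<^esub> h [^]\<^bsub>mps R\<^esub> j) m \<in> carrier R" for i j
    using c by (simp)
  let ?v = "\<lambda>x. replicate_mset (fst x) VX + replicate_mset (snd x) VY"
  have "subst2 R (coeffs2 s) g h m = (\<Oplus>x\<in>{..n} \<times> {..n}. coeffs2 s (fst x) (snd x) \<otimes>
           (g [^]\<^bsub>mps R\<^esub> fst x \<otimes>\<^bsub>mps R\<^esub> h [^]\<^bsub>mps R\<^esub> snd x) m)"
    using c g h by (simp add: subst2_extend n_def)
  also have "\<dots> = (\<Oplus>x\<in>{x. fst x + snd x \<le> n}. coeffs2 s (fst x) (snd x) \<otimes>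
           (g [^]\<^bsub>mps R\<^esub> fst x \<otimes>\<^bsub>mps R\<^esub> h [^]\<^bsub>mps R\<^esub> snd x) m)"
  proof (rule finsum_restrict_support[symmetric])
    fix x :: "nat \<times> nat" assume "x \<notin> {x. fst x + snd x \<le> n}"
    hence "(g [^]\<^bsub>mps R\<^esub> fst x \<otimes>\<^bsub>mps R\<^esub> h [^]\<^bsub>mps R\<^esub> snd x) m = \<zero>"
      using order_at_least_pow_mult[OF g h, of "fst x" "snd x"]
      by (simp add: order_at_least_def n_def)
    thus "coeffs2 s (fst x) (snd x) \<otimes> (g [^]\<^bsub>mps R\<^esub> fst x \<otimes>\<^bsub>mps R\<^esub> h [^]\<^bsub>mps R\<^esub> snd x) m = \<zero>"
      using c by simp
  qed (use closed2 in auto)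
  also have "\<dots> = (\<Oplus>k\<in>{k \<in> monomials n. count k VZ = 0}.
      s k \<otimes> eval_monomial R (triple_assignment g h \<zero>\<^bsub>mps R\<^esub>) k m)"
  proof (rule finsum_bij_betw[where h = ?v])
    show "bij_betw ?v {x. fst x + snd x \<le> n} {k \<in> monomials n. count k VZ = 0}"
    proof (rule bij_betw_byWitness[where f' = "\<lambda>k. (count k VX, count k VY)"])
      show "\<forall>k\<in>{k \<in> monomials n. count k VZ = 0}. ?v (count k VX, count k VY) = k"
      proof (intro ballI multiset_eqI)
        fix k v assume "k \<in> {k \<in> monomials n. count k VZ = 0}"
        thus "count (?v (count k VX, count k VY)) v = count k v" by (cases v) auto
      qed
    qed (auto simp: monomials_def size_var_multiset)
    show "s (?v x) \<otimes> eval_monomial R (triple_assignment g h \<zero>\<^bsub>mps R\<^esub>) (?v x) m =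
        coeffs2 s (fst x) (snd x) \<otimes> (g [^]\<^bsub>mps R\<^esub> fst x \<otimes>\<^bsub>mps R\<^esub> h [^]\<^bsub>mps R\<^esub> snd x) m" for x
      by (simp add: eval_monomial_def coeffs2_def)
  qed (rule closed)
  also have "\<dots> = (\<Oplus>k\<in>monomials n. s k \<otimes> eval_monomial R (triple_assignment g h \<zero>\<^bsub>mps R\<^esub>) k m)"
  proof (rule finsum_restrict_support)
    fix k assume "k \<in> monomials n" "k \<notin> {k \<in> monomials n. count k VZ = 0}"
    hence "count k VZ \<noteq> 0" by simp
    hence "eval_monomial R (triple_assignment g h \<zero>\<^bsub>mps R\<^esub>) k = \<zero>\<^bsub>mps R\<^esub>"
      by (simp add: eval_monomial_def P.nat_pow_zero)
    thus "s k \<otimes> eval_monomial R (triple_assignment g h \<zero>\<^bsub>mps R\<^esub>) k m = \<zero>"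
      using s by simp
  qed (use closed in auto)
  also have "\<dots> = eval_series R (triple_assignment g h \<zero>\<^bsub>mps R\<^esub>) s m"
    by (simp add: eval_series_def n_def)
  finally show "subst2 R (coeffs2 s) g h m = eval_series R (triple_assignment g h \<zero>\<^bsub>mps R\<^esub>) s m" .
qed

lemma subst1_coeffs1:
  assumes s: "s \<in> carrier (mps R)" and g: "g \<in> augmentation_ideal R"
  shows "subst1 R (coeffs1 s) g = eval_series R (triple_assignment g \<zero>\<^bsub>mps R\<^esub> \<zero>\<^bsub>mps R\<^esub>) s"
proof -
  have "subst1 R (coeffs1 s) g = subst2 R (coeffs2 s) g \<zero>\<^bsub>mps R\<^esub>"
    using s g by (subst subst2_zero_right) (auto simp: coeffs1_def[abs_def] coeffs2_def)
  thus ?thesis using s g by (simp add: subst2_coeffs2)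
qed

definition monomial_series :: "var multiset \<Rightarrow> var multiset \<Rightarrow> 'a" where
  "monomial_series a m = (if m = a then \<one> else \<zero>)"

lemma monomial_series_mult:
  "monomial_series a \<otimes>\<^bsub>mps R\<^esub> monomial_series b = monomial_series (a + b)"
proof (rule ext)
  fix m :: "var multiset"
  have c: "monomial_series a \<in> carrier (mps R)" for a by (simp add: carrier_mps monomial_series_def)
  show "(monomial_series a \<otimes>\<^bsub>mps R\<^esub> monomial_series b) m = monomial_series (a + b) m"
  proof (cases "m = a + b")
    case True
    have "(\<Oplus>p\<in>splittings m. monomial_series a (fst p) \<otimes> monomial_series b (snd p)) =
        monomial_series a (fst (a, b)) \<otimes> monomial_series b (snd (a, b))"
      by (rule finsum_eq_single)
         (auto simp: True monomial_series_def splittings_def finite_splittings[unfolded splittings_def])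
    thus ?thesis using c True by (simp add: mps_mult monomial_series_def)
  next
    case False
    have "monomial_series a (fst p) \<otimes> monomial_series b (snd p) = \<zero>" if "p \<in> splittings m" for p
      using False that by (auto simp: monomial_series_def splittings_def)
    thus ?thesis using c False by (simp add: mps_mult monomial_series_def add.finprod_one_eqI)
  qed
qed

lemma var_pow: "mps_var R v [^]\<^bsub>mps R\<^esub> (i::nat) = monomial_series (replicate_mset i v)"
proof (induction i)
  case 0
  show ?case by (simp add: fun_eq_iff mps_one monomial_series_def)
next
  case (Suc i)
  have v: "mps_var R v = monomial_series {#v#}" by (simp add: fun_eq_iff mps_var_def monomial_series_def)
  have "mps_var R v [^]\<^bsub>mps R\<^esub> Suc i = monomial_series (replicate_mset i v) \<otimes>\<^bsub>mps R\<^esub> mps_var R v"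
    by (simp add: Suc)
  thus ?case by (simp add: v monomial_series_mult del: P.nat_pow_Suc)
qed

lemma coeffs2_subst2:
  assumes F: "\<And>i j. F i j \<in> carrier R"
  shows "coeffs2 (subst2 R F (mps_var R VX) (mps_var R VY)) = F"
proof (intro ext)
  fix i j :: nat
  let ?m = "replicate_mset i VX + replicate_mset j VY"
  let ?t = "\<lambda>x. F (fst x) (snd x) \<otimes> monomial_series (replicate_mset (fst x) VX + replicate_mset (snd x) VY) ?m"
  have inj: "?m = replicate_mset i' VX + replicate_mset j' VY \<longleftrightarrow> (i' = i \<and> j' = j)" for i' j'
    by (metis (no_types, lifting) add.commute add_0 count_replicate_mset count_union var.distinct(1))
  have "coeffs2 (subst2 R F (mps_var R VX) (mps_var R VY)) i j = (\<Oplus>x\<in>{..i+j} \<times> {..i+j}. ?t x)"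
    unfolding coeffs2_def
    by (subst subst2_extend[where n = "i + j"]) (use F in \<open>simp_all add: var_pow monomial_series_mult\<close>)
  also have "\<dots> = ?t (i, j)"
    by (rule finsum_eq_single) (use F in \<open>auto simp: monomial_series_def inj\<close>)
  also have "\<dots> = F i j" using F by (simp add: monomial_series_def)
  finally show "coeffs2 (subst2 R F (mps_var R VX) (mps_var R VY)) i j = F i j" .
qed

lemma coeffs1_subst1:
  assumes f: "\<And>i. f i \<in> carrier R"
  shows "coeffs1 (subst1 R f (mps_var R VX)) = f"
proof -
  have "coeffs1 (subst1 R f (mps_var R VX)) i = f i" for i
  proof -
    let ?t = "\<lambda>k. f k \<otimes> monomial_series (replicate_mset k VX) (replicate_mset i VX)"
    have "coeffs1 (subst1 R f (mps_var R VX)) i = (\<Oplus>k\<in>{..i}. ?t k)"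
      by (simp add: coeffs1_def subst1_def var_pow)
    also have "\<dots> = ?t i"
      by (rule finsum_eq_single)
         (use f in \<open>auto simp: monomial_series_def replicate_mset_eq_iff\<close>)
    also have "\<dots> = f i" using f by (simp add: monomial_series_def)
    finally show ?thesis .
  qed
  thus ?thesis by (simp add: fun_eq_iff)
qed

lemma subst2_linear_coeff:
  assumes F: "\<And>i j. F i j \<in> carrier R" and F0: "F 0 0 = \<zero>"
    and g: "g \<in> augmentation_ideal R" and h: "h \<in> augmentation_ideal R"
  shows "subst2 R F g h {#v#} = F 1 0 \<otimes> g {#v#} \<oplus> F 0 1 \<otimes> h {#v#}"
proof -
  have gh: "g \<in> carrier (mps R)" "h \<in> carrier (mps R)" using g h by blast+
  have "(g \<otimes>\<^bsub>mps R\<^esub> h) {#v#} = \<zero>"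
    using order_at_least_pow_mult[OF g h, of 1 1] gh by (simp add: order_at_least_def)
  moreover have "subst2 R F g h {#v#} = (\<Oplus>x\<in>{(0, 0), (1, 0), (0, 1), (1, 1)}. F (fst x) (snd x) \<otimes>
           (g [^]\<^bsub>mps R\<^esub> fst x \<otimes>\<^bsub>mps R\<^esub> h [^]\<^bsub>mps R\<^esub> snd x) {#v#})"
  proof -
    have "{..Suc 0} \<times> {..Suc 0} = {(0, 0), (1, 0), (0, 1), (1, 1)}" by auto
    thus ?thesis by (subst subst2_extend[OF F g h, where n = "Suc 0"]) simp_all
  qed
  ultimately show ?thesis
    using F F0 gh by (simp add: finsum_insert Pi_def mps_one)
qed

lemma subst1_linear_coeff:
  assumes "substitutable R f" "g \<in> augmentation_ideal R"
  shows "subst1 R f g {#v#} = f 1 \<otimes> g {#v#}"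
  using assms augmentation_ideal_carrier[OF assms(2)]
  by (simp add: subst1_eq_subst2 subst2_linear_coeff substitutable_def)

end

section \<open>Homogeneous series\<close>

text \<open>The variables have degree \<open>-2\<close>, as the orientation of \<open>MU\<close> lives in cohomological degree 2. Then a
homogeneous series of total degree \<open>-2w\<close> has its coefficient at \<open>m\<close> in degree \<open>2 size m - 2w\<close>. The
coefficient families of formal group laws make \<open>w = 1\<close> stable under composition.\<close>

definition homogeneous :: "'a graded_ring \<Rightarrow> int \<Rightarrow> ('v multiset \<Rightarrow> 'a) \<Rightarrow> bool" where
  "homogeneous R w f \<longleftrightarrow> (\<forall>m. f m \<in> grade R (2 * int (size m) - 2 * w))"

locale graded_coefficient_ring = coefficient_ring +
  assumes graded: "graded_cring R"
begin

lemma grade_subgroup: "additive_subgroup (grade R n) R"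
  using graded by (simp add: graded_cring_def)

lemma grade_closed [simp]: "x \<in> grade R n \<Longrightarrow> x \<in> carrier R"
  using additive_subgroup.a_Hcarr[OF grade_subgroup] .

lemma grade_zero [simp]: "\<zero> \<in> grade R n"
  using additive_subgroup.zero_closed[OF grade_subgroup] .

lemma grade_add: "x \<in> grade R n \<Longrightarrow> y \<in> grade R n \<Longrightarrow> x \<oplus> y \<in> grade R n"
  using additive_subgroup.a_closed[OF grade_subgroup] .

lemma grade_uminus: "x \<in> grade R n \<Longrightarrow> \<ominus> x \<in> grade R n"
  using additive_subgroup.a_inv_closed[OF grade_subgroup] abelian_group_axioms by blast

lemma grade_one [simp]: "\<one> \<in> grade R 0"
  using graded by (simp add: graded_cring_def)

lemma grade_mult: "x \<in> grade R m \<Longrightarrow> y \<in> grade R n \<Longrightarrow> x \<otimes> y \<in> grade R (m + n)"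
  using graded by (simp add: graded_cring_def)

lemma grade_finsum:
  assumes "\<And>i. i \<in> I \<Longrightarrow> f i \<in> grade R n"
  shows "finsum R f I \<in> grade R n"
  using assms
proof (induction I rule: infinite_finite_induct)
  case (insert x I)
  thus ?case by (subst finsum_insert) (auto intro: grade_add grade_closed)
qed auto

lemma homogeneous_mult:
  assumes "f \<in> carrier (mps R)" "g \<in> carrier (mps R)" "homogeneous R a f" "homogeneous R b g"
  shows "homogeneous R (a + b) (f \<otimes>\<^bsub>mps R\<^esub> g)"
  unfolding homogeneous_def
proof
  fix m
  have "f (fst p) \<otimes> g (snd p) \<in> grade R (2 * int (size m) - 2 * (a + b))" if "p \<in> splittings m" for p
  proof -
    have eq: "2 * int (size m) - 2 * (a + b) =
        (2 * int (size (fst p)) - 2 * a) + (2 * int (size (snd p)) - 2 * b)"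
      using that by (auto simp: splittings_def)
    show ?thesis
      unfolding eq using assms by (intro grade_mult) (auto simp: homogeneous_def)
  qed
  thus "(f \<otimes>\<^bsub>mps R\<^esub> g) m \<in> grade R (2 * int (size m) - 2 * (a + b))"
    using assms by (simp add: mps_mult grade_finsum)
qed

lemma homogeneous_pow:
  fixes g :: "var multiset \<Rightarrow> 'a"
  assumes "g \<in> carrier (mps R)" "homogeneous R 1 g"
  shows "homogeneous R (int i) (g [^]\<^bsub>mps R\<^esub> i)"
proof (induction i)
  case 0
  show ?case by (simp add: homogeneous_def mps_one)
next
  case (Suc i)
  show ?case using homogeneous_mult[OF _ _ Suc assms(2)] assms by (simp add: add.commute)
qed

lemma homogeneous_subst2:
  assumes F: "\<And>i j. F i j \<in> grade R (2 * int i + 2 * int j - 2)"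
    and g: "g \<in> augmentation_ideal R" "homogeneous R 1 g"
    and h: "h \<in> augmentation_ideal R" "homogeneous R 1 h"
  shows "homogeneous R 1 (subst2 R F g h)"
  unfolding homogeneous_def subst2_def
proof (intro allI grade_finsum)
  fix m i j
  have "homogeneous R (int i + int j) (g [^]\<^bsub>mps R\<^esub> i \<otimes>\<^bsub>mps R\<^esub> h [^]\<^bsub>mps R\<^esub> j)"
    using g h by (intro homogeneous_mult homogeneous_pow) auto
  hence "F i j \<otimes> (g [^]\<^bsub>mps R\<^esub> i \<otimes>\<^bsub>mps R\<^esub> h [^]\<^bsub>mps R\<^esub> j) m
      \<in> grade R ((2 * int i + 2 * int j - 2) + (2 * int (size m) - 2 * (int i + int j)))"
    by (intro grade_mult F) (simp add: homogeneous_def)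
  also have "(2 * int i + 2 * int j - 2) + (2 * int (size m) - 2 * (int i + int j)) = 2 * int (size m) - 2 * 1"
    by simp
  finally show "F i j \<otimes> (g [^]\<^bsub>mps R\<^esub> i \<otimes>\<^bsub>mps R\<^esub> h [^]\<^bsub>mps R\<^esub> j) m \<in> grade R (2 * int (size m) - 2 * 1)" .
qed

lemma homogeneous_subst1:
  assumes f: "\<And>i. f i \<in> grade R (2 * int i - 2)"
    and g: "g \<in> augmentation_ideal R" "homogeneous R 1 g"
  shows "homogeneous R 1 (subst1 R f g)"
proof -
  let ?C = "\<lambda>i j. if i = 0 then f j else \<zero>"
  have "homogeneous R 1 (subst2 R ?C \<zero>\<^bsub>mps R\<^esub> g)"
    using f g by (intro homogeneous_subst2) (auto simp: homogeneous_def)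
  moreover have "f i \<in> carrier R" for i using f by (rule grade_closed)
  ultimately show ?thesis using g by (simp add: subst2_zero_left)
qed

lemma homogeneous_var [simp]: "homogeneous R 1 (mps_var R v)"
  by (simp add: homogeneous_def mps_var_def)

lemma homogeneous_zero [simp]: "homogeneous R w \<zero>\<^bsub>mps R\<^esub>"
  by (simp add: homogeneous_def)

lemma homogeneous_uminus:
  fixes g :: "var multiset \<Rightarrow> 'a"
  shows "g \<in> carrier (mps R) \<Longrightarrow> homogeneous R w g \<Longrightarrow> homogeneous R w (\<ominus>\<^bsub>mps R\<^esub> g)"
  by (simp add: homogeneous_def grade_uminus)

lemma homogeneous_coeffs1: "homogeneous R 1 s \<Longrightarrow> coeffs1 s i \<in> grade R (2 * int i - 2)"
  unfolding homogeneous_def coeffs1_def by (drule spec[of _ "replicate_mset i VX"]) simp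

lemma homogeneous_coeffs2: "homogeneous R 1 s \<Longrightarrow> coeffs2 s i j \<in> grade R (2 * int i + 2 * int j - 2)"
  unfolding homogeneous_def coeffs2_def
  by (drule spec[of _ "replicate_mset i VX + replicate_mset j VY"]) (simp add: algebra_simps)

end

section \<open>Solving equations by successive approximation\<close>

text \<open>The iterates of \<open>T\<close> agree with each other on ever larger monomials, and their stable values form the fixed
point. The set \<open>A\<close> is given by conditions on single coefficients, so that it is closed under this
passage to the limit.\<close>

lemma contraction_fixpoint:
  fixes T :: "('v multiset \<Rightarrow> 'a) \<Rightarrow> 'v multiset \<Rightarrow> 'a"
  assumes z: "z \<in> A" and A: "A = {y. \<forall>m. y m \<in> B m}"
    and T: "\<And>y. y \<in> A \<Longrightarrow> T y \<in> A"
    and contraction: "\<And>y y' n m. y \<in> A \<Longrightarrow> y' \<in> A \<Longrightarrow> (\<And>k. size k < n \<Longrightarrow> y k = y' k) \<Longrightarrow>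
      size m \<le> n \<Longrightarrow> T y m = T y' m"
  shows "\<exists>y\<in>A. T y = y"
proof -
  define it where "it i = (T ^^ i) z" for i :: nat
  have it_Suc: "it (Suc i) = T (it i)" for i by (simp add: it_def)
  have it_A: "it i \<in> A" for i
    by (induction i) (use z T in \<open>auto simp: it_def\<close>)
  have step: "it (Suc i) k = it i k" if "size k < i" for i k
    using that
  proof (induction i arbitrary: k)
    case (Suc i)
    show ?case
      unfolding it_Suc[of "Suc i"] it_Suc[of i]
      by (rule contraction[where n = i]) (use it_A it_A[of "Suc i"] Suc it_Suc in auto)
  qed simp
  have stable: "it (i + d) k = it i k" if "size k < i" for i d k
    using that by (induction d) (auto simp: step)
  define y where "y k = it (Suc (size k)) k" for k
  have y_it: "y k = it i k" if "size k < i" for i k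
    using stable[of k "Suc (size k)" "i - Suc (size k)"] that by (simp add: y_def)
  have y: "y \<in> A"
    using it_A by (auto simp: A y_def)
  have "T y m = y m" for m
  proof -
    have "T y m = T (it (Suc (size m))) m"
      by (rule contraction[where n = "size m"], rule y, rule it_A, rule y_it) simp_all
    also have "\<dots> = y m" using y_it[of m "Suc (Suc (size m))"] by (simp add: it_Suc)
    finally show ?thesis .
  qed
  thus ?thesis using y by auto
qed

context coefficient_ring
begin

text \<open>If \<open>y\<close> and \<open>y'\<close> agree below size \<open>n\<close>, their powers agree further out: all factors but one contribute
order at least 1.\<close>

lemma pow_agree:
  fixes y y' :: "var multiset \<Rightarrow> 'a"
  assumes y: "y \<in> augmentation_ideal R" "y' \<in> augmentation_ideal R"
    and agree: "\<And>k. size k < n \<Longrightarrow> y k = y' k"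
    and "size m < n + j"
  shows "(y [^]\<^bsub>mps R\<^esub> Suc j) m = (y' [^]\<^bsub>mps R\<^esub> Suc j) m"
  using assms(4)
proof (induction j arbitrary: m)
  case 0
  thus ?case using y agree by (auto dest!: augmentation_ideal_carrier)
next
  case (Suc j)
  have c: "y \<in> carrier (mps R)" "y' \<in> carrier (mps R)" using y by auto
  have "(y [^]\<^bsub>mps R\<^esub> Suc j) (fst p) \<otimes> y (snd p) = (y' [^]\<^bsub>mps R\<^esub> Suc j) (fst p) \<otimes> y' (snd p)"
    if p: "p \<in> splittings m" for p
  proof -
    have m: "size m = size (fst p) + size (snd p)" using p by (auto simp: splittings_def)
    consider "size (snd p) = 0" | "size (fst p) < Suc j" | "size (snd p) \<ge> 1" "size (fst p) \<ge> Suc j"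
      by linarith
    thus ?thesis
    proof cases
      case 1
      thus ?thesis using y c by (simp add: augmentation_ideal_def del: P.nat_pow_Suc)
    next
      case 2
      thus ?thesis
        using order_at_least_pow[OF y(1), of "Suc j"] order_at_least_pow[OF y(2), of "Suc j"] c
        by (simp add: order_at_least_def del: P.nat_pow_Suc)
    next
      case 3
      have "(y [^]\<^bsub>mps R\<^esub> Suc j) (fst p) = (y' [^]\<^bsub>mps R\<^esub> Suc j) (fst p)"
        by (rule Suc.IH) (use 3 m Suc.prems in linarith)
      moreover have "y (snd p) = y' (snd p)"
        by (rule agree) (use 3 m Suc.prems in linarith)
      ultimately show ?thesis by simp
    qed
  qed
  hence "(y [^]\<^bsub>mps R\<^esub> Suc j \<otimes>\<^bsub>mps R\<^esub> y) m = (y' [^]\<^bsub>mps R\<^esub> Suc j \<otimes>\<^bsub>mps R\<^esub> y') m"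
    using c by (subst (1 2) mps_mult) (auto intro!: finsum_cong' simp del: P.nat_pow_Suc)
  thus ?case by simp
qed

lemma pow_mult_agree:
  fixes g y y' :: "var multiset \<Rightarrow> 'a" and i j :: nat
  assumes g: "g \<in> augmentation_ideal R" and y: "y \<in> augmentation_ideal R" "y' \<in> augmentation_ideal R"
    and agree: "\<And>k. size k < n \<Longrightarrow> y k = y' k"
    and "size m \<le> n" and ij: "(i, j) \<noteq> (0, 1)"
  shows "(g [^]\<^bsub>mps R\<^esub> i \<otimes>\<^bsub>mps R\<^esub> y [^]\<^bsub>mps R\<^esub> j) m = (g [^]\<^bsub>mps R\<^esub> i \<otimes>\<^bsub>mps R\<^esub> y' [^]\<^bsub>mps R\<^esub> j) m"
proof (cases j)
  case 0
  thus ?thesis by simp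
next
  case (Suc l)
  have c: "g \<in> carrier (mps R)" "y \<in> carrier (mps R)" "y' \<in> carrier (mps R)" using g y by auto
  have "(g [^]\<^bsub>mps R\<^esub> i) (fst p) \<otimes> (y [^]\<^bsub>mps R\<^esub> j) (snd p) =
      (g [^]\<^bsub>mps R\<^esub> i) (fst p) \<otimes> (y' [^]\<^bsub>mps R\<^esub> j) (snd p)"
    if p: "p \<in> splittings m" for p
  proof (cases "size (fst p) < i")
    case True
    thus ?thesis
      using order_at_least_pow[OF g, of i] c by (simp add: order_at_least_def)
  next
    case False
    have "size m = size (fst p) + size (snd p)" using p by (auto simp: splittings_def)
    moreover have "i > 0 \<or> l > 0" using ij Suc by auto
    ultimately have "size (snd p) < n + l" using False assms(5) by linarith
    hence "(y [^]\<^bsub>mps R\<^esub> Suc l) (snd p) = (y' [^]\<^bsub>mps R\<^esub> Suc l) (snd p)"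
      by (intro pow_agree[OF y agree])
    thus ?thesis by (simp add: Suc)
  qed
  thus ?thesis
    using c by (subst (1 2) mps_mult) (auto intro!: finsum_cong')
qed

text \<open>Without the term linear in \<open>y\<close> alone, \<open>C(g, y)\<close> gains one order of precision over \<open>y\<close>. This is what makes
the iteration below a contraction.\<close>

lemma subst2_agree:
  assumes C: "\<And>i j. C i j \<in> carrier R" "C 0 1 = \<zero>"
    and g: "g \<in> augmentation_ideal R" and y: "y \<in> augmentation_ideal R" "y' \<in> augmentation_ideal R"
    and agree: "\<And>k. size k < n \<Longrightarrow> y k = y' k"
    and m: "size m \<le> n"
  shows "subst2 R C g y m = subst2 R C g y' m"
proof -
  have c: "g \<in> carrier (mps R)" "y \<in> carrier (mps R)" "y' \<in> carrier (mps R)" using g y by auto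
  have "C i j \<otimes> (g [^]\<^bsub>mps R\<^esub> i \<otimes>\<^bsub>mps R\<^esub> y [^]\<^bsub>mps R\<^esub> j) m =
      C i j \<otimes> (g [^]\<^bsub>mps R\<^esub> i \<otimes>\<^bsub>mps R\<^esub> y' [^]\<^bsub>mps R\<^esub> j) m" for i j
  proof (cases "(i, j) = (0, 1)")
    case True
    thus ?thesis using C c by simp
  next
    case False
    thus ?thesis by (subst pow_mult_agree[OF g y agree m]) auto
  qed
  thus ?thesis by (simp add: subst2_def)
qed

lemma subst2_split_linear:
  fixes C :: "nat \<Rightarrow> nat \<Rightarrow> 'a"
  defines "C' \<equiv> \<lambda>i j. if i = 0 \<and> j = 1 then \<zero> else C i j"
  assumes C: "\<And>i j. C i j \<in> carrier R"
    and g: "g \<in> augmentation_ideal R" and y: "y \<in> augmentation_ideal R"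
  shows "subst2 R C g y m = C 0 1 \<otimes> y m \<oplus> subst2 R C' g y m"
proof -
  define n where "n = Suc (size m)"
  have c [simp]: "g \<in> carrier (mps R)" "y \<in> carrier (mps R)" using g y by auto
  define t where "t x = (g [^]\<^bsub>mps R\<^esub> fst x \<otimes>\<^bsub>mps R\<^esub> y [^]\<^bsub>mps R\<^esub> snd x) m" for x :: "nat \<times> nat"
  have t [simp]: "t x \<in> carrier R" for x by (simp add: t_def)
  have C' [simp]: "C' i j \<in> carrier R" for i j using C by (simp add: C'_def)
  let ?d = "\<lambda>x :: nat \<times> nat. if x = (0, 1) then C 0 1 \<otimes> t (0, 1) else \<zero>"
  have "subst2 R C g y m = (\<Oplus>x\<in>{..n} \<times> {..n}. C (fst x) (snd x) \<otimes> t x)"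
    using C g y by (simp add: subst2_extend n_def t_def)
  also have "\<dots> = (\<Oplus>x\<in>{..n} \<times> {..n}. ?d x \<oplus> C' (fst x) (snd x) \<otimes> t x)"
    by (rule finsum_cong') (use C in \<open>auto simp: C'_def\<close>)
  also have "\<dots> = (\<Oplus>x\<in>{..n} \<times> {..n}. ?d x) \<oplus> (\<Oplus>x\<in>{..n} \<times> {..n}. C' (fst x) (snd x) \<otimes> t x)"
    by (rule finsum_addf) (use C in auto)
  also have "(\<Oplus>x\<in>{..n} \<times> {..n}. ?d x) = ?d (0, 1)"
    by (rule finsum_eq_single) (use C in \<open>auto simp: n_def\<close>)
  also have "?d (0, 1) = C 0 1 \<otimes> y m" by (simp add: t_def)
  also have "(\<Oplus>x\<in>{..n} \<times> {..n}. C' (fst x) (snd x) \<otimes> t x) = subst2 R C' g y m"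
    by (subst subst2_extend[OF C' g y, where n = n]) (simp_all add: n_def t_def)
  finally show ?thesis .
qed

text \<open>By induction on the size of the monomial: once \<open>y\<close> and \<open>y'\<close> agree below size \<open>n\<close>, the nonlinear
parts agree up to size \<open>n\<close>, and the linear coefficient can be cancelled.\<close>

lemma subst2_solution_unique:
  assumes C: "\<And>i j. C i j \<in> carrier R" and v: "v \<in> carrier R" "v \<otimes> C 0 1 = \<one>"
    and g: "g \<in> augmentation_ideal R" and y: "y \<in> augmentation_ideal R" "y' \<in> augmentation_ideal R"
    and eq: "subst2 R C g y = subst2 R C g y'"
  shows "y = y'"
proof -
  have c: "y \<in> carrier (mps R)" "y' \<in> carrier (mps R)" using y by auto
  let ?C' = "\<lambda>i j. if i = 0 \<and> j = 1 then \<zero> else C i j"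
  have "\<forall>m. size m < n \<longrightarrow> y m = y' m" for n
  proof (induction n)
    case (Suc n)
    show ?case
    proof (intro allI impI)
      fix m :: "var multiset" assume m: "size m < Suc n"
      have "subst2 R ?C' g y' \<in> carrier (mps R)"
        by (rule subst2_closed) (use C g y in auto)
      hence s: "subst2 R ?C' g y' m \<in> carrier R" by simp
      have "subst2 R ?C' g y m = subst2 R ?C' g y' m"
        by (rule subst2_agree[where n = n]) (use C g y Suc m in auto)
      moreover have "C 0 1 \<otimes> y m \<oplus> subst2 R ?C' g y m = C 0 1 \<otimes> y' m \<oplus> subst2 R ?C' g y' m"
        using fun_cong[OF eq, of m]
        unfolding subst2_split_linear[OF C g y(1)] subst2_split_linear[OF C g y(2)] .
      ultimately have "C 0 1 \<otimes> y m = C 0 1 \<otimes> y' m"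
        using s C c by simp
      moreover have "z = v \<otimes> (C 0 1 \<otimes> z)" if "z \<in> carrier R" for z
        using m_assoc[of v "C 0 1" z] v C that by simp
      ultimately show "y m = y' m" using c by (metis mps_coeff_closed)
    qed
  qed simp
  thus ?thesis by (intro ext) blast
qed

end

context graded_coefficient_ring
begin

text \<open>Write \<open>C(g, y) = u y + C'(g, y)\<close> with \<open>v u = 1\<close>. The equation \<open>C(g, y) = w\<close> says that \<open>y\<close> is a
fixed point of \<open>y \<mapsto> v (w - C'(g, y))\<close>. The iteration stays among homogeneous series because \<open>v\<close> has
degree 0.\<close>

lemma subst2_solution_exists:
  assumes C: "\<And>i j. C i j \<in> grade R (2 * int i + 2 * int j - 2)" and C0: "C 0 0 = \<zero>"
    and v: "v \<in> grade R 0" "v \<otimes> C 0 1 = \<one>"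
    and g: "g \<in> augmentation_ideal R" "homogeneous R 1 g"
    and w: "w \<in> augmentation_ideal R" "homogeneous R 1 w"
  shows "\<exists>y\<in>augmentation_ideal R. homogeneous R 1 y \<and> subst2 R C g y = w"
proof -
  define C' where "C' i j = (if i = 0 \<and> j = 1 then \<zero> else C i j)" for i j :: nat
  have Cc: "C i j \<in> carrier R" for i j using C by (rule grade_closed)
  have C': "C' i j \<in> carrier R" for i j using Cc by (simp add: C'_def)
  have C'g: "C' i j \<in> grade R (2 * int i + 2 * int j - 2)" for i j using C by (simp add: C'_def)
  have C'0: "C' 0 0 = \<zero>" using C0 by (simp add: C'_def)
  have vc: "v \<in> carrier R" using v by simp
  have wc: "w \<in> carrier (mps R)" using w by auto
  define A where "A = {y \<in> augmentation_ideal R. homogeneous R 1 (y :: var multiset \<Rightarrow> 'a)}"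
  define T where "T y m = v \<otimes> (w m \<ominus> subst2 R C' g y m)" for y m
  have S: "subst2 R C' g y \<in> augmentation_ideal R" "homogeneous R 1 (subst2 R C' g y)" if "y \<in> A" for y
    using that g C' C'0 C'g by (auto simp: A_def intro!: subst2_augmentation homogeneous_subst2)
  have Sc: "subst2 R C' g y m \<in> carrier R" if "y \<in> A" for y m
    using S[OF that] by auto
  have "\<exists>y\<in>A. T y = y"
  proof (rule contraction_fixpoint)
    show "\<zero>\<^bsub>mps R\<^esub> \<in> A" by (simp add: A_def)
    show "A = {y. \<forall>m. y m \<in> {c \<in> grade R (2 * int (size m) - 2 * 1). m = {#} \<longrightarrow> c = \<zero>}}"
      by (auto simp: A_def homogeneous_def augmentation_ideal_iff intro: grade_closed)
    show "T y \<in> A" if y: "y \<in> A" for y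
    proof -
      have "T y m \<in> grade R (0 + (2 * int (size m) - 2 * 1))" for m
        unfolding T_def a_minus_def using S[OF y] w v
        by (intro grade_mult grade_add grade_uminus) (auto simp: homogeneous_def)
      moreover have "T y m \<in> carrier R" for m
        using calculation grade_closed by blast
      ultimately show ?thesis
        using S[OF y] w vc by (simp add: A_def homogeneous_def augmentation_ideal_def mps_memI)
          (simp add: T_def a_minus_def)
    qed
    show "T y m = T y' m"
      if "y \<in> A" "y' \<in> A" "\<And>k. size k < n \<Longrightarrow> y k = y' k" "size m \<le> n" for y y' n m
      unfolding T_def
      by (subst subst2_agree[where n = n and y' = y']) (use that g C' in \<open>auto simp: A_def C'_def\<close>)
  qed
  then obtain y where y: "y \<in> A" "T y = y" by blast
  have yc: "y \<in> carrier (mps R)" using y by (auto simp: A_def)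
  have "subst2 R C g y m = w m" for m
  proof -
    have "subst2 R C g y m = C 0 1 \<otimes> y m \<oplus> subst2 R C' g y m"
      unfolding C'_def[abs_def] using Cc g y by (intro subst2_split_linear) (auto simp: A_def)
    also have "C 0 1 \<otimes> y m = C 0 1 \<otimes> (v \<otimes> (w m \<ominus> subst2 R C' g y m))"
      using fun_cong[OF y(2), of m] by (simp add: T_def)
    also have "\<dots> = (v \<otimes> C 0 1) \<otimes> (w m \<ominus> subst2 R C' g y m)"
      using vc wc Sc[OF y(1)] Cc by (simp add: m_ac del: v(2))
    also have "\<dots> = w m \<ominus> subst2 R C' g y m"
      using v(2) wc Sc[OF y(1)] by simp
    also have "\<dots> \<oplus> subst2 R C' g y m = w m"
      using wc Sc[OF y(1)] by (simp add: a_minus_def a_assoc l_neg)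
    finally show ?thesis .
  qed
  thus ?thesis using y by (auto simp: A_def)
qed

end

context coefficient_ring
begin

text \<open>Evaluation at points: \<open>at3 f g h\<close> substitutes \<open>f\<close>, \<open>g\<close>, \<open>h\<close> for the three variables, and the other two
kill the variables for which no value is given.\<close>

abbreviation at3 where "at3 f g h \<equiv> eval_series R (triple_assignment f g h)"
abbreviation at2 where "at2 f g \<equiv> at3 f g \<zero>\<^bsub>mps R\<^esub>"
abbreviation at1 where "at1 f \<equiv> at2 f \<zero>\<^bsub>mps R\<^esub>"

lemma at3_simps [simp]:
  assumes fgh: "f \<in> augmentation_ideal R" "g \<in> augmentation_ideal R" "h \<in> augmentation_ideal R"
  shows "at3 f g h (mps_var R VX) = f" "at3 f g h (mps_var R VY) = g" "at3 f g h (mps_var R VZ) = h"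
    "at3 f g h \<zero>\<^bsub>mps R\<^esub> = \<zero>\<^bsub>mps R\<^esub>"
    "p \<in> augmentation_ideal R \<Longrightarrow> at3 f g h p \<in> augmentation_ideal R"
    "p \<in> carrier (mps R) \<Longrightarrow> at3 f g h (\<ominus>\<^bsub>mps R\<^esub> p) = \<ominus>\<^bsub>mps R\<^esub> at3 f g h p"
    "(\<And>i j. F i j \<in> carrier R) \<Longrightarrow> p \<in> augmentation_ideal R \<Longrightarrow> q \<in> augmentation_ideal R \<Longrightarrow>
       at3 f g h (subst2 R F p q) = subst2 R F (at3 f g h p) (at3 f g h q)"
    "(\<And>i. c i \<in> carrier R) \<Longrightarrow> p \<in> augmentation_ideal R \<Longrightarrow>
       at3 f g h (subst1 R c p) = subst1 R c (at3 f g h p)"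
proof -
  interpret S: substitution R "triple_assignment f g h"
    by (rule substitution_triple[OF fgh])
  show "at3 f g h (mps_var R VX) = f" "at3 f g h (mps_var R VY) = g" "at3 f g h (mps_var R VZ) = h"
    by (simp_all add: S.eval_var)
  show "at3 f g h \<zero>\<^bsub>mps R\<^esub> = \<zero>\<^bsub>mps R\<^esub>" by (rule S.E.hom_zero)
  show "p \<in> augmentation_ideal R \<Longrightarrow> at3 f g h p \<in> augmentation_ideal R"
    by (rule S.eval_series_augmentation)
  show "p \<in> carrier (mps R) \<Longrightarrow> at3 f g h (\<ominus>\<^bsub>mps R\<^esub> p) = \<ominus>\<^bsub>mps R\<^esub> at3 f g h p"
    by (rule S.E.hom_a_inv)
  show "(\<And>i j. F i j \<in> carrier R) \<Longrightarrow> p \<in> augmentation_ideal R \<Longrightarrow> q \<in> augmentation_ideal R \<Longrightarrow>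
       at3 f g h (subst2 R F p q) = subst2 R F (at3 f g h p) (at3 f g h q)"
    by (rule S.eval_subst2)
  show "(\<And>i. c i \<in> carrier R) \<Longrightarrow> p \<in> augmentation_ideal R \<Longrightarrow>
       at3 f g h (subst1 R c p) = subst1 R c (at3 f g h p)"
    by (rule S.eval_subst1)
qed

lemma var_coeff_self [simp]: "mps_var R v {#v#} = \<one>"
  by (simp add: mps_var_def)

lemma substitutable_coeff: "substitutable R f \<Longrightarrow> f i \<in> carrier R"
  by (simp add: substitutable_def)

lemma substitutable_coeffs1: "s \<in> augmentation_ideal R \<Longrightarrow> substitutable R (coeffs1 s)"
  using augmentation_ideal_carrier[of s R] by (simp add: substitutable_def coeffs1_def augmentation_ideal_def)

lemma subst1_inject:
  assumes "substitutable R f" "substitutable R f'"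
    "subst1 R f (mps_var R VX) = subst1 R f' (mps_var R VX)"
  shows "f = f'"
  using assms by (metis coeffs1_subst1 substitutable_coeff)

lemma subst1_solution_unique:
  assumes f: "substitutable R f" and v: "v \<in> carrier R" "v \<otimes> f 1 = \<one>"
    and y: "y \<in> augmentation_ideal R" "y' \<in> augmentation_ideal R"
    and eq: "subst1 R f y = subst1 R f y'"
  shows "y = y'"
  by (rule subst2_solution_unique[where C = "\<lambda>_. f" and g = "\<zero>\<^bsub>mps R\<^esub>"])
     (use assms in \<open>auto simp: substitutable_coeff subst1_eq_subst2[symmetric]\<close>)

end

context graded_coefficient_ring
begin

text \<open>The solution of \<open>C(g, y) = w\<close> as a family of coefficients. The conditions on \<open>at1\<close> say that only
the variable \<open>X\<close> occurs in \<open>g\<close> and \<open>w\<close>. The solution \<open>y\<close> itself may be evaluated at \<open>Y = Z = 0\<close>, which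
preserves the equation.\<close>

lemma series_solution:
  assumes C: "\<And>i j. C i j \<in> grade R (2 * int i + 2 * int j - 2)" and C0: "C 0 0 = \<zero>"
    and v: "v \<in> grade R 0" "v \<otimes> C 0 1 = \<one>"
    and g: "g \<in> augmentation_ideal R" "homogeneous R 1 g" "at1 (mps_var R VX) g = g"
    and w: "w \<in> augmentation_ideal R" "homogeneous R 1 w" "at1 (mps_var R VX) w = w"
  obtains f where "substitutable R f" "\<And>i. f i \<in> grade R (2 * int i - 2)"
    "subst2 R C g (subst1 R f (mps_var R VX)) = w"
    "\<And>f'. substitutable R f' \<Longrightarrow> subst2 R C g (subst1 R f' (mps_var R VX)) = w \<Longrightarrow> f' = f"
proof -
  have Cc: "C i j \<in> carrier R" for i j using C by (rule grade_closed)
  obtain y where y: "y \<in> augmentation_ideal R" "homogeneous R 1 y" "subst2 R C g y = w"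
    using subst2_solution_exists[OF C C0 v g(1,2) w(1,2)] by blast
  have s: "substitutable R (coeffs1 y)" using y by (intro substitutable_coeffs1)
  have eq: "subst2 R C g (subst1 R (coeffs1 y) (mps_var R VX)) = w"
  proof -
    have "subst2 R C g (subst1 R (coeffs1 y) (mps_var R VX)) = at1 (mps_var R VX) (subst2 R C g y)"
      using Cc g y(1) by (simp add: subst1_coeffs1 augmentation_ideal_carrier)
    thus ?thesis using y w by simp
  qed
  show thesis
  proof (rule that[OF s _ eq])
    show "coeffs1 y i \<in> grade R (2 * int i - 2)" for i by (rule homogeneous_coeffs1[OF y(2)])
    show "f' = coeffs1 y"
      if f': "substitutable R f'" "subst2 R C g (subst1 R f' (mps_var R VX)) = w" for f'
    proof (rule subst1_inject[OF f'(1) s])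
      show "subst1 R f' (mps_var R VX) = subst1 R (coeffs1 y) (mps_var R VX)"
        by (rule subst2_solution_unique[where C = C, OF Cc _ v(2) g(1)])
           (use v s f' eq in \<open>auto intro!: subst1_augmentation\<close>)
    qed
  qed
qed

lemma right_inverse_series:
  assumes f: "f 0 = \<zero>" "\<And>i. f i \<in> grade R (2 * int i - 2)"
    and v: "v \<in> grade R 0" "v \<otimes> f 1 = \<one>"
  obtains g where "substitutable R g" "\<And>i. g i \<in> grade R (2 * int i - 2)"
    "subst1 R f (subst1 R g (mps_var R VX)) = mps_var R VX"
    "\<And>g'. substitutable R g' \<Longrightarrow> subst1 R f (subst1 R g' (mps_var R VX)) = mps_var R VX \<Longrightarrow> g' = g"
proof -
  let ?C = "\<lambda>i j. if i = (0::nat) then f j else \<zero>"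
  have fc: "f i \<in> carrier R" for i using f(2) by (rule grade_closed)
  have C: "subst2 R ?C \<zero>\<^bsub>mps R\<^esub> (subst1 R g (mps_var R VX)) = subst1 R f (subst1 R g (mps_var R VX))"
    if "substitutable R g" for g
    using fc that by (subst subst2_zero_left) (auto intro!: subst1_augmentation)
  obtain g where "substitutable R g" "\<And>i. g i \<in> grade R (2 * int i - 2)"
    "subst2 R ?C \<zero>\<^bsub>mps R\<^esub> (subst1 R g (mps_var R VX)) = mps_var R VX"
    "\<And>g'. substitutable R g' \<Longrightarrow> subst2 R ?C \<zero>\<^bsub>mps R\<^esub> (subst1 R g' (mps_var R VX)) = mps_var R VX \<Longrightarrow> g' = g"
  proof -
    have C: "?C i j \<in> grade R (2 * int i + 2 * int j - 2)" for i j using f by simp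
    have C': "?C 0 0 = \<zero>" "v \<otimes> ?C 0 1 = \<one>" using f v by simp_all
    have x: "at1 (mps_var R VX) \<zero>\<^bsub>mps R\<^esub> = \<zero>\<^bsub>mps R\<^esub>" "at1 (mps_var R VX) (mps_var R VX) = mps_var R VX"
      by simp_all
    show ?thesis
      using series_solution[of ?C v "\<zero>\<^bsub>mps R\<^esub>" "mps_var R VX", OF C C'(1) v(1) C'(2)
          augmentation_zero homogeneous_zero x(1) augmentation_var homogeneous_var x(2)] that by blast
  qed
  thus thesis using that C by metis
qed

text \<open>A right inverse \<open>h\<close> of \<open>f\<close> is a left inverse as well: \<open>f(h(f(g))) = f(g)\<close>, and \<open>f\<close> can be cancelled
because its linear coefficient is a unit.\<close>

lemma comp_inverse:
  assumes f: "f 0 = \<zero>" "\<And>i. f i \<in> grade R (2 * int i - 2)"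
    and v: "v \<in> grade R 0" "v \<otimes> f 1 = \<one>"
  shows "substitutable R (comp_inverse R f)"
    and "comp_inverse R f i \<in> grade R (2 * int i - 2)"
    and "g \<in> augmentation_ideal R \<Longrightarrow> subst1 R f (subst1 R (comp_inverse R f) g) = g"
    and "g \<in> augmentation_ideal R \<Longrightarrow> subst1 R (comp_inverse R f) (subst1 R f g) = g"
proof -
  let ?x = "mps_var R VX"
  have fs: "substitutable R f" using f by (auto simp: substitutable_def intro: grade_closed)
  obtain h where h: "substitutable R h" "\<And>i. h i \<in> grade R (2 * int i - 2)"
    "subst1 R f (subst1 R h ?x) = ?x"
    "\<And>g'. substitutable R g' \<Longrightarrow> subst1 R f (subst1 R g' ?x) = ?x \<Longrightarrow> g' = h"
    using right_inverse_series[OF f v] by blast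
  have right: "subst1 R f (subst1 R h g) = g" if g: "g \<in> augmentation_ideal R" for g
  proof -
    have "at1 g (subst1 R f (subst1 R h ?x)) = subst1 R f (subst1 R h g)"
      using g fs h(1) by (simp add: substitutable_coeff subst1_augmentation)
    thus ?thesis using h(3) g by simp
  qed
  have left: "subst1 R h (subst1 R f g) = g" if g: "g \<in> augmentation_ideal R" for g
    by (rule subst1_solution_unique[OF fs, of v])
       (use v g fs h(1) right in \<open>auto intro!: subst1_augmentation\<close>)
  have "comp_inverse R f = h"
    unfolding comp_inverse_def
    by (rule the_equality, use h(1,3) left in simp, use h(4) in blast)
  thus "substitutable R (comp_inverse R f)" "comp_inverse R f i \<in> grade R (2 * int i - 2)"
    "g \<in> augmentation_ideal R \<Longrightarrow> subst1 R f (subst1 R (comp_inverse R f) g) = g"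
    "g \<in> augmentation_ideal R \<Longrightarrow> subst1 R (comp_inverse R f) (subst1 R f g) = g"
    using h(1,2) right left by auto
qed

end

section \<open>The group of points of a formal group law\<close>

definition fgl_group ::
  "'a graded_ring \<Rightarrow> (nat \<Rightarrow> nat \<Rightarrow> 'a) \<Rightarrow> (var multiset \<Rightarrow> 'a) monoid" where
  "fgl_group R F =
     \<lparr>carrier = augmentation_ideal R, monoid.mult = subst2 R F, one = \<zero>\<^bsub>mps R\<^esub>\<rparr>"

locale formal_group = graded_coefficient_ring +
  fixes F :: "nat \<Rightarrow> nat \<Rightarrow> 'a"
  assumes law: "formal_group_law R F"
begin

lemma F_grade: "F i j \<in> grade R (2 * int i + 2 * int j - 2)"
  using law by (simp add: formal_group_law_def)

lemma F_closed [simp]: "F i j \<in> carrier R"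
  using F_grade by (rule grade_closed)

lemma law_axioms:
  "subst2 R F (mps_var R VX) \<zero>\<^bsub>mps R\<^esub> = mps_var R VX"
  "subst2 R F (mps_var R VX) (mps_var R VY) = subst2 R F (mps_var R VY) (mps_var R VX)"
  "subst2 R F (subst2 R F (mps_var R VX) (mps_var R VY)) (mps_var R VZ) =
   subst2 R F (mps_var R VX) (subst2 R F (mps_var R VY) (mps_var R VZ))"
  using law unfolding formal_group_law_def Let_def by blast+

lemma F_0_0 [simp]: "F 0 0 = \<zero>"
  using fun_cong[OF law_axioms(1), of "{#}"] by (simp add: subst2_def mps_one mps_var_def)

lemma F_augmentation [simp]:
  "g \<in> augmentation_ideal R \<Longrightarrow> h \<in> augmentation_ideal R \<Longrightarrow> subst2 R F g h \<in> augmentation_ideal R"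
  by (simp add: subst2_augmentation)

text \<open>Compare linear coefficients in \<open>F(X, 0) = X\<close>.\<close>

lemma F_1_0 [simp]: "F (Suc 0) 0 = \<one>"
proof -
  have "subst2 R F (mps_var R VX) \<zero>\<^bsub>mps R\<^esub> {#VX#} = \<one>"
    by (simp add: law_axioms)
  thus ?thesis by (simp add: subst2_linear_coeff)
qed

lemma F_unit: "g \<in> augmentation_ideal R \<Longrightarrow> subst2 R F g \<zero>\<^bsub>mps R\<^esub> = g"
  using arg_cong[OF law_axioms(1), of "at1 g"] by simp

lemma F_comm:
  "g \<in> augmentation_ideal R \<Longrightarrow> h \<in> augmentation_ideal R \<Longrightarrow> subst2 R F g h = subst2 R F h g"
  using arg_cong[OF law_axioms(2), of "at2 g h"] by simp

lemma F_assoc: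
  "g \<in> augmentation_ideal R \<Longrightarrow> h \<in> augmentation_ideal R \<Longrightarrow> k \<in> augmentation_ideal R \<Longrightarrow>
     subst2 R F (subst2 R F g h) k = subst2 R F g (subst2 R F h k)"
  using arg_cong[OF law_axioms(3), of "at3 g h k"] by simp

lemma F_unit_left: "g \<in> augmentation_ideal R \<Longrightarrow> subst2 R F \<zero>\<^bsub>mps R\<^esub> g = g"
  by (simp add: F_comm[of "\<zero>\<^bsub>mps R\<^esub>"] F_unit)

lemma F_0_1 [simp]: "F 0 (Suc 0) = \<one>"
proof -
  have "subst2 R F \<zero>\<^bsub>mps R\<^esub> (mps_var R VX) {#VX#} = \<one>"
    by (simp add: F_unit_left)
  thus ?thesis by (simp add: subst2_linear_coeff)
qed

text \<open>The equation \<open>F(X, y) = 0\<close> has linear coefficient 1 in \<open>y\<close>. Evaluating the resulting identity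
at \<open>g\<close> gives the inverse of \<open>g\<close>.\<close>

lemma neg_series:
  "substitutable R (neg_series R F)" "neg_series R F i \<in> grade R (2 * int i - 2)"
  "g \<in> augmentation_ideal R \<Longrightarrow> subst2 R F g (subst1 R (neg_series R F) g) = \<zero>\<^bsub>mps R\<^esub>"
  and neg_series_unique:
  "substitutable R f \<Longrightarrow> subst2 R F (mps_var R VX) (subst1 R f (mps_var R VX)) = \<zero>\<^bsub>mps R\<^esub> \<Longrightarrow>
     neg_series R F = f"
proof -
  let ?x = "mps_var R VX"
  obtain f where f: "substitutable R f" "\<And>i. f i \<in> grade R (2 * int i - 2)"
    "subst2 R F ?x (subst1 R f ?x) = \<zero>\<^bsub>mps R\<^esub>"
    "\<And>f'. substitutable R f' \<Longrightarrow> subst2 R F ?x (subst1 R f' ?x) = \<zero>\<^bsub>mps R\<^esub> \<Longrightarrow> f' = f"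
  proof -
    have x: "at1 ?x \<zero>\<^bsub>mps R\<^esub> = \<zero>\<^bsub>mps R\<^esub>" "at1 ?x ?x = ?x" and one: "\<one> \<otimes> F 0 1 = \<one>" by simp_all
    show ?thesis
      using series_solution[of F \<one> ?x "\<zero>\<^bsub>mps R\<^esub>", OF F_grade F_0_0 grade_one one
          augmentation_var homogeneous_var x(2) augmentation_zero homogeneous_zero x(1)] that by blast
  qed
  have eq: "neg_series R F = f"
    unfolding neg_series_def by (rule the_equality, use f(1,3) in simp, use f(4) in blast)
  show "substitutable R (neg_series R F)" "neg_series R F i \<in> grade R (2 * int i - 2)"
    using f(1,2) eq by auto
  show "subst2 R F g (subst1 R (neg_series R F) g) = \<zero>\<^bsub>mps R\<^esub>" if g: "g \<in> augmentation_ideal R"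
    using arg_cong[OF f(3), of "at1 g"] g f(1) eq
    by (simp add: substitutable_coeff subst1_augmentation)
  show "substitutable R f' \<Longrightarrow> subst2 R F ?x (subst1 R f' ?x) = \<zero>\<^bsub>mps R\<^esub> \<Longrightarrow> neg_series R F = f'" for f'
    using f(4) eq by blast
qed

lemma fgl_group_comm_group: "comm_group (fgl_group R F)"
proof (rule comm_groupI)
  fix g assume g: "g \<in> carrier (fgl_group R F)"
  thus "\<exists>h\<in>carrier (fgl_group R F). h \<otimes>\<^bsub>fgl_group R F\<^esub> g = \<one>\<^bsub>fgl_group R F\<^esub>"
    using neg_series(1,3)
    by (intro bexI[where x = "subst1 R (neg_series R F) g"])
       (auto simp: fgl_group_def subst1_augmentation F_comm)
qed (auto simp: fgl_group_def F_assoc F_unit F_unit_left intro: F_comm)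

end

sublocale formal_group \<subseteq> G: comm_group "fgl_group R F"
  rewrites "carrier (fgl_group R F) = augmentation_ideal R"
    and "monoid.mult (fgl_group R F) = subst2 R F"
    and "one (fgl_group R F) = \<zero>\<^bsub>mps R\<^esub>"
  by (rule fgl_group_comm_group) (simp_all add: fgl_group_def)

context formal_group
begin

abbreviation group_neg ("neg") where "neg g \<equiv> inv\<^bsub>fgl_group R F\<^esub> g"

lemma subst1_neg_series:
  "g \<in> augmentation_ideal R \<Longrightarrow> subst1 R (neg_series R F) g = neg g"
  using neg_series(1,3)
  by (intro G.inv_equality[symmetric]) (auto simp: subst1_augmentation F_comm)

text \<open>By uniqueness of inverses in the group, \<open>[-1](X)\<close> equals \<open>-X\<close> as soon as \<open>F(X, -X) = 0\<close>. Hence oddness can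
be checked without computing the series \<open>[-1]\<close>.\<close>

lemma odd_iff:
  "odd_formal_group_law R F \<longleftrightarrow>
     subst2 R F (mps_var R VX) (\<ominus>\<^bsub>mps R\<^esub> mps_var R VX) = \<zero>\<^bsub>mps R\<^esub>"
proof -
  have "odd_formal_group_law R F \<longleftrightarrow> neg (mps_var R VX) = \<ominus>\<^bsub>mps R\<^esub> mps_var R VX"
    using law by (simp add: odd_formal_group_law_def subst1_neg_series)
  also have "\<dots> \<longleftrightarrow> subst2 R F (mps_var R VX) (\<ominus>\<^bsub>mps R\<^esub> mps_var R VX) = \<zero>\<^bsub>mps R\<^esub>"
    by (metis G.r_inv G.inv_equality F_comm augmentation_var augmentation_uminus)
  finally show ?thesis .
qed

lemma two_series_grade: "two_series R F i \<in> grade R (2 * int i - 2)"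
  unfolding two_series_def
  by (intro homogeneous_coeffs1 homogeneous_subst2) (simp_all add: F_grade)

lemma two_series_substitutable: "substitutable R (two_series R F)"
  unfolding two_series_def by (intro substitutable_coeffs1) simp

lemma subst1_two_series:
  "g \<in> augmentation_ideal R \<Longrightarrow> subst1 R (two_series R F) g = subst2 R F g g"
  unfolding two_series_def
  by (subst subst1_coeffs1) (simp_all add: augmentation_ideal_carrier)

lemma two_series_1: "two_series R F (Suc 0) = \<one> \<oplus> \<one>"
  by (simp add: two_series_def coeffs1_def subst2_linear_coeff)

end

locale half_formal_group = formal_group +
  fixes half :: 'a
  assumes half_grade: "half \<in> grade R 0" and half_two: "half \<otimes> (\<one> \<oplus> \<one>) = \<one>"
begin

lemma half_closed [simp]: "half \<in> carrier R"
  using half_grade by (rule grade_closed)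

lemma half_series:
  "substitutable R (half_series R F)" "half_series R F i \<in> grade R (2 * int i - 2)"
  and half_series_double: "g \<in> augmentation_ideal R \<Longrightarrow>
    subst2 R F (subst1 R (half_series R F) g) (subst1 R (half_series R F) g) = g"
  and half_series_unique:
  "substitutable R f \<Longrightarrow> subst2 R F (subst1 R f (mps_var R VX)) (subst1 R f (mps_var R VX)) = mps_var R VX \<Longrightarrow>
     half_series R F = f"
proof -
  let ?x = "mps_var R VX"
  obtain f where f: "substitutable R f" "\<And>i. f i \<in> grade R (2 * int i - 2)"
    "subst1 R (two_series R F) (subst1 R f ?x) = ?x"
    "\<And>f'. substitutable R f' \<Longrightarrow> subst1 R (two_series R F) (subst1 R f' ?x) = ?x \<Longrightarrow> f' = f"
  proof -
    have "two_series R F 0 = \<zero>" "half \<otimes> two_series R F 1 = \<one>"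
      using two_series_substitutable half_two by (simp_all add: two_series_1 substitutable_def)
    thus ?thesis
      using right_inverse_series[OF _ two_series_grade half_grade] that by blast
  qed
  have eq: "half_series R F = f"
    unfolding half_series_def by (rule the_equality, use f(1,3) in simp, use f(4) in blast)
  show "substitutable R (half_series R F)" "half_series R F i \<in> grade R (2 * int i - 2)"
    using f(1,2) eq by auto
  show "subst2 R F (subst1 R (half_series R F) g) (subst1 R (half_series R F) g) = g"
    if g: "g \<in> augmentation_ideal R"
    using arg_cong[OF f(3), of "at1 g"] g f(1) eq
    by (simp add: substitutable_coeff subst1_augmentation subst1_two_series)
  show "substitutable R f' \<Longrightarrow> subst2 R F (subst1 R f' ?x) (subst1 R f' ?x) = ?x \<Longrightarrow> half_series R F = f'" for f'
    using f(4)[of f'] eq by (simp add: subst1_two_series subst1_augmentation)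
qed

abbreviation halve where "halve g \<equiv> subst1 R (half_series R F) g"

lemma halve_closed [simp]: "g \<in> augmentation_ideal R \<Longrightarrow> halve g \<in> augmentation_ideal R"
  by (rule subst1_augmentation[OF half_series(1)])

text \<open>Doubling is injective, so a half is recognized by doubling it. All identities for \<open>halve\<close> are
obtained in this way.\<close>

lemma halve_eqI:
  assumes "h \<in> augmentation_ideal R" "subst2 R F h h = g"
  shows "halve g = h"
proof -
  have g: "g \<in> augmentation_ideal R" using assms by auto
  show ?thesis
    by (rule subst1_solution_unique[OF two_series_substitutable half_closed])
       (use assms g half_two in \<open>auto simp: subst1_two_series half_series_double two_series_1\<close>)
qed

lemma halve_neg:
  assumes g: "g \<in> augmentation_ideal R"
  shows "halve (neg g) = neg (halve g)"
  by (rule halve_eqI) (use g in \<open>simp_all add: G.inv_mult[symmetric] half_series_double\<close>)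

lemma halve_zero: "halve \<zero>\<^bsub>mps R\<^esub> = \<zero>\<^bsub>mps R\<^esub>"
  by (rule halve_eqI) (simp_all add: F_unit)

abbreviation phi where "phi \<equiv> phi_series R F"

lemma subst1_phi:
  assumes g: "g \<in> augmentation_ideal R"
  shows "subst1 R phi g = halve (subst2 R F g (neg (\<ominus>\<^bsub>mps R\<^esub> g)))"
proof -
  have "subst1 R phi g = at1 g (halve (subst2 R F (mps_var R VX)
      (subst1 R (neg_series R F) (\<ominus>\<^bsub>mps R\<^esub> mps_var R VX))))"
    unfolding phi_series_def Let_def
    using g neg_series(1)
    by (intro subst1_coeffs1) (auto intro!: augmentation_ideal_carrier subst1_augmentation augmentation_uminus half_series(1) F_augmentation)
  also have "\<dots> = halve (subst2 R F g (subst1 R (neg_series R F) (\<ominus>\<^bsub>mps R\<^esub> g)))"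
    using g neg_series(1) half_series(1)
    by (simp add: substitutable_coeff subst1_augmentation augmentation_uminus)
  finally show ?thesis using g by (simp add: subst1_neg_series augmentation_uminus)
qed

lemma phi_substitutable: "substitutable R phi"
  unfolding phi_series_def Let_def
  using neg_series(1)
  by (intro substitutable_coeffs1) (auto intro!: subst1_augmentation augmentation_uminus half_series(1) F_augmentation)

lemma phi_grade: "phi i \<in> grade R (2 * int i - 2)"
  unfolding phi_series_def Let_def
  using neg_series(1)
  by (intro homogeneous_coeffs1 homogeneous_subst1 homogeneous_subst2 homogeneous_uminus
        half_series neg_series F_grade)
     (auto intro!: subst1_augmentation augmentation_uminus F_augmentation)

lemma phi_closed [simp]: "g \<in> augmentation_ideal R \<Longrightarrow> subst1 R phi g \<in> augmentation_ideal R"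
  by (rule subst1_augmentation[OF phi_substitutable])

text \<open>The linear coefficients of \<open>[-1](X)\<close> and \<open>[1/2](X)\<close> are \<open>-1\<close> and \<open>1/2\<close>, so that of \<open>\<phi>\<close> is
\<open>1/2 (1 + (-1)(-1)) = 1\<close>. In particular \<open>\<phi>\<close> is invertible under composition.\<close>

lemma phi_1: "phi (Suc 0) = \<one>"
proof -
  let ?x = "mps_var R VX" and ?m = "{#VX#}"
  have c: "neg_series R F (Suc 0) \<in> carrier R" "half_series R F (Suc 0) \<in> carrier R"
    using neg_series(1) half_series(1) by (simp_all add: substitutable_coeff)
  have "subst2 R F ?x (subst1 R (neg_series R F) ?x) ?m = \<zero>"
    by (simp add: neg_series(3))
  hence "\<one> \<oplus> neg_series R F (Suc 0) = \<zero>"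
    using c by (simp add: subst2_linear_coeff subst1_linear_coeff subst1_augmentation neg_series(1))
  hence n: "neg_series R F (Suc 0) = \<ominus> \<one>"
    using c by (metis a_comm minus_equality one_closed)
  have h: "half_series R F (Suc 0) \<otimes> (\<one> \<oplus> \<one>) = \<one>"
  proof -
    have "subst2 R F (halve ?x) (halve ?x) ?m = \<one>" by (simp add: half_series_double)
    thus ?thesis
      using c by (simp add: subst2_linear_coeff subst1_linear_coeff half_series(1) r_distr)
  qed
  have "phi (Suc 0) = half_series R F (Suc 0) \<otimes> (\<one> \<oplus> neg_series R F (Suc 0) \<otimes> \<ominus> \<one>)"
    using c unfolding phi_series_def Let_def coeffs1_def
    by (simp add: subst2_linear_coeff subst1_linear_coeff subst1_augmentation augmentation_uminus
        neg_series(1) half_series(1))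
  thus ?thesis using n h by (simp add: l_minus r_minus)
qed

text \<open>The key identity: \<open>\<phi>\<close> exchanges the sign of the power series ring with the inverse of the group.\<close>

lemma phi_neg:
  assumes g: "g \<in> augmentation_ideal R"
  shows "subst1 R phi (\<ominus>\<^bsub>mps R\<^esub> g) = neg (subst1 R phi g)"
proof -
  have u: "\<ominus>\<^bsub>mps R\<^esub> g \<in> augmentation_ideal R" using g by (rule augmentation_uminus)
  have "subst1 R phi (\<ominus>\<^bsub>mps R\<^esub> g) = halve (subst2 R F (\<ominus>\<^bsub>mps R\<^esub> g) (neg g))"
    using u g by (simp add: subst1_phi augmentation_ideal_carrier)
  also have "subst2 R F (\<ominus>\<^bsub>mps R\<^esub> g) (neg g) = neg (subst2 R F g (neg (\<ominus>\<^bsub>mps R\<^esub> g)))"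
    using u g by (simp add: G.inv_mult F_comm)
  also have "halve \<dots> = neg (subst1 R phi g)"
    using u g by (simp add: halve_neg subst1_phi)
  finally show ?thesis .
qed

abbreviation psi where "psi \<equiv> comp_inverse R phi"

lemma phi_0: "phi 0 = \<zero>"
  using phi_substitutable by (simp add: substitutable_def)

lemma psi: "substitutable R psi" "psi i \<in> grade R (2 * int i - 2)"
  and phi_psi: "g \<in> augmentation_ideal R \<Longrightarrow> subst1 R phi (subst1 R psi g) = g"
  and psi_phi: "g \<in> augmentation_ideal R \<Longrightarrow> subst1 R psi (subst1 R phi g) = g"
  using comp_inverse[OF phi_0 phi_grade, of \<one>] by (simp_all add: phi_1)

lemma psi_closed [simp]: "g \<in> augmentation_ideal R \<Longrightarrow> subst1 R psi g \<in> augmentation_ideal R"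
  by (rule subst1_augmentation[OF psi(1)])

lemma subst2_odd_twist:
  assumes g: "g \<in> augmentation_ideal R" and h: "h \<in> augmentation_ideal R"
  shows "subst2 R (odd_twist R F) g h = subst1 R psi (subst2 R F (subst1 R phi g) (subst1 R phi h))"
proof -
  have "subst2 R (odd_twist R F) g h =
      at2 g h (subst1 R psi (subst2 R F (subst1 R phi (mps_var R VX)) (subst1 R phi (mps_var R VY))))"
    unfolding odd_twist_def Let_def
    using g h by (intro subst2_coeffs2) (auto intro!: augmentation_ideal_carrier)
  also have "\<dots> = subst1 R psi (subst2 R F (subst1 R phi g) (subst1 R phi h))"
    using g h psi(1) phi_substitutable by (simp add: substitutable_coeff)
  finally show ?thesis .
qed

text \<open>Conjugation by the bijection \<open>\<phi>\<close> transports the group structure; since \<open>\<phi>\<close> fixes 0, the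
unit remains 0.\<close>

lemma odd_twist_law: "formal_group_law R (odd_twist R F)"
proof -
  let ?G = "odd_twist R F" and ?x = "mps_var R VX" and ?y = "mps_var R VY" and ?z = "mps_var R VZ"
  have "subst1 R phi \<zero>\<^bsub>mps R\<^esub> = \<zero>\<^bsub>mps R\<^esub>"
    by (simp add: subst1_phi F_unit halve_zero)
  hence "subst2 R ?G ?x \<zero>\<^bsub>mps R\<^esub> = ?x" "subst2 R ?G \<zero>\<^bsub>mps R\<^esub> ?y = ?y"
    by (simp_all add: subst2_odd_twist psi_phi F_unit F_unit_left)
  moreover have "subst2 R ?G ?x ?y = subst2 R ?G ?y ?x"
    by (simp add: subst2_odd_twist F_comm)
  moreover have "subst2 R ?G (subst2 R ?G ?x ?y) ?z = subst2 R ?G ?x (subst2 R ?G ?y ?z)"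
    by (simp add: subst2_odd_twist phi_psi F_assoc)
  moreover have "?G i j \<in> grade R (2 * int i + 2 * int j - 2)" for i j
    unfolding odd_twist_def Let_def
    by (intro homogeneous_coeffs2 homogeneous_subst1 homogeneous_subst2 psi phi_grade F_grade) auto
  ultimately show ?thesis
    using graded unfolding formal_group_law_def Let_def by blast
qed

text \<open>\<open>F'(X, -X) = \<phi>\<^sup>-\<^sup>1(\<phi>(X) +\<^sub>F \<phi>(-X)) = \<phi>\<^sup>-\<^sup>1(\<phi>(X) +\<^sub>F -\<^sub>F \<phi>(X)) = 0\<close>.\<close>

lemma odd_twist_odd: "odd_formal_group_law R (odd_twist R F)"
proof -
  interpret twist: formal_group R "odd_twist R F"
    by unfold_locales (rule odd_twist_law)
  have "subst1 R phi \<zero>\<^bsub>mps R\<^esub> = \<zero>\<^bsub>mps R\<^esub>"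
    by (simp add: subst1_phi F_unit halve_zero)
  hence "subst1 R psi \<zero>\<^bsub>mps R\<^esub> = \<zero>\<^bsub>mps R\<^esub>"
    using psi_phi[of "\<zero>\<^bsub>mps R\<^esub>"] by simp
  thus ?thesis
    by (simp add: twist.odd_iff subst2_odd_twist augmentation_uminus phi_neg)
qed

text \<open>For an odd law, \<open>g\<close> is the group inverse of \<open>-g\<close>, so \<open>\<phi>(g)\<close> is half of the double of \<open>g\<close>.\<close>

lemma odd_twist_of_odd:
  assumes "odd_formal_group_law R F"
  shows "odd_twist R F = F"
proof -
  have odd: "subst2 R F (mps_var R VX) (\<ominus>\<^bsub>mps R\<^esub> mps_var R VX) = \<zero>\<^bsub>mps R\<^esub>"
    using assms by (simp add: odd_iff)
  have neg: "neg (\<ominus>\<^bsub>mps R\<^esub> g) = g" if g: "g \<in> augmentation_ideal R" for g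
    using arg_cong[OF odd, of "at1 g"] g
    by (intro G.inv_equality) (simp_all add: augmentation_uminus)
  have phi: "subst1 R phi g = g" if g: "g \<in> augmentation_ideal R" for g
    using g by (simp add: subst1_phi neg halve_eqI)
  have psi: "subst1 R psi g = g" if g: "g \<in> augmentation_ideal R" for g
    using phi_psi[OF g] phi[of "subst1 R psi g"] g by simp
  show ?thesis
    unfolding odd_twist_def Let_def by (simp add: phi psi coeffs2_subst2)
qed

end

section \<open>Base change\<close>

lemma formal_groupI: "formal_group_law R F \<Longrightarrow> formal_group R F"
  by (auto simp: formal_group_law_def graded_cring_def formal_group_def formal_group_axioms_def
      graded_coefficient_ring_def graded_coefficient_ring_axioms_def coefficient_ring_def)

lemma graded_coefficient_ringI: "graded_cring R \<Longrightarrow> graded_coefficient_ring R"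
  by (auto simp: graded_cring_def
      graded_coefficient_ring_def graded_coefficient_ring_axioms_def coefficient_ring_def)

locale graded_morphism =
  A: graded_coefficient_ring A + B: graded_coefficient_ring B
  for A :: "'a graded_ring" and B :: "'b graded_ring" +
  fixes h :: "'a \<Rightarrow> 'b"
  assumes hom: "h \<in> graded_ring_hom A B"
begin

sublocale H: ring_hom_cring A B h
  by unfold_locales (use hom in \<open>simp add: graded_ring_hom_def\<close>)

lemma hom_grade: "a \<in> grade A n \<Longrightarrow> h a \<in> grade B n"
  using hom by (auto simp: graded_ring_hom_def)

lemma map_carrier [simp]: "f \<in> carrier (mps A) \<Longrightarrow> h \<circ> f \<in> carrier (mps B)"
  by (rule B.mps_memI) simp

lemma map_augmentation [simp]: "f \<in> augmentation_ideal A \<Longrightarrow> h \<circ> f \<in> augmentation_ideal B"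
  by (simp add: augmentation_ideal_def)

lemma map_var [simp]: "h \<circ> mps_var A v = mps_var B v"
  by (auto simp: mps_var_def)

lemma map_zero [simp]: "h \<circ> \<zero>\<^bsub>mps A\<^esub> = \<zero>\<^bsub>mps B\<^esub>"
  by (auto simp: fun_eq_iff)

lemma map_uminus [simp]:
  fixes f :: "var multiset \<Rightarrow> 'a"
  shows "f \<in> carrier (mps A) \<Longrightarrow> h \<circ> (\<ominus>\<^bsub>mps A\<^esub> f) = \<ominus>\<^bsub>mps B\<^esub> (h \<circ> f)"
  by (auto simp: fun_eq_iff)

lemma map_mult:
  fixes f g :: "var multiset \<Rightarrow> 'a"
  assumes "f \<in> carrier (mps A)" "g \<in> carrier (mps A)"
  shows "h \<circ> (f \<otimes>\<^bsub>mps A\<^esub> g) = (h \<circ> f) \<otimes>\<^bsub>mps B\<^esub> (h \<circ> g)"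
proof (rule ext)
  fix m
  show "(h \<circ> (f \<otimes>\<^bsub>mps A\<^esub> g)) m = ((h \<circ> f) \<otimes>\<^bsub>mps B\<^esub> (h \<circ> g)) m"
    using assms by (simp add: A.mps_mult B.mps_mult Pi_def) (intro B.finsum_cong', auto)
qed

lemma map_pow:
  fixes f :: "var multiset \<Rightarrow> 'a" and i :: nat
  assumes "f \<in> carrier (mps A)"
  shows "h \<circ> (f [^]\<^bsub>mps A\<^esub> i) = (h \<circ> f) [^]\<^bsub>mps B\<^esub> i"
proof (induction i)
  case 0
  show ?case by (auto simp: fun_eq_iff mps_one)
next
  case (Suc i)
  have "h \<circ> (f [^]\<^bsub>mps A\<^esub> Suc i) = (h \<circ> f [^]\<^bsub>mps A\<^esub> i) \<otimes>\<^bsub>mps B\<^esub> (h \<circ> f)"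
    using assms by (simp add: map_mult)
  thus ?case by (simp only: Suc B.P.nat_pow_Suc)
qed

lemma map_subst2:
  assumes F: "\<And>i j. F i j \<in> carrier A"
    and f: "f \<in> augmentation_ideal A" and g: "g \<in> augmentation_ideal A"
  shows "h \<circ> subst2 A F f g = subst2 B (\<lambda>i j. h (F i j)) (h \<circ> f) (h \<circ> g)"
proof (rule ext)
  fix m
  have c: "f \<in> carrier (mps A)" "g \<in> carrier (mps A)" using f g by auto
  let ?t = "\<lambda>x. F (fst x) (snd x) \<otimes>\<^bsub>A\<^esub> (f [^]\<^bsub>mps A\<^esub> fst x \<otimes>\<^bsub>mps A\<^esub> g [^]\<^bsub>mps A\<^esub> snd x) m"
  have t: "h (?t x) = h (F (fst x) (snd x)) \<otimes>\<^bsub>B\<^esub>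
      ((h \<circ> f) [^]\<^bsub>mps B\<^esub> fst x \<otimes>\<^bsub>mps B\<^esub> (h \<circ> g) [^]\<^bsub>mps B\<^esub> snd x) m" for x :: "nat \<times> nat"
    using F c by (simp add: map_mult[symmetric] map_pow[symmetric])
  have "(h \<circ> subst2 A F f g) m = h (\<Oplus>\<^bsub>A\<^esub>x\<in>{..size m} \<times> {..size m}. ?t x)"
    by (simp add: A.subst2_extend[OF F f g order_refl])
  also have "\<dots> = (\<Oplus>\<^bsub>B\<^esub>x\<in>{..size m} \<times> {..size m}. h (?t x))"
    using F c by (subst H.hom_finsum) (simp_all add: comp_def)
  also have "\<dots> = subst2 B (\<lambda>i j. h (F i j)) (h \<circ> f) (h \<circ> g) m"
    unfolding t using F
    by (intro B.subst2_extend[OF _ map_augmentation[OF f] map_augmentation[OF g] order_refl, symmetric]) simp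
  finally show "(h \<circ> subst2 A F f g) m = subst2 B (\<lambda>i j. h (F i j)) (h \<circ> f) (h \<circ> g) m" .
qed

lemma map_subst1:
  assumes "\<And>i. c i \<in> carrier A" "g \<in> augmentation_ideal A"
  shows "h \<circ> subst1 A c g = subst1 B (\<lambda>i. h (c i)) (h \<circ> g)"
  using assms by (simp add: A.subst1_eq_subst2 B.subst1_eq_subst2 map_subst2)

lemma map_substitutable: "substitutable A c \<Longrightarrow> substitutable B (\<lambda>i. h (c i))"
  by (simp add: substitutable_def)

end

locale fgl_morphism = graded_morphism + fixes F :: "nat \<Rightarrow> nat \<Rightarrow> 'a"
  assumes source_law: "formal_group_law A F"
begin

sublocale AF: formal_group A F
  by (rule formal_groupI[OF source_law])

text \<open>Oriented against \<open>map_subst2\<close>, so that rewriting with it collects a composite over \<open>B\<close> into the image of a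
composite over \<open>A\<close>, where the laws of the group apply.\<close>

lemma map_subst2_F:
  "f \<in> augmentation_ideal A \<Longrightarrow> g \<in> augmentation_ideal A \<Longrightarrow>
     subst2 B (\<lambda>i j. h (F i j)) (h \<circ> f) (h \<circ> g) = h \<circ> subst2 A F f g"
  by (simp add: map_subst2)

lemma target_law: "formal_group_law B (\<lambda>i j. h (F i j))"
proof -
  let ?x = "mps_var A VX" and ?y = "mps_var A VY" and ?z = "mps_var A VZ" and ?o = "\<zero>\<^bsub>mps A\<^esub>"
  let ?G = "subst2 B (\<lambda>i j. h (F i j))"
  have "?G (h \<circ> ?x) (h \<circ> ?o) = h \<circ> ?x" "?G (h \<circ> ?o) (h \<circ> ?y) = h \<circ> ?y"
    by (simp_all only: map_subst2_F AF.F_unit AF.F_unit_left A.augmentation_var A.augmentation_zero)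
  moreover have "?G (h \<circ> ?x) (h \<circ> ?y) = ?G (h \<circ> ?y) (h \<circ> ?x)"
    by (simp only: map_subst2_F AF.F_comm[of ?x ?y] A.augmentation_var)
  moreover have "?G (?G (h \<circ> ?x) (h \<circ> ?y)) (h \<circ> ?z) = ?G (h \<circ> ?x) (?G (h \<circ> ?y) (h \<circ> ?z))"
    by (simp only: map_subst2_F AF.F_assoc AF.F_augmentation A.augmentation_var)
  moreover have "h (F i j) \<in> grade B (2 * int i + 2 * int j - 2)" for i j
    by (intro hom_grade AF.F_grade)
  ultimately show ?thesis
    using B.graded unfolding formal_group_law_def Let_def map_var map_zero by blast
qed

sublocale BF: formal_group B "\<lambda>i j. h (F i j)"
  by (rule formal_groupI[OF target_law])

lemma odd_target:
  assumes "odd_formal_group_law A F"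
  shows "odd_formal_group_law B (\<lambda>i j. h (F i j))"
proof -
  have "subst2 B (\<lambda>i j. h (F i j)) (h \<circ> mps_var A VX) (h \<circ> (\<ominus>\<^bsub>mps A\<^esub> mps_var A VX)) = \<zero>\<^bsub>mps B\<^esub>"
    using assms AF.odd_iff by (subst map_subst2_F) (simp_all add: A.augmentation_uminus)
  thus ?thesis by (simp add: BF.odd_iff)
qed

text \<open>The inverse series are defined by their characteristic equations, so each commutes with base change
because the image of the solution over \<open>A\<close> solves the equation over \<open>B\<close>.\<close>

lemma neg_series_natural: "neg_series B (\<lambda>i j. h (F i j)) = (\<lambda>i. h (neg_series A F i))"
proof (rule BF.neg_series_unique)
  show "substitutable B (\<lambda>i. h (neg_series A F i))"
    by (intro map_substitutable AF.neg_series)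
  have "h \<circ> subst2 A F (mps_var A VX) (subst1 A (neg_series A F) (mps_var A VX)) = \<zero>\<^bsub>mps B\<^esub>"
    by (simp add: AF.neg_series(3))
  thus "subst2 B (\<lambda>i j. h (F i j)) (mps_var B VX) (subst1 B (\<lambda>i. h (neg_series A F i)) (mps_var B VX)) = \<zero>\<^bsub>mps B\<^esub>"
    using AF.neg_series(1)
    by (simp add: map_subst2 map_subst1 A.substitutable_coeff A.subst1_augmentation)
qed

end

locale half_fgl_morphism = fgl_morphism + fixes half
  assumes source_half: "half \<in> grade A 0" "half \<otimes>\<^bsub>A\<^esub> (\<one>\<^bsub>A\<^esub> \<oplus>\<^bsub>A\<^esub> \<one>\<^bsub>A\<^esub>) = \<one>\<^bsub>A\<^esub>"
begin

sublocale AH: half_formal_group A F half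
  by unfold_locales (rule source_half)+

sublocale BH: half_formal_group B "\<lambda>i j. h (F i j)" "h half"
proof unfold_locales
  show "h half \<in> grade B 0" by (intro hom_grade source_half)
  have "h (half \<otimes>\<^bsub>A\<^esub> (\<one>\<^bsub>A\<^esub> \<oplus>\<^bsub>A\<^esub> \<one>\<^bsub>A\<^esub>)) = \<one>\<^bsub>B\<^esub>" by (simp add: source_half(2))
  thus "h half \<otimes>\<^bsub>B\<^esub> (\<one>\<^bsub>B\<^esub> \<oplus>\<^bsub>B\<^esub> \<one>\<^bsub>B\<^esub>) = \<one>\<^bsub>B\<^esub>"
    using AH.half_closed by simp
qed

lemma half_series_natural: "half_series B (\<lambda>i j. h (F i j)) = (\<lambda>i. h (half_series A F i))"
proof (rule BH.half_series_unique)
  show "substitutable B (\<lambda>i. h (half_series A F i))"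
    by (intro map_substitutable AH.half_series)
  have "h \<circ> subst2 A F (AH.halve (mps_var A VX)) (AH.halve (mps_var A VX)) = mps_var B VX"
    by (simp add: AH.half_series_double)
  thus "subst2 B (\<lambda>i j. h (F i j)) (subst1 B (\<lambda>i. h (half_series A F i)) (mps_var B VX))
      (subst1 B (\<lambda>i. h (half_series A F i)) (mps_var B VX)) = mps_var B VX"
    using AH.half_series(1)
    by (simp add: map_subst2 map_subst1 A.substitutable_coeff A.subst1_augmentation)
qed

lemma phi_series_natural: "phi_series B (\<lambda>i j. h (F i j)) = (\<lambda>i. h (phi_series A F i))"
proof
  fix i
  let ?x = "mps_var A VX"
  have "h \<circ> AH.halve (subst2 A F ?x (subst1 A (neg_series A F) (\<ominus>\<^bsub>mps A\<^esub> ?x))) =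
      BH.halve (subst2 B (\<lambda>i j. h (F i j)) (mps_var B VX)
        (subst1 B (neg_series B (\<lambda>i j. h (F i j))) (\<ominus>\<^bsub>mps B\<^esub> mps_var B VX)))"
    using AH.half_series(1) AF.neg_series(1)
    by (simp add: neg_series_natural half_series_natural map_subst2 map_subst1 A.substitutable_coeff
        A.subst1_augmentation A.augmentation_uminus)
  thus "phi_series B (\<lambda>i j. h (F i j)) i = h (phi_series A F i)"
    unfolding phi_series_def Let_def by (simp add: coeffs1_def fun_eq_iff)
qed

lemma psi_natural:
  "comp_inverse B (phi_series B (\<lambda>i j. h (F i j))) = (\<lambda>i. h (comp_inverse A (phi_series A F) i))"
proof (rule B.subst1_inject)
  let ?x = "mps_var B VX"
  show s: "substitutable B (\<lambda>i. h (AH.psi i))"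
    by (intro map_substitutable AH.psi)
  show "substitutable B BH.psi" by (rule BH.psi)
  have "h \<circ> subst1 A AH.phi (subst1 A AH.psi (mps_var A VX)) = ?x"
    by (simp add: AH.phi_psi)
  hence "subst1 B BH.phi (subst1 B (\<lambda>i. h (AH.psi i)) ?x) = ?x"
    using AH.phi_substitutable AH.psi(1)
    by (simp add: map_subst1 A.substitutable_coeff phi_series_natural)
  hence "subst1 B BH.psi ?x = subst1 B BH.psi (subst1 B BH.phi (subst1 B (\<lambda>i. h (AH.psi i)) ?x))"
    by simp
  thus "subst1 B BH.psi ?x = subst1 B (\<lambda>i. h (AH.psi i)) ?x"
    by (simp add: BH.psi_phi B.subst1_augmentation[OF s])
qed

lemma odd_twist_natural: "odd_twist B (\<lambda>i j. h (F i j)) i j = h (odd_twist A F i j)"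
proof -
  let ?x = "mps_var A VX" and ?y = "mps_var A VY"
  have "h \<circ> subst1 A AH.psi (subst2 A F (subst1 A AH.phi ?x) (subst1 A AH.phi ?y)) =
      subst1 B BH.psi (subst2 B (\<lambda>i j. h (F i j)) (subst1 B BH.phi (mps_var B VX)) (subst1 B BH.phi (mps_var B VY)))"
    using AH.phi_substitutable AH.psi(1) unfolding psi_natural unfolding phi_series_natural
    by (simp add: map_subst2 map_subst1 A.substitutable_coeff)
  thus ?thesis
    unfolding odd_twist_def Let_def by (simp add: coeffs2_def fun_eq_iff)
qed

end

section \<open>Gradings\<close>

text \<open>Unique decomposition into homogeneous components follows from existence of a decomposition and
independence of the grades; these two are easier to transport along homomorphisms.\<close>

lemma graded_cringI:
  fixes R :: "'a graded_ring" (structure)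
  assumes R: "cring R"
    and sub: "\<And>n. additive_subgroup (grade R n) R"
    and one: "\<one> \<in> grade R 0"
    and mult: "\<And>m n x y. x \<in> grade R m \<Longrightarrow> y \<in> grade R n \<Longrightarrow> x \<otimes> y \<in> grade R (m + n)"
    and gen: "\<And>x. x \<in> carrier R \<Longrightarrow> \<exists>I c. finite I \<and> (\<forall>n\<in>I. c n \<in> grade R n) \<and> x = (\<Oplus>n\<in>I. c n)"
    and indep: "\<And>I c n. finite I \<Longrightarrow> (\<And>n. n \<in> I \<Longrightarrow> c n \<in> grade R n) \<Longrightarrow> (\<Oplus>n\<in>I. c n) = \<zero> \<Longrightarrow>
      n \<in> I \<Longrightarrow> c n = \<zero>"
  shows "graded_cring R"
proof -
  interpret cring R by (rule R)
  have closed: "x \<in> carrier R" if "x \<in> grade R n" for x n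
    using additive_subgroup.a_Hcarr[OF sub that] .
  have zero: "\<zero> \<in> grade R n" for n using additive_subgroup.zero_closed[OF sub] .
  have "\<exists>!c. (\<forall>n. c n \<in> grade R n) \<and> finite {n. c n \<noteq> \<zero>} \<and> x = (\<Oplus>n\<in>{n. c n \<noteq> \<zero>}. c n)"
    if x: "x \<in> carrier R" for x
  proof (rule ex_ex1I)
    obtain I c where I: "finite I" "\<forall>n\<in>I. c n \<in> grade R n" "x = (\<Oplus>n\<in>I. c n)"
      using gen[OF x] by blast
    define d where "d n = (if n \<in> I then c n else \<zero>)" for n
    have "(\<Oplus>n\<in>{n. d n \<noteq> \<zero>}. d n) = (\<Oplus>n\<in>I. d n)"
      by (rule finsum_restrict_support) (use I closed in \<open>auto simp: d_def\<close>)
    also have "\<dots> = x"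
      unfolding I(3) by (rule finsum_cong') (use I closed in \<open>auto simp: d_def\<close>)
    finally have "x = (\<Oplus>n\<in>{n. d n \<noteq> \<zero>}. d n)" ..
    moreover have "finite {n. d n \<noteq> \<zero>}"
      by (rule finite_subset[OF _ I(1)]) (auto simp: d_def)
    ultimately show "\<exists>c. (\<forall>n. c n \<in> grade R n) \<and> finite {n. c n \<noteq> \<zero>} \<and> x = (\<Oplus>n\<in>{n. c n \<noteq> \<zero>}. c n)"
      using I zero by (intro exI[of _ d]) (auto simp: d_def)
  next
    fix c d
    assume c: "(\<forall>n. c n \<in> grade R n) \<and> finite {n. c n \<noteq> \<zero>} \<and> x = (\<Oplus>n\<in>{n. c n \<noteq> \<zero>}. c n)"
      and d: "(\<forall>n. d n \<in> grade R n) \<and> finite {n. d n \<noteq> \<zero>} \<and> x = (\<Oplus>n\<in>{n. d n \<noteq> \<zero>}. d n)"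
    define I where "I = {n. c n \<noteq> \<zero>} \<union> {n. d n \<noteq> \<zero>}"
    have I: "finite I" using c d by (simp add: I_def)
    have cl: "c n \<in> carrier R" "d n \<in> carrier R" for n using c d closed by blast+
    have "(\<Oplus>n\<in>{n. c n \<noteq> \<zero>}. c n) = (\<Oplus>n\<in>I. c n)" "(\<Oplus>n\<in>{n. d n \<noteq> \<zero>}. d n) = (\<Oplus>n\<in>I. d n)"
      by (rule finsum_restrict_support; use I cl in \<open>auto simp: I_def\<close>)+
    hence sums: "(\<Oplus>n\<in>I. c n) = x" "(\<Oplus>n\<in>I. d n) = x" using c d by auto
    have "(\<Oplus>n\<in>I. c n \<ominus> d n) \<oplus> x = (\<Oplus>n\<in>I. (c n \<ominus> d n) \<oplus> d n)"
      unfolding sums(2)[symmetric] by (rule finsum_addf[symmetric]) (use cl in auto)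
    also have "\<dots> = (\<Oplus>n\<in>I. c n)"
      by (rule finsum_cong') (use cl in \<open>auto simp: a_minus_def a_assoc l_neg\<close>)
    finally have "(\<Oplus>n\<in>I. c n \<ominus> d n) \<oplus> x = \<zero> \<oplus> x" using sums x by simp
    moreover have "(\<Oplus>n\<in>I. c n \<ominus> d n) \<in> carrier R" using cl by (intro finsum_closed) auto
    ultimately have z: "(\<Oplus>n\<in>I. c n \<ominus> d n) = \<zero>" using x by (metis add.r_cancel zero_closed)
    have g: "c n \<ominus> d n \<in> grade R n" for n
      unfolding a_minus_def
      using c d additive_subgroup.a_closed[OF sub] additive_subgroup.a_inv_closed[OF sub]
        abelian_group_axioms by blast
    show "c = d"
    proof
      fix n
      show "c n = d n"
      proof (cases "n \<in> I")
        case True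
        have "c n \<ominus> d n = \<zero>" by (rule indep[OF I g z True])
        thus ?thesis using cl by simp
      qed (auto simp: I_def)
    qed
  qed
  thus ?thesis using R sub one mult by (simp add: graded_cring_def)
qed

context graded_coefficient_ring
begin

lemma graded_decomposition:
  assumes "x \<in> carrier R"
  obtains I c where "finite I" "\<And>n. c n \<in> grade R n" "x = (\<Oplus>n\<in>I. c n)"
proof -
  have "\<exists>!c. (\<forall>n. c n \<in> grade R n) \<and> finite {n. c n \<noteq> \<zero>} \<and> x = (\<Oplus>n\<in>{n. c n \<noteq> \<zero>}. c n)"
    using graded assms unfolding graded_cring_def by blast
  then obtain c where "(\<forall>n. c n \<in> grade R n) \<and> finite {n. c n \<noteq> \<zero>} \<and> x = (\<Oplus>n\<in>{n. c n \<noteq> \<zero>}. c n)"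
    by (rule ex1E)
  thus thesis by (intro that[of "{n. c n \<noteq> \<zero>}" c]) simp_all
qed

lemma graded_independent:
  assumes I: "finite I" "\<And>n. n \<in> I \<Longrightarrow> c n \<in> grade R n" and zero: "(\<Oplus>n\<in>I. c n) = \<zero>" and n: "n \<in> I"
  shows "c n = \<zero>"
proof -
  define d where "d n = (if n \<in> I then c n else \<zero>)" for n
  have cl: "c n \<in> carrier R" if "n \<in> I" for n using I(2)[OF that] by simp
  have "(\<Oplus>n\<in>{n. d n \<noteq> \<zero>}. d n) = (\<Oplus>n\<in>I. d n)"
    by (rule finsum_restrict_support) (use I cl in \<open>auto simp: d_def\<close>)
  also have "\<dots> = (\<Oplus>n\<in>I. c n)"
    by (rule finsum_cong') (use I cl in \<open>auto simp: d_def\<close>)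
  finally have d: "\<zero> = (\<Oplus>n\<in>{n. d n \<noteq> \<zero>}. d n)" using zero by simp
  let ?P = "\<lambda>c. (\<forall>n. c n \<in> grade R n) \<and> finite {n. c n \<noteq> \<zero>} \<and> \<zero> = (\<Oplus>n\<in>{n. c n \<noteq> \<zero>}. c n)"
  have "finite {n. d n \<noteq> \<zero>}"
    by (rule finite_subset[OF _ I(1)]) (auto simp: d_def)
  moreover have "\<forall>n. d n \<in> grade R n" using I by (simp add: d_def)
  ultimately have Pd: "?P d" using d by (intro conjI)
  have P0: "?P (\<lambda>_. \<zero>)" by simp
  have "\<exists>!c. ?P c"
    using graded zero_closed unfolding graded_cring_def by blast
  then obtain e where e: "\<And>c. ?P c \<Longrightarrow> c = e" by (rule ex1E) blast
  have "d n = \<zero>" using e[OF Pd] fun_cong[OF e[OF P0], of n] by simp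
  thus ?thesis using n by (simp add: d_def)
qed

lemma grade_nat_pow: "x \<in> grade R 0 \<Longrightarrow> x [^] (k::nat) \<in> grade R 0"
  by (induction k) (use grade_mult[of _ 0 _ 0] in auto)

end

section \<open>Inverting 2\<close>

context coefficient_ring
begin

definition two_pow :: "nat \<Rightarrow> 'a" where "two_pow n = (\<one> \<oplus> \<one>) [^] n"

lemma two_pow_closed [simp]: "two_pow n \<in> carrier R"
  by (simp add: two_pow_def)

lemma two_pow_0 [simp]: "two_pow 0 = \<one>"
  by (simp add: two_pow_def)

lemma two_pow_add: "two_pow (m + n) = two_pow m \<otimes> two_pow n"
  by (simp add: two_pow_def nat_pow_mult)

lemma add_pow_two_power:
  assumes a: "a \<in> carrier R"
  shows "add_pow R ((2::nat) ^ n) a = two_pow n \<otimes> a"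
proof (induction n)
  case 0
  show ?case using a by (simp add: two_pow_def)
next
  case (Suc n)
  have "add_pow R ((2::nat) ^ Suc n) a = add_pow R ((2::nat) ^ n) a \<oplus> add_pow R ((2::nat) ^ n) a"
    using a by (subst add.nat_pow_mult) (simp_all add: mult_2)
  also have "\<dots> = two_pow n \<otimes> (\<one> \<oplus> \<one>) \<otimes> a"
    using a by (simp add: Suc l_distr r_distr)
  finally show ?case by (simp add: two_pow_def)
qed

lemma half_frac_iff:
  assumes "a \<in> carrier R"
  shows "(b, l) \<in> half_frac R a k \<longleftrightarrow>
    b \<in> carrier R \<and> (\<exists>m. two_pow (m + l) \<otimes> a = two_pow (m + k) \<otimes> b)"
  using assms by (auto simp: half_frac_def add_pow_two_power)

text \<open>Fractions are defined as sets, and equality of these sets is the usual relation of a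
localization. The point is its transitivity, for which the annihilating powers of 2 are added up.\<close>

lemma half_frac_eq_iff:
  assumes a: "a \<in> carrier R" and b: "b \<in> carrier R"
  shows "half_frac R a k = half_frac R b l \<longleftrightarrow> (\<exists>m. two_pow (m + l) \<otimes> a = two_pow (m + k) \<otimes> b)"
proof -
  have trans: "(c, j) \<in> half_frac R b l"
    if a: "a \<in> carrier R" and b: "b \<in> carrier R" and m: "two_pow (m + l) \<otimes> a = two_pow (m + k) \<otimes> b"
      and c: "(c, j) \<in> half_frac R a k" for a b c k l j m
  proof -
    obtain m' where m': "two_pow (m' + j) \<otimes> a = two_pow (m' + k) \<otimes> c" and cR: "c \<in> carrier R"
      using c a by (auto simp: half_frac_iff)
    have "two_pow (m + m' + k + j) \<otimes> b = two_pow (m' + j) \<otimes> (two_pow (m + k) \<otimes> b)"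
      using b by (simp add: two_pow_add m_ac)
    also have "\<dots> = two_pow (m + l) \<otimes> (two_pow (m' + j) \<otimes> a)"
      unfolding m[symmetric] using a by (simp add: m_lcomm)
    also have "\<dots> = two_pow (m + m' + k + l) \<otimes> c"
      unfolding m' using cR by (simp add: two_pow_add m_ac)
    finally show ?thesis using b cR by (auto simp: half_frac_iff)
  qed
  show ?thesis
  proof
    assume "half_frac R a k = half_frac R b l"
    moreover have "(a, k) \<in> half_frac R a k" using a by (auto simp: half_frac_iff)
    ultimately have "(a, k) \<in> half_frac R b l" by simp
    thus "\<exists>m. two_pow (m + l) \<otimes> a = two_pow (m + k) \<otimes> b"
      using b by (auto simp: half_frac_iff) metis
  next
    assume "\<exists>m. two_pow (m + l) \<otimes> a = two_pow (m + k) \<otimes> b"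
    then obtain m where m: "two_pow (m + l) \<otimes> a = two_pow (m + k) \<otimes> b" ..
    show "half_frac R a k = half_frac R b l"
      using trans[OF a b m] trans[OF b a m[symmetric]] by auto
  qed
qed

lemma half_frac_self: "a \<in> carrier R \<Longrightarrow> (a, k) \<in> half_frac R a k"
  by (auto simp: half_frac_iff)

lemma half_frac_memD:
  assumes "(b, l) \<in> half_frac R a k" "a \<in> carrier R"
  shows "b \<in> carrier R" "half_frac R b l = half_frac R a k"
  using assms half_frac_eq_iff[of a b k l] by (auto simp: half_frac_iff)

lemma half_frac_expand:
  "a \<in> carrier R \<Longrightarrow> half_frac R (two_pow j \<otimes> a) (k + j) = half_frac R a k"
  by (subst half_frac_eq_iff) (auto intro!: exI[of _ 0] simp: two_pow_add m_ac)

abbreviation M where "M \<equiv> invert_two R"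

lemma invert_two_carrier: "carrier M = {half_frac R a k | a k. a \<in> carrier R}"
  and invert_two_one: "\<one>\<^bsub>M\<^esub> = half_frac R \<one> 0"
  and invert_two_zero: "\<zero>\<^bsub>M\<^esub> = half_frac R \<zero> 0"
  and invert_two_grade: "grade M n = {half_frac R a k | a k. a \<in> grade R n}"
  by (simp_all add: invert_two_def)

lemma invert_two_gradeI: "a \<in> grade R n \<Longrightarrow> half_frac R a k \<in> grade M n"
  by (auto simp: invert_two_grade)

lemma half_frac_carrier [simp]: "a \<in> carrier R \<Longrightarrow> half_frac R a k \<in> carrier M"
  by (auto simp: invert_two_carrier)

text \<open>The operations on fractions are unions over all representatives; this reduces them to a computation with
representatives once the result is known to be independent of the choice.\<close>

lemma half_frac_UN:
  assumes a: "a \<in> carrier R" and b: "b \<in> carrier R"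
    and "\<And>a' k' b' l'. (a', k') \<in> half_frac R a k \<Longrightarrow> (b', l') \<in> half_frac R b l \<Longrightarrow> f a' k' b' l' = S"
  shows "(\<Union>(a', k')\<in>half_frac R a k. \<Union>(b', l')\<in>half_frac R b l. f a' k' b' l') = S"
  using assms(3) half_frac_self[OF a, of k] half_frac_self[OF b, of l] by fast

lemma half_frac_mult:
  assumes a: "a \<in> carrier R" and b: "b \<in> carrier R"
  shows "half_frac R a k \<otimes>\<^bsub>M\<^esub> half_frac R b l = half_frac R (a \<otimes> b) (k + l)"
proof -
  have eq: "half_frac R (a' \<otimes> b') (k' + l') = half_frac R (a \<otimes> b) (k + l)"
    if a': "(a', k') \<in> half_frac R a k" and b': "(b', l') \<in> half_frac R b l" for a' k' b' l'
  proof -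
    have c: "a' \<in> carrier R" "b' \<in> carrier R" using a' b' a b by (auto dest: half_frac_memD)
    obtain m where m: "two_pow (m + k') \<otimes> a = two_pow (m + k) \<otimes> a'"
      using a' a by (auto simp: half_frac_iff)
    obtain n where n: "two_pow (n + l') \<otimes> b = two_pow (n + l) \<otimes> b'"
      using b' b by (auto simp: half_frac_iff)
    have "two_pow ((m + n) + (k + l)) \<otimes> (a' \<otimes> b') = (two_pow (m + k) \<otimes> a') \<otimes> (two_pow (n + l) \<otimes> b')"
      using c by (simp add: two_pow_add m_ac)
    also have "\<dots> = (two_pow (m + k') \<otimes> a) \<otimes> (two_pow (n + l') \<otimes> b)" by (simp only: m n)
    also have "\<dots> = two_pow ((m + n) + (k' + l')) \<otimes> (a \<otimes> b)"
      using a b by (simp add: two_pow_add m_ac)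
    finally show ?thesis using a b c by (subst half_frac_eq_iff) auto
  qed
  show ?thesis by (simp add: invert_two_def) (rule half_frac_UN[OF a b], rule eq)
qed

lemma half_frac_add:
  assumes a: "a \<in> carrier R" and b: "b \<in> carrier R"
  shows "half_frac R a k \<oplus>\<^bsub>M\<^esub> half_frac R b l =
    half_frac R (two_pow l \<otimes> a \<oplus> two_pow k \<otimes> b) (k + l)"
proof -
  have eq: "half_frac R (add_pow R ((2::nat) ^ l') a' \<oplus> add_pow R ((2::nat) ^ k') b') (k' + l') =
      half_frac R (two_pow l \<otimes> a \<oplus> two_pow k \<otimes> b) (k + l)"
    if a': "(a', k') \<in> half_frac R a k" and b': "(b', l') \<in> half_frac R b l" for a' k' b' l'
  proof -
    have c: "a' \<in> carrier R" "b' \<in> carrier R" using a' b' a b by (auto dest: half_frac_memD)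
    obtain m where m: "two_pow (m + k') \<otimes> a = two_pow (m + k) \<otimes> a'"
      using a' a by (auto simp: half_frac_iff)
    obtain n where n: "two_pow (n + l') \<otimes> b = two_pow (n + l) \<otimes> b'"
      using b' b by (auto simp: half_frac_iff)
    have "two_pow ((m + n) + (k + l)) \<otimes> (two_pow l' \<otimes> a' \<oplus> two_pow k' \<otimes> b') =
        two_pow (n + l + l') \<otimes> (two_pow (m + k) \<otimes> a') \<oplus> two_pow (m + k + k') \<otimes> (two_pow (n + l) \<otimes> b')"
      using c by (simp add: two_pow_add m_ac r_distr)
    also have "\<dots> = two_pow (n + l + l') \<otimes> (two_pow (m + k') \<otimes> a) \<oplus> two_pow (m + k + k') \<otimes> (two_pow (n + l') \<otimes> b)"
      by (simp only: m n)
    also have "\<dots> = two_pow ((m + n) + (k' + l')) \<otimes> (two_pow l \<otimes> a \<oplus> two_pow k \<otimes> b)"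
      using a b by (simp add: two_pow_add m_ac r_distr)
    finally show ?thesis using a b c
      by (subst half_frac_eq_iff) (auto simp: add_pow_two_power)
  qed
  show ?thesis by (simp add: invert_two_def) (rule half_frac_UN[OF a b], rule eq)
qed

lemma half_frac_add_same:
  assumes a: "a \<in> carrier R" and b: "b \<in> carrier R"
  shows "half_frac R a k \<oplus>\<^bsub>M\<^esub> half_frac R b k = half_frac R (a \<oplus> b) k"
proof -
  have "half_frac R a k \<oplus>\<^bsub>M\<^esub> half_frac R b k = half_frac R (two_pow k \<otimes> (a \<oplus> b)) (k + k)"
    using a b by (simp add: half_frac_add r_distr)
  thus ?thesis using a b by (simp add: half_frac_expand)
qed

text \<open>With one denominator for all fractions, the ring axioms are those of the numerators.\<close>

lemma common_denominator:
  assumes "x \<in> carrier M" "y \<in> carrier M" "z \<in> carrier M"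
  obtains a b c k where "a \<in> carrier R" "b \<in> carrier R" "c \<in> carrier R"
    "x = half_frac R a k" "y = half_frac R b k" "z = half_frac R c k"
proof -
  obtain a k b l c j where abc: "a \<in> carrier R" "b \<in> carrier R" "c \<in> carrier R"
    and xyz: "x = half_frac R a k" "y = half_frac R b l" "z = half_frac R c j"
    using assms by (auto simp: invert_two_carrier)
  have "x = half_frac R (two_pow (l + j) \<otimes> a) (k + l + j)"
    using abc xyz half_frac_expand[of a "l + j" k] by (simp add: add_ac)
  moreover have "y = half_frac R (two_pow (k + j) \<otimes> b) (k + l + j)"
    using abc xyz half_frac_expand[of b "k + j" l] by (simp add: add_ac)
  moreover have "z = half_frac R (two_pow (k + l) \<otimes> c) (k + l + j)"
    using abc xyz half_frac_expand[of c "k + l" j] by (simp add: add_ac)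
  ultimately show thesis using that abc by (metis m_closed two_pow_closed)
qed

lemma half_frac_zero: "half_frac R \<zero> k = \<zero>\<^bsub>M\<^esub>"
  by (simp add: invert_two_zero half_frac_eq_iff)

lemma invert_two_cring: "cring M"
proof (rule cringI)
  show "abelian_group M"
  proof (rule abelian_groupI)
    fix x y z assume x: "x \<in> carrier M" and y: "y \<in> carrier M" and z: "z \<in> carrier M"
    obtain a b c k where "a \<in> carrier R" "b \<in> carrier R" "c \<in> carrier R"
      "x = half_frac R a k" "y = half_frac R b k" "z = half_frac R c k"
      using common_denominator[OF x y z] .
    thus "(x \<oplus>\<^bsub>M\<^esub> y) \<oplus>\<^bsub>M\<^esub> z = x \<oplus>\<^bsub>M\<^esub> (y \<oplus>\<^bsub>M\<^esub> z)"
      by (simp add: half_frac_add_same a_assoc)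
  next
    fix x y assume x: "x \<in> carrier M" and y: "y \<in> carrier M"
    obtain a b k where "a \<in> carrier R" "b \<in> carrier R" "x = half_frac R a k" "y = half_frac R b k"
      using common_denominator[OF x y y] by metis
    thus "x \<oplus>\<^bsub>M\<^esub> y \<in> carrier M" "x \<oplus>\<^bsub>M\<^esub> y = y \<oplus>\<^bsub>M\<^esub> x"
      by (simp_all add: half_frac_add_same a_comm)
  next
    fix x assume "x \<in> carrier M"
    then obtain a k where a: "a \<in> carrier R" "x = half_frac R a k" by (auto simp: invert_two_carrier)
    show "\<zero>\<^bsub>M\<^esub> \<oplus>\<^bsub>M\<^esub> x = x"
      using a by (simp add: half_frac_zero[of k, symmetric] half_frac_add_same)
    show "\<exists>y\<in>carrier M. y \<oplus>\<^bsub>M\<^esub> x = \<zero>\<^bsub>M\<^esub>"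
      by (rule bexI[of _ "half_frac R (\<ominus> a) k"])
         (use a in \<open>simp_all add: half_frac_zero half_frac_add_same l_neg\<close>)
  qed (simp add: invert_two_zero)
  show "comm_monoid M"
  proof (rule comm_monoidI)
    fix x y z assume x: "x \<in> carrier M" and y: "y \<in> carrier M" and z: "z \<in> carrier M"
    obtain a b c k where "a \<in> carrier R" "b \<in> carrier R" "c \<in> carrier R"
      "x = half_frac R a k" "y = half_frac R b k" "z = half_frac R c k"
      using common_denominator[OF x y z] .
    thus "(x \<otimes>\<^bsub>M\<^esub> y) \<otimes>\<^bsub>M\<^esub> z = x \<otimes>\<^bsub>M\<^esub> (y \<otimes>\<^bsub>M\<^esub> z)"
      by (simp add: half_frac_mult m_assoc add_ac)
  next
    fix x y assume x: "x \<in> carrier M" and y: "y \<in> carrier M"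
    obtain a b k where "a \<in> carrier R" "b \<in> carrier R" "x = half_frac R a k" "y = half_frac R b k"
      using common_denominator[OF x y y] by metis
    thus "x \<otimes>\<^bsub>M\<^esub> y \<in> carrier M" "x \<otimes>\<^bsub>M\<^esub> y = y \<otimes>\<^bsub>M\<^esub> x"
      by (simp_all add: half_frac_mult m_comm)
  next
    fix x assume "x \<in> carrier M"
    then obtain a k where a: "a \<in> carrier R" "x = half_frac R a k" by (auto simp: invert_two_carrier)
    thus "\<one>\<^bsub>M\<^esub> \<otimes>\<^bsub>M\<^esub> x = x" by (simp add: invert_two_one half_frac_mult)
  qed (simp add: invert_two_one)
  fix x y z assume x: "x \<in> carrier M" and y: "y \<in> carrier M" and z: "z \<in> carrier M"
  obtain a b c k where "a \<in> carrier R" "b \<in> carrier R" "c \<in> carrier R"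
    "x = half_frac R a k" "y = half_frac R b k" "z = half_frac R c k"
    using common_denominator[OF x y z] .
  thus "(x \<oplus>\<^bsub>M\<^esub> y) \<otimes>\<^bsub>M\<^esub> z = x \<otimes>\<^bsub>M\<^esub> z \<oplus>\<^bsub>M\<^esub> y \<otimes>\<^bsub>M\<^esub> z"
    by (simp add: half_frac_mult half_frac_add_same l_distr)
qed

end

sublocale coefficient_ring \<subseteq> Q: cring "invert_two R"
  by (rule invert_two_cring)

context coefficient_ring
begin

lemma half_frac_uminus: "a \<in> carrier R \<Longrightarrow> \<ominus>\<^bsub>M\<^esub> half_frac R a k = half_frac R (\<ominus> a) k"
  by (rule Q.minus_equality) (simp_all add: half_frac_add_same l_neg half_frac_zero)

lemma half_frac_finsum:
  assumes "\<And>i. i \<in> I \<Longrightarrow> c i \<in> carrier R"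
  shows "half_frac R (\<Oplus>i\<in>I. c i) k = (\<Oplus>\<^bsub>M\<^esub>i\<in>I. half_frac R (c i) k)"
  using assms
proof (induction I rule: infinite_finite_induct)
  case (insert i I)
  have c: "c \<in> I \<rightarrow> carrier R" "c i \<in> carrier R" using insert.prems by auto
  have "half_frac R (\<Oplus>i\<in>insert i I. c i) k = half_frac R (c i) k \<oplus>\<^bsub>M\<^esub> half_frac R (\<Oplus>i\<in>I. c i) k"
    using insert.hyps c by (simp add: finsum_insert half_frac_add_same)
  thus ?case using insert c by (subst Q.finsum_insert) auto
qed (simp_all add: half_frac_zero)

end

context graded_coefficient_ring
begin

lemma grade_two_pow: "two_pow k \<in> grade R 0"
  unfolding two_pow_def by (intro grade_nat_pow grade_add) simp_all

lemma grade_two_pow_mult: "a \<in> grade R n \<Longrightarrow> two_pow k \<otimes> a \<in> grade R n"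
  using grade_mult[OF grade_two_pow, of a n k] by simp

text \<open>Fractions with homogeneous numerators. For independence, bring the finitely many components to a common
denominator; some power of 2 then annihilates the sum of the numerators, hence by independence in \<open>R\<close>
each numerator.\<close>

lemma invert_two_graded: "graded_cring M"
proof (rule graded_cringI)
  show "cring M" by (rule invert_two_cring)
  show "\<one>\<^bsub>M\<^esub> \<in> grade M 0" by (auto simp: invert_two_one invert_two_grade)
  show "x \<otimes>\<^bsub>M\<^esub> y \<in> grade M (m + n)" if xy: "x \<in> grade M m" "y \<in> grade M n" for x y m n
  proof -
    obtain a k b l where "a \<in> grade R m" "b \<in> grade R n" "x = half_frac R a k" "y = half_frac R b l"
      using xy by (auto simp: invert_two_grade)
    thus ?thesis using grade_mult by (auto simp: invert_two_grade half_frac_mult)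
  qed
  show "additive_subgroup (grade M n) M" for n
  proof (rule additive_subgroupI, rule Q.add.subgroupI)
    show "grade M n \<subseteq> carrier M" by (auto simp: invert_two_grade)
    show "grade M n \<noteq> {}" unfolding invert_two_grade using grade_zero[of n] by blast
    show "\<ominus>\<^bsub>M\<^esub> x \<in> grade M n" if x: "x \<in> grade M n" for x
    proof -
      obtain a k where "a \<in> grade R n" "x = half_frac R a k"
        using x by (auto simp: invert_two_grade)
      thus ?thesis by (simp add: half_frac_uminus invert_two_gradeI grade_uminus)
    qed
    show "x \<oplus>\<^bsub>M\<^esub> y \<in> grade M n" if xy: "x \<in> grade M n" "y \<in> grade M n" for x y
    proof -
      obtain a k b l where "a \<in> grade R n" "b \<in> grade R n" "x = half_frac R a k" "y = half_frac R b l"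
        using xy by (auto simp: invert_two_grade)
      thus ?thesis
        by (simp add: half_frac_add invert_two_gradeI grade_add grade_two_pow_mult)
    qed
  qed
  show "\<exists>I c. finite I \<and> (\<forall>n\<in>I. c n \<in> grade M n) \<and> x = (\<Oplus>\<^bsub>M\<^esub>n\<in>I. c n)" if "x \<in> carrier M" for x
  proof -
    obtain a k where a: "a \<in> carrier R" "x = half_frac R a k" using \<open>x \<in> carrier M\<close> by (auto simp: invert_two_carrier)
    obtain I c where I: "finite I" "\<And>n. c n \<in> grade R n" "a = (\<Oplus>n\<in>I. c n)"
      using graded_decomposition[OF a(1)] by metis
    have "c n \<in> carrier R" for n using I(2) by (rule grade_closed)
    hence "half_frac R (\<Oplus>n\<in>I. c n) k = (\<Oplus>\<^bsub>M\<^esub>n\<in>I. half_frac R (c n) k)"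
      by (rule half_frac_finsum)
    hence "x = (\<Oplus>\<^bsub>M\<^esub>n\<in>I. half_frac R (c n) k)" by (simp only: a(2) I(3))
    moreover have "\<forall>n\<in>I. half_frac R (c n) k \<in> grade M n" using I(2) by (simp add: invert_two_gradeI)
    ultimately show ?thesis
      using I(1) by (intro exI[of _ I] exI[of _ "\<lambda>n. half_frac R (c n) k"] conjI)
  qed
  show "c n = \<zero>\<^bsub>M\<^esub>" if I: "finite I" and c: "\<And>n. n \<in> I \<Longrightarrow> c n \<in> grade M n"
    and zero: "(\<Oplus>\<^bsub>M\<^esub>n\<in>I. c n) = \<zero>\<^bsub>M\<^esub>" and n: "n \<in> I" for I c n
  proof -
    have "\<forall>n\<in>I. \<exists>a k. a \<in> grade R n \<and> c n = half_frac R a k" using c unfolding invert_two_grade by blast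
    then obtain a k where a: "\<And>n. n \<in> I \<Longrightarrow> a n \<in> grade R n" "\<And>n. n \<in> I \<Longrightarrow> c n = half_frac R (a n) (k n)"
      by metis
    \<comment> \<open>a common denominator exponent for all components\<close>
    define K where "K = (\<Sum>n\<in>I. k n)"
    define b where "b n = two_pow (K - k n) \<otimes> a n" for n
    have K: "k n + (K - k n) = K" if "n \<in> I" for n
      using I that member_le_sum[of n I k] by (simp add: K_def)
    have b: "b n \<in> grade R n" if "n \<in> I" for n
      unfolding b_def using a(1)[OF that] by (rule grade_two_pow_mult)
    have bc: "b n \<in> carrier R" if "n \<in> I" for n
      using b[OF that] by simp
    have cb: "c n = half_frac R (b n) K" if "n \<in> I" for n
      using half_frac_expand[of "a n" "K - k n" "k n"] a[OF that] K[OF that] by (simp add: b_def)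
    have "(\<Oplus>\<^bsub>M\<^esub>n\<in>I. c n) = (\<Oplus>\<^bsub>M\<^esub>n\<in>I. half_frac R (b n) K)"
      by (rule Q.finsum_cong') (use cb bc in auto)
    also have "\<dots> = half_frac R (\<Oplus>n\<in>I. b n) K"
      by (rule half_frac_finsum[symmetric]) (rule bc)
    finally have "half_frac R (\<Oplus>n\<in>I. b n) K = half_frac R \<zero> 0" using zero by (simp add: invert_two_zero)
    moreover have bsum: "(\<Oplus>n\<in>I. b n) \<in> carrier R" using bc by (intro finsum_closed) auto
    ultimately obtain m where "two_pow m \<otimes> (\<Oplus>n\<in>I. b n) = \<zero>"
      by (auto simp: half_frac_eq_iff)
    hence "(\<Oplus>n\<in>I. two_pow m \<otimes> b n) = \<zero>"
      using I bc by (subst (asm) finsum_rdistr) auto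
    hence "two_pow m \<otimes> b n = \<zero>"
      using graded_independent[OF I, of "\<lambda>n. two_pow m \<otimes> b n"] grade_two_pow_mult[OF b] n by blast
    hence "half_frac R (b n) K = half_frac R \<zero> 0"
      using bc[OF n] by (subst half_frac_eq_iff) auto
    thus ?thesis using cb[OF n] by (simp add: invert_two_zero)
  qed
qed

definition localize :: "'a \<Rightarrow> ('a \<times> nat) set" where
  "localize = restrict (\<lambda>a. half_frac R a 0) (carrier R)"

lemma localize_hom: "localize \<in> graded_ring_hom R M"
proof -
  have "localize \<in> ring_hom R M"
    by (rule ring_hom_memI)
       (simp_all add: localize_def half_frac_mult half_frac_add_same invert_two_one)
  thus ?thesis
    by (auto simp: graded_ring_hom_def localize_def invert_two_grade)
qed

lemma half_in_invert_two:
  "half_frac R \<one> 1 \<in> grade M 0" "half_frac R \<one> 1 \<otimes>\<^bsub>M\<^esub> (\<one>\<^bsub>M\<^esub> \<oplus>\<^bsub>M\<^esub> \<one>\<^bsub>M\<^esub>) = \<one>\<^bsub>M\<^esub>"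
proof -
  show "half_frac R \<one> 1 \<in> grade M 0" by (auto simp: invert_two_grade)
  have "half_frac R (\<one> \<oplus> \<one>) 1 = half_frac R \<one> 0"
    by (subst half_frac_eq_iff) (auto intro!: exI[of _ 0] simp: two_pow_def)
  thus "half_frac R \<one> 1 \<otimes>\<^bsub>M\<^esub> (\<one>\<^bsub>M\<^esub> \<oplus>\<^bsub>M\<^esub> \<one>\<^bsub>M\<^esub>) = \<one>\<^bsub>M\<^esub>"
    by (simp add: invert_two_one half_frac_add_same half_frac_mult)
qed

end

lemma graded_ring_homI:
  assumes "h \<in> ring_hom R S" "h \<in> extensional (carrier R)"
    "\<And>n a. a \<in> grade R n \<Longrightarrow> h a \<in> grade S n"
  shows "h \<in> graded_ring_hom R S"
  using assms by (auto simp: graded_ring_hom_def)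

lemma graded_ring_hom_grade: "h \<in> graded_ring_hom R S \<Longrightarrow> a \<in> grade R n \<Longrightarrow> h a \<in> grade S n"
  by (auto simp: graded_ring_hom_def)

lemma graded_ring_hom_compose:
  assumes R: "graded_cring R" and f: "f \<in> graded_ring_hom R S" and g: "g \<in> graded_ring_hom S T"
  shows "compose (carrier R) g f \<in> graded_ring_hom R T"
proof (rule graded_ring_homI)
  interpret graded_coefficient_ring R by (rule graded_coefficient_ringI[OF R])
  have fg: "f \<in> ring_hom R S" "g \<in> ring_hom S T" using f g by (auto simp: graded_ring_hom_def)
  show "compose (carrier R) g f \<in> ring_hom R T"
    using ring_hom_trans[OF fg] by (auto simp: ring_hom_def compose_def)
  show "compose (carrier R) g f a \<in> grade T n" if a: "a \<in> grade R n" for n a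
    using graded_ring_hom_grade[OF g graded_ring_hom_grade[OF f a]] grade_closed[OF a]
    by (simp add: compose_def)
qed simp

context coefficient_ring
begin

lemma inverse_two_pow:
  assumes v: "v \<in> carrier R" "v \<otimes> (\<one> \<oplus> \<one>) = \<one>"
  shows "v [^] k \<otimes> two_pow k = \<one>"
proof -
  have "v [^] k \<otimes> two_pow k = (v \<otimes> (\<one> \<oplus> \<one>)) [^] k"
    using v(1) by (simp add: two_pow_def nat_pow_distrib)
  thus ?thesis using v(2) by simp
qed

lemma inverse_two_pow_cancel:
  assumes v: "v \<in> carrier R" "v \<otimes> (\<one> \<oplus> \<one>) = \<one>" and a: "a \<in> carrier R"
  shows "v [^] (k + l) \<otimes> (two_pow l \<otimes> a) = v [^] k \<otimes> a"
proof -
  have "v [^] (k + l) \<otimes> (two_pow l \<otimes> a) = (v [^] l \<otimes> two_pow l) \<otimes> (v [^] k \<otimes> a)"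
    using v(1) a by (simp add: nat_pow_mult[symmetric] m_ac)
  thus ?thesis using inverse_two_pow[OF v] v(1) a by simp
qed

text \<open>If \<open>v\<close> is the inverse of 2, the value \<open>v\<^sup>k a\<close> of the fraction \<open>a / 2\<^sup>k\<close> depends only on the fraction.
This and the next lemma serve both homomorphisms out of \<open>R[1/2]\<close> and out of \<open>\<int>[1/2]\<close>.\<close>

lemma fraction_value_unique:
  assumes v: "v \<in> carrier R" "v \<otimes> (\<one> \<oplus> \<one>) = \<one>"
    and ab: "a \<in> carrier R" "b \<in> carrier R"
    and eq: "two_pow (m + l) \<otimes> a = two_pow (m + k) \<otimes> b"
  shows "v [^] k \<otimes> a = v [^] l \<otimes> b"
proof -
  have "v [^] k \<otimes> a = v [^] (k + (m + l)) \<otimes> (two_pow (m + l) \<otimes> a)"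
    using v ab by (simp only: inverse_two_pow_cancel)
  also have "\<dots> = v [^] (l + (m + k)) \<otimes> (two_pow (m + k) \<otimes> b)"
  proof -
    have "k + (m + l) = l + (m + k)" by simp
    thus ?thesis by (simp only: eq)
  qed
  also have "\<dots> = v [^] l \<otimes> b"
    using v ab by (simp only: inverse_two_pow_cancel)
  finally show ?thesis .
qed

lemma fraction_value_add:
  assumes v: "v \<in> carrier R" "v \<otimes> (\<one> \<oplus> \<one>) = \<one>"
    and ab: "a \<in> carrier R" "b \<in> carrier R"
  shows "v [^] (k + l) \<otimes> (two_pow l \<otimes> a \<oplus> two_pow k \<otimes> b) = v [^] k \<otimes> a \<oplus> v [^] l \<otimes> b"
  using inverse_two_pow_cancel[OF v ab(1), of k l] inverse_two_pow_cancel[OF v ab(2), of l k] v(1) ab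
  by (simp add: r_distr add.commute)

end

section \<open>The universal property of inverting 2\<close>

context graded_morphism
begin

lemma map_two_pow: "h (A.two_pow k) = B.two_pow k"
  by (induction k) (simp_all add: A.two_pow_def B.two_pow_def)

lemma extend_to_invert_two:
  assumes v: "v \<in> grade B 0" "v \<otimes>\<^bsub>B\<^esub> (\<one>\<^bsub>B\<^esub> \<oplus>\<^bsub>B\<^esub> \<one>\<^bsub>B\<^esub>) = \<one>\<^bsub>B\<^esub>"
  obtains e where "e \<in> graded_ring_hom (invert_two A) B"
    "\<And>a. a \<in> carrier A \<Longrightarrow> e (half_frac A a 0) = h a"
proof -
  have vc: "v \<in> carrier B" using v by simp
  define e where "e = restrict (\<lambda>x. SOME s. \<exists>a k. a \<in> carrier A \<and> x = half_frac A a k \<and>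
      s = v [^]\<^bsub>B\<^esub> k \<otimes>\<^bsub>B\<^esub> h a) (carrier (invert_two A))"
  have e: "e (half_frac A a k) = v [^]\<^bsub>B\<^esub> k \<otimes>\<^bsub>B\<^esub> h a" if a: "a \<in> carrier A" for a k
  proof -
    have "v [^]\<^bsub>B\<^esub> k \<otimes>\<^bsub>B\<^esub> h a = v [^]\<^bsub>B\<^esub> l \<otimes>\<^bsub>B\<^esub> h b"
      if b: "b \<in> carrier A" "half_frac A a k = half_frac A b l" for b l
    proof -
      obtain m where "A.two_pow (m + l) \<otimes>\<^bsub>A\<^esub> a = A.two_pow (m + k) \<otimes>\<^bsub>A\<^esub> b"
        using a b A.half_frac_eq_iff by blast
      hence "h (A.two_pow (m + l) \<otimes>\<^bsub>A\<^esub> a) = h (A.two_pow (m + k) \<otimes>\<^bsub>A\<^esub> b)" by simp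
      hence "B.two_pow (m + l) \<otimes>\<^bsub>B\<^esub> h a = B.two_pow (m + k) \<otimes>\<^bsub>B\<^esub> h b"
        using a b by (simp add: map_two_pow)
      thus ?thesis using a b by (intro B.fraction_value_unique[OF vc v(2)]) auto
    qed
    hence "(SOME s. \<exists>b l. b \<in> carrier A \<and> half_frac A a k = half_frac A b l \<and>
      s = v [^]\<^bsub>B\<^esub> l \<otimes>\<^bsub>B\<^esub> h b) = v [^]\<^bsub>B\<^esub> k \<otimes>\<^bsub>B\<^esub> h a"
      using a by (intro some_equality) metis+
    thus ?thesis using a by (simp add: e_def)
  qed
  have "e \<in> graded_ring_hom (invert_two A) B"
  proof (rule graded_ring_homI)
    show "e \<in> extensional (carrier (invert_two A))" by (simp add: e_def)
    show "e x \<in> grade B n" if x: "x \<in> grade (invert_two A) n" for x n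
    proof -
      obtain a k where a: "a \<in> grade A n" "x = half_frac A a k"
        using x by (auto simp: A.invert_two_grade)
      thus ?thesis
        using B.grade_mult[OF B.grade_nat_pow[OF v(1)] hom_grade[OF a(1)], of k] by (simp add: e)
    qed
    show "e \<in> ring_hom (invert_two A) B"
    proof (rule ring_hom_memI)
      show "e \<one>\<^bsub>invert_two A\<^esub> = \<one>\<^bsub>B\<^esub>" by (simp add: A.invert_two_one e)
      fix x assume "x \<in> carrier (invert_two A)"
      then obtain a k where a: "a \<in> carrier A" "x = half_frac A a k" by (auto simp: A.invert_two_carrier)
      thus "e x \<in> carrier B" using vc by (simp add: e)
      fix y assume "y \<in> carrier (invert_two A)"
      then obtain b l where b: "b \<in> carrier A" "y = half_frac A b l" by (auto simp: A.invert_two_carrier)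
      show "e (x \<otimes>\<^bsub>invert_two A\<^esub> y) = e x \<otimes>\<^bsub>B\<^esub> e y"
        using a b vc by (simp add: A.half_frac_mult e B.nat_pow_mult[symmetric] B.m_ac)
      show "e (x \<oplus>\<^bsub>invert_two A\<^esub> y) = e x \<oplus>\<^bsub>B\<^esub> e y"
        using a b vc v(2) by (simp add: A.half_frac_add e map_two_pow B.fraction_value_add)
    qed
  qed
  moreover have "e (half_frac A a 0) = h a" if "a \<in> carrier A" for a
    using that e[OF that, of 0] by simp
  ultimately show thesis by (rule that)
qed

end

text \<open>A homomorphism sends \<open>1/2\<close> to the inverse of 2, which is unique, and every fraction is a product of a
power of \<open>1/2\<close> and an element of \<open>A\<close>.\<close>

lemma invert_two_hom_eqI:
  assumes A: "graded_cring A" and B: "graded_cring B"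
    and e: "e \<in> graded_ring_hom (invert_two A) B" "e' \<in> graded_ring_hom (invert_two A) B"
    and eq: "\<And>a. a \<in> carrier A \<Longrightarrow> e (half_frac A a 0) = e' (half_frac A a 0)"
  shows "e = e'"
proof (rule extensionalityI)
  show "e \<in> extensional (carrier (invert_two A))" "e' \<in> extensional (carrier (invert_two A))"
    using e by (auto simp: graded_ring_hom_def)
  interpret A: graded_coefficient_ring A by (rule graded_coefficient_ringI[OF A])
  interpret B: graded_coefficient_ring B by (rule graded_coefficient_ringI[OF B])
  fix x assume x: "x \<in> carrier (invert_two A)"
  then obtain a k where a: "a \<in> carrier A" "x = half_frac A a k" by (auto simp: A.invert_two_carrier)
  have formula: "e x = e (half_frac A \<one>\<^bsub>A\<^esub> 1) [^]\<^bsub>B\<^esub> k \<otimes>\<^bsub>B\<^esub> e (half_frac A a 0)"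
    and inverse: "e (half_frac A \<one>\<^bsub>A\<^esub> 1) \<otimes>\<^bsub>B\<^esub> (\<one>\<^bsub>B\<^esub> \<oplus>\<^bsub>B\<^esub> \<one>\<^bsub>B\<^esub>) = \<one>\<^bsub>B\<^esub>"
    and closed: "e (half_frac A \<one>\<^bsub>A\<^esub> 1) \<in> carrier B"
    if e: "e \<in> graded_ring_hom (invert_two A) B" for e
  proof -
    interpret E: graded_morphism "invert_two A" B e
      by (intro graded_morphism.intro graded_coefficient_ringI graded_morphism_axioms.intro
          A.invert_two_graded B e)
    have pow: "half_frac A \<one>\<^bsub>A\<^esub> 1 [^]\<^bsub>invert_two A\<^esub> k = half_frac A \<one>\<^bsub>A\<^esub> k"
      by (induction k) (simp_all add: A.invert_two_one A.half_frac_mult)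
    have "e (half_frac A \<one>\<^bsub>A\<^esub> 1 [^]\<^bsub>invert_two A\<^esub> k \<otimes>\<^bsub>invert_two A\<^esub> half_frac A a 0) =
        e (half_frac A \<one>\<^bsub>A\<^esub> 1 [^]\<^bsub>invert_two A\<^esub> k) \<otimes>\<^bsub>B\<^esub> e (half_frac A a 0)"
      using a by (intro E.H.hom_mult) simp_all
    also have "e (half_frac A \<one>\<^bsub>A\<^esub> 1 [^]\<^bsub>invert_two A\<^esub> k) = e (half_frac A \<one>\<^bsub>A\<^esub> 1) [^]\<^bsub>B\<^esub> k"
      by (induction k) simp_all
    also have "half_frac A \<one>\<^bsub>A\<^esub> 1 [^]\<^bsub>invert_two A\<^esub> k \<otimes>\<^bsub>invert_two A\<^esub> half_frac A a 0 = x"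
      unfolding pow using a by (simp add: A.half_frac_mult)
    finally show "e x = e (half_frac A \<one>\<^bsub>A\<^esub> 1) [^]\<^bsub>B\<^esub> k \<otimes>\<^bsub>B\<^esub> e (half_frac A a 0)" .
    show "e (half_frac A \<one>\<^bsub>A\<^esub> 1) \<in> carrier B" by simp
    have "e (half_frac A \<one>\<^bsub>A\<^esub> 1 \<otimes>\<^bsub>invert_two A\<^esub> (\<one>\<^bsub>invert_two A\<^esub> \<oplus>\<^bsub>invert_two A\<^esub> \<one>\<^bsub>invert_two A\<^esub>)) = \<one>\<^bsub>B\<^esub>"
      by (simp only: A.half_in_invert_two E.H.hom_one)
    thus "e (half_frac A \<one>\<^bsub>A\<^esub> 1) \<otimes>\<^bsub>B\<^esub> (\<one>\<^bsub>B\<^esub> \<oplus>\<^bsub>B\<^esub> \<one>\<^bsub>B\<^esub>) = \<one>\<^bsub>B\<^esub>"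
      by (simp only: E.H.hom_mult E.H.hom_add E.H.hom_one A.half_frac_carrier A.one_closed
          A.Q.one_closed A.Q.add.m_closed)
  qed
  have "e (half_frac A \<one>\<^bsub>A\<^esub> 1) = e' (half_frac A \<one>\<^bsub>A\<^esub> 1)"
    by (rule B.inv_unique[where x = "\<one>\<^bsub>B\<^esub> \<oplus>\<^bsub>B\<^esub> \<one>\<^bsub>B\<^esub>"])
       (use closed inverse e in \<open>auto simp: B.m_comm\<close>)
  thus "e x = e' x" using formula[OF e(1)] formula[OF e(2)] eq[OF a(1)] by simp
qed

text \<open>The classifying map \<open>R \<rightarrow> S\<close> extends to \<open>R[1/2]\<close>. Uniqueness holds because the restriction to \<open>R\<close> of a
classifying map on \<open>R[1/2]\<close> is again classifying.\<close>

lemma invert_two_universal: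
  fixes S :: "'b graded_ring"
  assumes U: "universal_fgl TYPE('b) R F"
    and S: "formal_group_law S G" "v \<in> grade S 0" "v \<otimes>\<^bsub>S\<^esub> (\<one>\<^bsub>S\<^esub> \<oplus>\<^bsub>S\<^esub> \<one>\<^bsub>S\<^esub>) = \<one>\<^bsub>S\<^esub>"
  shows "\<exists>!e. classifies (invert_two R) (MU_half_fgl R F) S G e"
proof -
  interpret R: formal_group R F
    by (rule formal_groupI) (use U in \<open>simp add: universal_fgl_def\<close>)
  interpret S: formal_group S G
    by (rule formal_groupI[OF S(1)])
  have ex1: "\<exists>!g. classifies R F S G g" using U S(1) by (simp add: universal_fgl_def)
  then obtain g where g: "classifies R F S G g" by blast
  interpret g: graded_morphism R S g
    by (intro graded_morphism.intro graded_coefficient_ringI graded_morphism_axioms.intro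
        R.graded S.graded) (use g in \<open>simp add: classifies_def\<close>)
  obtain e where e: "e \<in> graded_ring_hom (invert_two R) S"
    "\<And>a. a \<in> carrier R \<Longrightarrow> e (half_frac R a 0) = g a"
    using g.extend_to_invert_two[OF S(2,3)] by metis
  have "classifies (invert_two R) (MU_half_fgl R F) S G e"
    using g e by (simp add: classifies_def MU_half_fgl_def)
  moreover have "e' = e" if e': "classifies (invert_two R) (MU_half_fgl R F) S G e'" for e'
  proof (rule invert_two_hom_eqI[OF R.graded S.graded])
    show "e' \<in> graded_ring_hom (invert_two R) S" "e \<in> graded_ring_hom (invert_two R) S"
      using e' e by (auto simp: classifies_def)
    have "classifies R F S G (compose (carrier R) e' R.localize)"
      using e' graded_ring_hom_compose[OF R.graded R.localize_hom, of e' S]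
      by (simp add: classifies_def MU_half_fgl_def compose_def R.localize_def)
    hence "compose (carrier R) e' R.localize = g" using ex1 g by blast
    thus "e' (half_frac R a 0) = e (half_frac R a 0)" if "a \<in> carrier R" for a
      using that e(2) by (auto simp: compose_def R.localize_def dest: fun_cong[of _ _ a])
  qed
  ultimately show ?thesis by blast
qed

section \<open>Algebras over \<open>\<int>[1/2]\<close>\<close>

lemma Z_half_algebra_obtains_half:
  assumes "Z_half_algebra R"
  obtains v where "v \<in> grade R 0" "v \<otimes>\<^bsub>R\<^esub> (\<one>\<^bsub>R\<^esub> \<oplus>\<^bsub>R\<^esub> \<one>\<^bsub>R\<^esub>) = \<one>\<^bsub>R\<^esub>"
proof -
  obtain f where f: "f \<in> graded_ring_hom Z_half R" using assms by (auto simp: Z_half_algebra_def)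
  have hom: "f \<in> ring_hom Z_half R" using f by (simp add: graded_ring_hom_def)
  have Z: "of_int a / 2 ^ k \<in> carrier Z_half" for a k by (auto simp: Z_half_def Let_def)
  have c: "1 / 2 \<in> carrier Z_half" "1 \<in> carrier Z_half" "2 \<in> carrier Z_half"
    using Z[of 1 1] Z[of 1 0] Z[of 2 0] by simp_all
  have ops: "1 / 2 \<otimes>\<^bsub>Z_half\<^esub> (1 \<oplus>\<^bsub>Z_half\<^esub> 1) = \<one>\<^bsub>Z_half\<^esub>" "\<one>\<^bsub>Z_half\<^esub> = 1"
    "1 \<oplus>\<^bsub>Z_half\<^esub> 1 = 2"
    by (simp_all add: Z_half_def Let_def)
  have "1 / 2 \<in> grade Z_half 0" using c by (simp add: Z_half_def Let_def)
  hence "f (1 / 2) \<in> grade R 0" using f by (auto simp: graded_ring_hom_def)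
  moreover have "f (1 / 2) \<otimes>\<^bsub>R\<^esub> (\<one>\<^bsub>R\<^esub> \<oplus>\<^bsub>R\<^esub> \<one>\<^bsub>R\<^esub>) = \<one>\<^bsub>R\<^esub>"
  proof -
    have "\<one>\<^bsub>R\<^esub> = f (1 / 2 \<otimes>\<^bsub>Z_half\<^esub> 2)"
      using ring_hom_one[OF hom] ops by simp
    also have "\<dots> = f (1 / 2) \<otimes>\<^bsub>R\<^esub> f (1 \<oplus>\<^bsub>Z_half\<^esub> 1)"
      using ring_hom_mult[OF hom c(1,3)] ops(3) by simp
    also have "f (1 \<oplus>\<^bsub>Z_half\<^esub> 1) = \<one>\<^bsub>R\<^esub> \<oplus>\<^bsub>R\<^esub> \<one>\<^bsub>R\<^esub>"
      using ring_hom_add[OF hom c(2,2)] ring_hom_one[OF hom] ops(2) by simp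
    finally show ?thesis ..
  qed
  ultimately show thesis by (rule that)
qed

context graded_coefficient_ring
begin

text \<open>Conversely, an inverse \<open>v\<close> of 2 in degree 0 defines the structure map \<open>a / 2\<^sup>k \<mapsto> v\<^sup>k a\<close>.\<close>

lemma Z_half_algebraI:
  assumes v: "v \<in> grade R 0" "v \<otimes> (\<one> \<oplus> \<one>) = \<one>"
  shows "Z_half_algebra R"
proof -
  have vc: "v \<in> carrier R" using v by simp
  define i where "i a = add_pow R (a :: int) \<one>" for a
  have i [simp]: "i a \<in> carrier R" for a unfolding i_def by (rule add.int_pow_closed) simp
  have i_add: "i (a + b) = i a \<oplus> i b" for a b unfolding i_def by (rule add.int_pow_mult) simp
  have i_mult: "i (a * b) = i a \<otimes> i b" for a b
  proof -
    have "i a \<otimes> i b = add_pow R a (\<one> \<otimes> i b)" unfolding i_def by (rule add_pow_ldistr_int) simp_all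
    also have "\<dots> = add_pow R a (add_pow R b \<one>)" by (simp add: i_def)
    also have "\<dots> = i (b * a)" unfolding i_def by (rule add.int_pow_pow) simp
    finally show ?thesis by (simp add: mult.commute)
  qed
  have i_1: "i 1 = \<one>" unfolding i_def by (rule add.int_pow_1) simp
  have i_pow: "i (2 ^ k) = two_pow k" for k
    by (induction k) (simp_all add: i_1 i_mult two_pow_def i_add[of 1 1, simplified] m_comm)
  have i_0: "i 0 = \<zero>" by (simp add: i_def add_pow_def)
  have i_grade: "i a \<in> grade R 0" for a
  proof -
    have nat: "i (int n) \<in> grade R 0" for n
      by (induction n) (simp_all add: i_0 i_add i_1 grade_add)
    show ?thesis
    proof (cases "a \<ge> 0")
      case True
      thus ?thesis using nat[of "nat a"] by simp
    next
      case False
      have "i a \<oplus> i (- a) = \<zero>" by (simp add: i_add[symmetric] i_0)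
      hence "i a = \<ominus> i (- a)" by (intro sum_zero_eq_neg) simp_all
      thus ?thesis using nat[of "nat (- a)"] False grade_uminus by simp
    qed
  qed
  define f where "f = restrict (\<lambda>q. SOME s. \<exists>a k. q = of_int a / 2 ^ k \<and> s = v [^] k \<otimes> i a) (carrier Z_half)"
  have Z: "of_int a / 2 ^ k \<in> carrier Z_half" for a k by (auto simp: Z_half_def Let_def)
  have f: "f (of_int a / 2 ^ k) = v [^] k \<otimes> i a" for a k
  proof -
    have "v [^] l \<otimes> i b = v [^] k \<otimes> i a" if q: "(of_int a / 2 ^ k :: rat) = of_int b / 2 ^ l" for b l
    proof -
      have "(of_int (a * 2 ^ l) :: rat) = of_int (b * 2 ^ k)" using q by (simp add: field_simps)
      hence "a * 2 ^ l = b * 2 ^ k" by (simp only: of_int_eq_iff)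
      hence "two_pow (0 + l) \<otimes> i a = two_pow (0 + k) \<otimes> i b"
        by (metis add_0 i i_mult i_pow m_comm)
      thus ?thesis by (intro fraction_value_unique[where m = 0, OF vc v(2), symmetric]) simp_all
    qed
    hence "(SOME s. \<exists>b l. (of_int a / 2 ^ k :: rat) = of_int b / 2 ^ l \<and> s = v [^] l \<otimes> i b) = v [^] k \<otimes> i a"
      by (intro some_equality) blast+
    thus ?thesis using Z by (simp add: f_def)
  qed
  have "f \<in> graded_ring_hom Z_half R"
  proof (rule graded_ring_homI)
    show "f \<in> extensional (carrier Z_half)" by (simp add: f_def)
    show "f q \<in> grade R n" if q: "q \<in> grade Z_half n" for q n
    proof -
      obtain a k where a: "q = of_int a / 2 ^ k" "n \<noteq> 0 \<Longrightarrow> a = 0"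
      proof (cases "n = 0")
        case True
        thus thesis using that q by (auto simp: Z_half_def Let_def)
      next
        case False
        thus thesis using that[of 0 0] q by (simp add: Z_half_def Let_def)
      qed
      show ?thesis
        using a f[of 0 0] grade_mult[OF grade_nat_pow[OF v(1)] i_grade] vc by (cases "n = 0") (simp_all add: f i_0)
    qed
    show "f \<in> ring_hom Z_half R"
    proof (rule ring_hom_memI)
      have "\<one>\<^bsub>Z_half\<^esub> = of_int 1 / 2 ^ 0" by (simp add: Z_half_def Let_def)
      thus "f \<one>\<^bsub>Z_half\<^esub> = \<one>" by (simp only: f) (simp add: i_1)
      fix p assume "p \<in> carrier Z_half"
      then obtain a k where p: "p = of_int a / 2 ^ k" by (auto simp: Z_half_def Let_def)
      show "f p \<in> carrier R" using vc by (simp add: p f)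
      fix q assume "q \<in> carrier Z_half"
      then obtain b l where q: "q = of_int b / 2 ^ l" by (auto simp: Z_half_def Let_def)
      have "p \<otimes>\<^bsub>Z_half\<^esub> q = of_int (a * b) / 2 ^ (k + l)"
        by (simp add: Z_half_def Let_def p q power_add)
      hence "f (p \<otimes>\<^bsub>Z_half\<^esub> q) = v [^] (k + l) \<otimes> (i a \<otimes> i b)" by (simp only: f i_mult)
      thus "f (p \<otimes>\<^bsub>Z_half\<^esub> q) = f p \<otimes> f q"
        using vc by (simp add: p q f nat_pow_mult[symmetric] m_ac)
      have "p \<oplus>\<^bsub>Z_half\<^esub> q = of_int (2 ^ l * a + 2 ^ k * b) / 2 ^ (k + l)"
        by (simp add: Z_half_def Let_def p q power_add field_simps)
      hence "f (p \<oplus>\<^bsub>Z_half\<^esub> q) = v [^] (k + l) \<otimes> (two_pow l \<otimes> i a \<oplus> two_pow k \<otimes> i b)"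
        by (simp only: f i_add i_mult i_pow)
      thus "f (p \<oplus>\<^bsub>Z_half\<^esub> q) = f p \<oplus> f q"
        using vc v(2) by (simp add: p q f fraction_value_add)
    qed
  qed
  thus ?thesis using graded by (auto simp: Z_half_algebra_def)
qed

end

section \<open>The image of a graded homomorphism\<close>

context graded_morphism
begin

abbreviation N where "N \<equiv> image_graded_ring h A B"

lemma image_simps:
  "carrier N = h ` carrier A" "grade N n = h ` grade A n" "a \<otimes>\<^bsub>N\<^esub> b = a \<otimes>\<^bsub>B\<^esub> b" "a \<oplus>\<^bsub>N\<^esub> b = a \<oplus>\<^bsub>B\<^esub> b"
  "\<one>\<^bsub>N\<^esub> = \<one>\<^bsub>B\<^esub>" "\<zero>\<^bsub>N\<^esub> = \<zero>\<^bsub>B\<^esub>"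
  by (simp_all add: image_graded_ring_def)

lemma image_cring: "cring N"
proof -
  have mem: "\<exists>a. a \<in> carrier A \<and> x = h a" if "x \<in> carrier N" for x
    using that by (auto simp: image_simps)
  have add: "x \<oplus>\<^bsub>N\<^esub> y \<in> carrier N" and mult: "x \<otimes>\<^bsub>N\<^esub> y \<in> carrier N"
    if xy: "x \<in> carrier N" "y \<in> carrier N" for x y
  proof -
    obtain a b where ab: "a \<in> carrier A" "b \<in> carrier A" "x = h a" "y = h b" using mem xy by metis
    have "h (a \<oplus>\<^bsub>A\<^esub> b) \<in> carrier N" "h (a \<otimes>\<^bsub>A\<^esub> b) \<in> carrier N"
      unfolding image_simps by (intro imageI; use ab in simp)+
    thus "x \<oplus>\<^bsub>N\<^esub> y \<in> carrier N" "x \<otimes>\<^bsub>N\<^esub> y \<in> carrier N" using ab by (simp_all add: image_simps)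
  qed
  have zero: "\<zero>\<^bsub>N\<^esub> \<in> carrier N" and one: "\<one>\<^bsub>N\<^esub> \<in> carrier N"
    using imageI[OF A.zero_closed, of h] imageI[OF A.one_closed, of h] by (simp_all add: image_simps)
  show ?thesis
  proof (rule cringI)
    show "abelian_group N"
    proof (rule abelian_groupI)
      fix x assume "x \<in> carrier N"
      then obtain a where a: "a \<in> carrier A" "x = h a" using mem by blast
      hence "h (\<ominus>\<^bsub>A\<^esub> a) \<in> carrier N" unfolding image_simps by (intro imageI) simp
      thus "\<exists>y\<in>carrier N. y \<oplus>\<^bsub>N\<^esub> x = \<zero>\<^bsub>N\<^esub>"
        by (rule bexI[rotated]) (use a in \<open>simp add: image_simps B.l_neg\<close>)
    qed (use add zero in \<open>auto simp: image_simps B.a_assoc intro: B.a_comm\<close>)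
    show "comm_monoid N"
      by (rule comm_monoidI)
        (use mult in \<open>auto simp: image_simps one[unfolded image_simps] B.m_assoc intro: B.m_comm\<close>)
  qed (auto simp: image_simps B.l_distr)
qed

text \<open>Sums in the image are sums in the target, so independence of the grades is inherited from the target.\<close>

lemma image_finsum:
  assumes "\<And>i. i \<in> I \<Longrightarrow> c i \<in> carrier N"
  shows "finsum N c I = finsum B c I"
proof -
  interpret N: cring N by (rule image_cring)
  have sub: "carrier N \<subseteq> carrier B" by (auto simp: image_simps)
  show ?thesis
    using assms
  proof (induction I rule: infinite_finite_induct)
    case (insert i I)
    have "c \<in> I \<rightarrow> carrier N" "c i \<in> carrier N" "c \<in> I \<rightarrow> carrier B" "c i \<in> carrier B"
      using insert.prems sub by auto
    thus ?case using insert by (simp add: N.finsum_insert B.finsum_insert image_simps)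
  qed (simp_all add: image_simps)
qed

lemma image_graded: "graded_cring N"
proof (rule graded_cringI)
  interpret N: cring N by (rule image_cring)
  show "cring N" by (rule image_cring)
  show "\<one>\<^bsub>N\<^esub> \<in> grade N 0"
    using imageI[OF A.grade_one, of h] by (simp add: image_simps)
  show "x \<otimes>\<^bsub>N\<^esub> y \<in> grade N (m + n)" if "x \<in> grade N m" "y \<in> grade N n" for x y m n
    using that A.grade_mult by (auto simp: image_simps simp flip: H.hom_mult)
  show "additive_subgroup (grade N n) N" for n
  proof (rule additive_subgroupI, rule N.add.subgroupI)
    show "grade N n \<subseteq> carrier N" by (auto simp: image_simps)
    show "grade N n \<noteq> {}" using A.grade_zero[of n] unfolding image_simps by blast
    show "\<ominus>\<^bsub>N\<^esub> x \<in> grade N n" if x: "x \<in> grade N n" for x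
    proof -
      obtain a where a: "a \<in> grade A n" "x = h a" using x by (auto simp: image_simps)
      have "\<ominus>\<^bsub>N\<^esub> x = h (\<ominus>\<^bsub>A\<^esub> a)"
        using a by (intro N.minus_equality) (auto simp: image_simps A.l_neg simp flip: H.hom_add H.hom_zero simp del: H.hom_add H.hom_zero H.hom_a_inv)
      thus ?thesis using A.grade_uminus[OF a(1)] by (simp add: image_simps)
    qed
    show "x \<oplus>\<^bsub>N\<^esub> y \<in> grade N n" if "x \<in> grade N n" "y \<in> grade N n" for x y
      using that A.grade_add by (auto simp: image_simps simp flip: H.hom_add)
  qed
  show "\<exists>I c. finite I \<and> (\<forall>n\<in>I. c n \<in> grade N n) \<and> x = (\<Oplus>\<^bsub>N\<^esub>n\<in>I. c n)" if x: "x \<in> carrier N" for x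
  proof -
    obtain a where a: "a \<in> carrier A" "x = h a" using x by (auto simp: image_simps)
    obtain I c where I: "finite I" "\<And>n. c n \<in> grade A n" "a = (\<Oplus>\<^bsub>A\<^esub>n\<in>I. c n)"
      using A.graded_decomposition[OF a(1)] by metis
    have c: "c n \<in> carrier A" for n using I(2) by (rule A.grade_closed)
    have "h (\<Oplus>\<^bsub>A\<^esub>n\<in>I. c n) = (\<Oplus>\<^bsub>B\<^esub>n\<in>I. h (c n))"
      using c by (subst H.hom_finsum) (simp_all add: comp_def)
    also have "\<dots> = (\<Oplus>\<^bsub>N\<^esub>n\<in>I. h (c n))"
      using c by (intro image_finsum[symmetric]) (simp add: image_simps)
    finally have "x = (\<Oplus>\<^bsub>N\<^esub>n\<in>I. h (c n))" by (simp only: a(2) I(3))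
    moreover have "\<forall>n\<in>I. h (c n) \<in> grade N n" using I(2) by (simp add: image_simps)
    ultimately show ?thesis
      using I(1) by (intro exI[of _ I] exI[of _ "\<lambda>n. h (c n)"] conjI)
  qed
  show "c n = \<zero>\<^bsub>N\<^esub>" if I: "finite I" and c: "\<And>n. n \<in> I \<Longrightarrow> c n \<in> grade N n"
    and zero: "(\<Oplus>\<^bsub>N\<^esub>n\<in>I. c n) = \<zero>\<^bsub>N\<^esub>" and n: "n \<in> I" for I c n
  proof -
    have "c n \<in> carrier N" if "n \<in> I" for n using c[OF that] by (auto simp: image_simps)
    hence "(\<Oplus>\<^bsub>B\<^esub>n\<in>I. c n) = \<zero>\<^bsub>B\<^esub>" using zero by (simp add: image_finsum image_simps)
    moreover have "c n \<in> grade B n" if "n \<in> I" for n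
      using c[OF that] hom_grade by (auto simp: image_simps)
    ultimately show ?thesis using B.graded_independent[OF I _ _ n] by (simp add: image_simps)
  qed
qed

lemma image_hom: "h \<in> graded_ring_hom A N"
  using hom by (auto simp: graded_ring_hom_def ring_hom_def image_simps)

lemma image_restrict_hom:
  assumes "g \<in> graded_ring_hom B S"
  shows "restrict g (carrier N) \<in> graded_ring_hom N S"
proof (rule graded_ring_homI)
  have g: "g \<in> ring_hom B S" using assms by (simp add: graded_ring_hom_def)
  interpret N: cring N by (rule image_cring)
  show "restrict g (carrier N) \<in> ring_hom N S"
  proof (rule ring_hom_memI)
    fix x y assume x: "x \<in> carrier N" and y: "y \<in> carrier N"
    have B: "x \<in> carrier B" "y \<in> carrier B" using x y by (auto simp: image_simps)
    have "x \<otimes>\<^bsub>N\<^esub> y \<in> carrier N" "x \<oplus>\<^bsub>N\<^esub> y \<in> carrier N" using x y by simp_all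
    thus "restrict g (carrier N) (x \<otimes>\<^bsub>N\<^esub> y) = restrict g (carrier N) x \<otimes>\<^bsub>S\<^esub> restrict g (carrier N) y"
      "restrict g (carrier N) (x \<oplus>\<^bsub>N\<^esub> y) = restrict g (carrier N) x \<oplus>\<^bsub>S\<^esub> restrict g (carrier N) y"
      using x y ring_hom_mult[OF g B] ring_hom_add[OF g B]
      by (simp_all add: image_simps(3,4))
  next
    show "restrict g (carrier N) \<one>\<^bsub>N\<^esub> = \<one>\<^bsub>S\<^esub>"
      using ring_hom_one[OF g] N.one_closed by (simp add: image_simps(5))
    show "restrict g (carrier N) x \<in> carrier S" if "x \<in> carrier N" for x
      using that ring_hom_closed[OF g] by (auto simp: image_simps)
  qed
  show "restrict g (carrier N) x \<in> grade S n" if x: "x \<in> grade N n" for x n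
  proof -
    obtain a where a: "a \<in> grade A n" "x = h a" using x by (auto simp: image_simps)
    thus ?thesis
      using graded_ring_hom_grade[OF assms hom_grade[OF a(1)]] by (auto simp: image_simps)
  qed
qed simp

end

section \<open>Universality of the odd part\<close>

lemma graded_morphismI:
  "graded_cring A \<Longrightarrow> graded_cring B \<Longrightarrow> h \<in> graded_ring_hom A B \<Longrightarrow> graded_morphism A B h"
  by (intro graded_morphism.intro graded_coefficient_ringI graded_morphism_axioms.intro)

theorem theorem2p2:
  fixes MU :: "'a graded_ring" and F :: "nat \<Rightarrow> nat \<Rightarrow> 'a"
  assumes "universal_fgl TYPE(('a \<times> nat) set) MU F"
    and "universal_fgl TYPE('b) MU F"
  shows "universal_odd_fgl TYPE('b) (odd_MU MU F) (F_odd MU F)"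
proof -
  let ?M = "invert_two MU" and ?F = "MU_half_fgl MU F" and ?F' = "F_odd MU F"
  let ?N = "odd_MU MU F" and ?\<epsilon> = "eps2 MU F" and ?half = "half_frac MU \<one>\<^bsub>MU\<^esub> 1"
  interpret U: formal_group MU F
    by (rule formal_groupI) (use assms(1) in \<open>simp add: universal_fgl_def\<close>)
  interpret L: graded_morphism MU ?M U.localize
    by (intro graded_morphismI U.graded U.invert_two_graded U.localize_hom)
  interpret L: fgl_morphism MU ?M U.localize F
    by unfold_locales (rule U.law)
  have "(\<lambda>i j. U.localize (F i j)) = ?F"
    by (simp add: fun_eq_iff U.localize_def MU_half_fgl_def)
  hence law: "formal_group_law ?M ?F" using L.target_law by simp
  interpret MF: formal_group ?M ?F by (rule formal_groupI[OF law])
  interpret M: half_formal_group ?M ?F ?half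
    by unfold_locales (rule U.half_in_invert_two)+
  have twist: "?F' = odd_twist ?M ?F" by (simp add: F_odd_def)

  \<comment> \<open>by naturality, a map classifying an odd law \<open>G\<close> sends \<open>F'\<close> to the odd twist of \<open>G\<close>, which is \<open>G\<close>\<close>
  have carries: "h (?F' i j) = G i j"
    if S: "Z_half_algebra S" "odd_formal_group_law S G" and h: "classifies ?M ?F S G h"
    for S :: "'c graded_ring" and G h i j
  proof -
    interpret h: graded_morphism ?M S h
      using S h by (intro graded_morphismI) (auto simp: U.invert_two_graded Z_half_algebra_def classifies_def)
    interpret h: half_fgl_morphism ?M S h ?F ?half
      by unfold_locales (rule law U.half_in_invert_two)+
    have hF: "(\<lambda>i j. h (?F i j)) = G" using h by (simp add: fun_eq_iff classifies_def)
    have "odd_twist S (\<lambda>i j. h (?F i j)) = (\<lambda>i j. h (?F i j))"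
      by (rule h.BH.odd_twist_of_odd) (use S hF in simp)
    thus ?thesis using h.odd_twist_natural[of i j] hF twist by simp
  qed
  have universal: "\<exists>!h. classifies ?M ?F S G h"
    if U: "universal_fgl TYPE('c) MU F" and S: "Z_half_algebra S" "formal_group_law S G"
    for S :: "'c graded_ring" and G
  proof -
    obtain v where "v \<in> grade S 0" "v \<otimes>\<^bsub>S\<^esub> (\<one>\<^bsub>S\<^esub> \<oplus>\<^bsub>S\<^esub> \<one>\<^bsub>S\<^esub>) = \<one>\<^bsub>S\<^esub>"
      using Z_half_algebra_obtains_half[OF S(1)] .
    thus ?thesis using invert_two_universal[OF U S(2)] by blast
  qed

  have MZ: "Z_half_algebra ?M"
    by (rule L.B.Z_half_algebraI) (rule U.half_in_invert_two)+
  have F'_odd: "odd_formal_group_law ?M ?F'" unfolding twist by (rule M.odd_twist_odd)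
  hence F'_law: "formal_group_law ?M ?F'" by (simp add: odd_formal_group_law_def)
  have \<epsilon>: "classifies ?M ?F ?M ?F' ?\<epsilon>"
    unfolding eps2_def
    by (rule theI'[of "classifies ?M ?F ?M ?F'"]) (rule universal[OF assms(1) MZ F'_law])
  interpret E: graded_morphism ?M ?M ?\<epsilon>
    by (intro graded_morphismI U.invert_two_graded) (use \<epsilon> in \<open>simp add: classifies_def\<close>)
  have N: "?N = E.N" by (simp add: odd_MU_def)
  \<comment> \<open>\<open>\<epsilon>\<close> classifies the odd law \<open>F'\<close>, so it fixes the coefficients of \<open>F'\<close>\<close>
  have \<epsilon>F': "?\<epsilon> (?F' i j) = ?F' i j" for i j
    by (rule carries[OF MZ F'_odd \<epsilon>])
  interpret EN: graded_morphism ?M ?N ?\<epsilon>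
    by (intro graded_morphismI U.invert_two_graded) (simp_all add: N E.image_graded E.image_hom)
  interpret EN: half_fgl_morphism ?M ?N ?\<epsilon> ?F' ?half
    by unfold_locales (rule F'_law U.half_in_invert_two)+

  \<comment> \<open>the image of \<open>\<epsilon>\<close> with \<open>F'\<close> is the base change of \<open>M\<close> with \<open>F'\<close> along \<open>\<epsilon>\<close>\<close>
  have "Z_half_algebra ?N"
    by (rule EN.B.Z_half_algebraI) (rule EN.BH.half_grade EN.BH.half_two)+
  moreover have "odd_formal_group_law ?N ?F'"
    using EN.odd_target[OF F'_odd] by (simp add: \<epsilon>F')
  moreover have "\<exists>!h. classifies ?N ?F' S G h"
    if S: "Z_half_algebra S" "odd_formal_group_law S G" for S :: "'b graded_ring" and G
  proof -
    have G: "formal_group_law S G" using S by (simp add: odd_formal_group_law_def)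
    obtain h where h: "classifies ?M ?F S G h"
      and h_unique: "\<And>g. classifies ?M ?F S G g \<Longrightarrow> g = h"
      using universal[OF assms(2) S(1) G] by blast
    \<comment> \<open>a map on the image of \<open>\<epsilon>\<close> is determined by its composite with \<open>\<epsilon>\<close>, which classifies \<open>G\<close>\<close>
    have through: "k (?\<epsilon> y) = h y"
      if k: "k \<in> graded_ring_hom ?N S" "\<And>i j. k (?F' i j) = G i j" and y: "y \<in> carrier ?M" for k y
    proof -
      have "classifies ?M ?F S G (compose (carrier ?M) k ?\<epsilon>)"
        using graded_ring_hom_compose[OF U.invert_two_graded EN.hom k(1)] k(2) \<epsilon>
        by (simp add: classifies_def compose_def)
      from fun_cong[OF h_unique[OF this], of y] show ?thesis using y by (simp add: compose_def)
    qed
    let ?k = "restrict h (carrier ?N)"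
    have "?k \<in> graded_ring_hom ?N S"
      using h E.image_restrict_hom[of h S] by (simp add: N classifies_def)
    moreover have "?k (?F' i j) = G i j" for i j
    proof -
      have "?F' i j \<in> carrier ?N" using EN.BF.F_closed[of i j] by (simp add: \<epsilon>F')
      thus ?thesis using carries[OF S h] by simp
    qed
    ultimately have "classifies ?N ?F' S G ?k" by (simp add: classifies_def)
    moreover have "k = k'" if k: "classifies ?N ?F' S G k" and k': "classifies ?N ?F' S G k'" for k k'
    proof (rule extensionalityI)
      show "k \<in> extensional (carrier ?N)" "k' \<in> extensional (carrier ?N)"
        using k k' by (auto simp: classifies_def graded_ring_hom_def)
      show "k x = k' x" if x: "x \<in> carrier ?N" for x
      proof -
        obtain y where "y \<in> carrier ?M" "x = ?\<epsilon> y" using x by (auto simp: N E.image_simps)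
        thus ?thesis using through[of k y] through[of k' y] k k' by (simp add: classifies_def)
      qed
    qed
    ultimately show ?thesis by blast
  qed
  ultimately show ?thesis by (simp add: universal_odd_fgl_def)
qed

end
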